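(* Let $d\ge 1$, let $G$ be a subgroup of the unitary group $\mathcal U(M_d)$ of $M_d=M_d(\mathbb C)$, and let $\mathfrak A\subset\mathfrak B=\bigotimes_{i\in\mathbb Z}M_d$ be the associated gauge-invariant $C^*$-algebra. Let $E:M_d\otimes M_d\to M_d$ be a $G$-covariant completely positive map and $\rho$ a state on $M_d$ such that the triple $(M_d,E,\rho)$ generates a $C^*$-finitely correlated state $\tilde\phi$ on $\mathfrak B$, and let $\phi=\tilde\phi|\mathfrak A$ be the generalized quantum Markov chain on $\mathfrak A$ generated by $E$ and $\rho$. Then the mean entropies of $\phi$ and $\tilde\phi$ coincide: \[ s(\phi)=s(\tilde\phi). \]
   Context: **Algebras.** For $i\in\mathbb Z$ let $\mathfrak B_i=M_d=M_d(\mathbb C)$, let $\mathfrak B=\bigotimes_{i\in\mathbb Z}\mathfrak B_i$ be the infinite $C^*$-tensor product, and for $\Lambda\subset\mathbb Z$ let $\mathfrak B_\Lambda=\bigotimes_{i\in\Lambda}\mathfrak B_i\subset\mathfrak B$. For integers $a\le b$, $[a,b]$ denotes the set of integers from $a$ to $b$. For $g\in G$ let $\alpha_g$ be the automorphism of $\mathfrak B$ acting on each $\mathfrak B_\Lambda$ ($\Lambda$ finite) as $\mathrm{Ad}\,g^{\otimes|\Lambda|}$. For finite $\Lambda\subset\mathbb Z$ put $\mathfrak A_\Lambda=(\mathfrak B_\Lambda)^G=\{B\in\mathfrak B_\Lambda:\alpha_g(B)=B\ \text{for all } g\in G\}$, and let $\mathfrak A=\overline{\bigcup_{n\ge1}\mathfrak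 A_{[-n,n]}}$ (the gauge-invariant $C^*$-algebra). **$C^*$-finitely correlated state.** A state $\tilde\phi$ on $\mathfrak B$ is called $C^*$-finitely correlated, generated by the triple $(\mathfrak C,E,\rho)$, if $\mathfrak C$ is a finite-dimensional $C^*$-algebra, $E:M_d\otimes\mathfrak C\to\mathfrak C$ is a completely positive map and $\rho$ is a state on $\mathfrak C$ such that $\rho(E(1_{M_d}\otimes C))=\rho(C)$ for all $C\in\mathfrak C$ and \[ \tilde\phi(A_1\otimes\cdots\otimes A_n)=\rho(E(A_1\otimes E(A_2\otimes\cdots\otimes E(A_n\otimes 1_{\mathfrak C})\cdots))) \] for all $n$ and all $A_1,\dots,A_n\in M_d$. Such a state is translation-invariant. Here $\mathfrak C=M_d$. **$G$-covariance and generalized quantum Markov chain.** $E:M_d\otimes M_d\to M_d$ is $G$-covariant if $E(g^{\otimes2}(A\otimes B)g^{\otimes2*})=gE(A\otimes B)g^*$ for all $A,B\in M_d$, $g\in G$. For a $C^*$-finitely correlated state $\tilde\phi$ generated by $(M_d,E,\rho)$ with $E$ $G$-covariant, the state $\phi=\tilde\phi|\mathfrak A$ is called the generalized (quantum) Markov chain on $\mathfrak A$ generated by $E$ and $\rho$. **Mean entropy.** For a state $\psi$ on a finite-dimensional $C^*$-algebra $\mathfrak N\cong\bigoplus_i M_{d_i}$, its density matrix $D_\psi$ is taken with respect to the canonical trace on $\mathfrak N$ (value $1$ on every minimal projection), and $S(D)=-\mathrm{Tr}\,D\log D$ is the von Neumann entropy. Let $\tilde D_{[1,n]}$ and $D_{[1,n]}$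 be the density matrices of $\tilde\phi|\mathfrak B_{[1,n]}$ and $\phi|\mathfrak A_{[1,n]}$ respectively. Then $s(\tilde\phi)=\lim_{n\to\infty}\frac1nS(\tilde D_{[1,n]})$ and $s(\phi)=\lim_{n\to\infty}\frac1nS(D_{[1,n]})$. *)

theory Defs
  imports "HOL-Analysis.Analysis" "HOL-Algebra.Group" "HOL-Library.Nonpos_Ints"
begin

section \<open>Matrices\<close>

text \<open>
  \<open>M_d\<close> is \<open>complex^'d^'d\<close> with \<open>d = CARD('d)\<close> (so \<open>d \<ge> 1\<close>), and \<open>M_d \<otimes> M_d\<close> is
  \<open>complex^('d \<times> 'd)^('d \<times> 'd)\<close>, the elementary tensors being Kronecker products.
\<close>

definition mat_scale :: "complex \<Rightarrow> complex^'n^'m \<Rightarrow> complex^'n^'m" where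
  "mat_scale c A = (\<chi> i j. c * A $ i $ j)"

definition mat_adj :: "complex^'n^'m \<Rightarrow> complex^'m^'n" where
  "mat_adj A = (\<chi> i j. cnj (A $ j $ i))"

definition kron :: "complex^'n^'n \<Rightarrow> complex^'m^'m \<Rightarrow> complex^('n \<times> 'm)^('n \<times> 'm)" where
  "kron A B = (\<chi> p q. A $ fst p $ fst q * B $ snd p $ snd q)"

definition unitary_group :: "(complex^'d^'d) monoid" where
  "unitary_group =
     \<lparr>carrier = {U. mat_adj U ** U = mat 1 \<and> U ** mat_adj U = mat 1},
      monoid.mult = (**), one = mat 1\<rparr>"

definition mat_linear :: "(complex^'a^'a \<Rightarrow> complex^'b^'b) \<Rightarrow> bool" where
  "mat_linear T \<longleftrightarrow>
     (\<forall>X Y. T (X + Y) = T X + T Y) \<and> (\<forall>c X. T (mat_scale c X) = mat_scale c (T X))"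

text \<open>
  Positivity of the block matrix \<open>[X i j]\<close>, \<open>i, j < n\<close>, in \<open>M_n(M_a)\<close>, acting on \<open>n\<close>-tuples
  of vectors in \<open>\<complex>\<^sup>a\<close>.
\<close>

definition block_positive :: "nat \<Rightarrow> (nat \<Rightarrow> nat \<Rightarrow> complex^'a^'a) \<Rightarrow> bool" where
  "block_positive n X \<longleftrightarrow>
     (\<forall>v :: nat \<Rightarrow> complex^'a.
        (\<Sum>i<n. \<Sum>j<n. \<Sum>k\<in>UNIV. cnj (v i $ k) * (X i j *v v j) $ k) \<in> \<real>\<^sub>\<ge>\<^sub>0)"

definition completely_positive :: "(complex^'a^'a \<Rightarrow> complex^'b^'b) \<Rightarrow> bool" where
  "completely_positive T \<longleftrightarrow> mat_linear T \<and>
     (\<forall>n X. block_positive n X \<longrightarrow> block_positive n (\<lambda>i j. T (X i j)))"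

definition matrix_state :: "(complex^'d^'d \<Rightarrow> complex) \<Rightarrow> bool" where
  "matrix_state \<rho> \<longleftrightarrow>
     (\<forall>X Y. \<rho> (X + Y) = \<rho> X + \<rho> Y) \<and>
     (\<forall>c X. \<rho> (mat_scale c X) = c * \<rho> X) \<and>
     (\<forall>X :: complex^'d^'d. \<rho> (mat_adj X ** X) \<in> \<real>\<^sub>\<ge>\<^sub>0) \<and>
     \<rho> (mat 1) = 1"

definition covariant ::
  "(complex^'d^'d) set \<Rightarrow> (complex^('d \<times> 'd)^('d \<times> 'd) \<Rightarrow> complex^'d^'d) \<Rightarrow> bool" where
  "covariant G E \<longleftrightarrow>
     (\<forall>g\<in>G. \<forall>A B. E (kron g g ** kron A B ** mat_adj (kron g g)) =
                   g ** E (kron A B) ** mat_adj g)"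

section \<open>The infinite tensor product\<close>

text \<open>
  The infinite \<open>C\<^sup>*\<close>-tensor product of copies of \<open>M_d\<close> over the integers is realized faithfully
  on the Hilbert space \<open>\<ell>\<^sup>2(int \<Rightarrow> 'd)\<close>: an element of \<open>M_d\<close> at site \<open>i\<close> acts on the \<open>i\<close>-th
  coordinate of a configuration. A bounded operator \<open>T\<close> is identified with its matrix
  \<open>K \<omega> \<eta> = \<langle>\<delta>\<^sub>\<omega>, T \<delta>\<^sub>\<eta>\<rangle>\<close>. The local
  operators form an increasing union of full matrix algebras, which carries only one \<open>C\<^sup>*\<close>-norm,
  so their operator-norm closure is the infinite \<open>C\<^sup>*\<close>-tensor product.
\<close>

type_synonym 'd kernel = "(int \<Rightarrow> 'd) \<Rightarrow> (int \<Rightarrow> 'd) \<Rightarrow> complex"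

definition kadd :: "'d kernel \<Rightarrow> 'd kernel \<Rightarrow> 'd kernel" where
  "kadd K L = (\<lambda>\<omega> \<eta>. K \<omega> \<eta> + L \<omega> \<eta>)"

definition kscale :: "complex \<Rightarrow> 'd kernel \<Rightarrow> 'd kernel" where
  "kscale c K = (\<lambda>\<omega> \<eta>. c * K \<omega> \<eta>)"

definition kzero :: "'d kernel" where
  "kzero = (\<lambda>\<omega> \<eta>. 0)"

definition kone :: "'d kernel" where
  "kone = (\<lambda>\<omega> \<eta>. if \<omega> = \<eta> then 1 else 0)"

text \<open>Rows and columns of a bounded operator are square-summable, so the sum converges absolutely.\<close>

definition kmult :: "'d kernel \<Rightarrow> 'd kernel \<Rightarrow> 'd kernel" where
  "kmult K L = (\<lambda>\<omega> \<eta>. \<Sum>\<^sub>\<infinity>\<xi>\<in>UNIV. K \<omega> \<xi> * L \<xi> \<eta>)"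

definition kadj :: "'d kernel \<Rightarrow> 'd kernel" where
  "kadj K = (\<lambda>\<omega> \<eta>. cnj (K \<eta> \<omega>))"

text \<open>The operator norm of \<open>K\<close> is at most \<open>c\<close>, tested on finitely supported vectors.\<close>

definition knorm_le :: "'d kernel \<Rightarrow> real \<Rightarrow> bool" where
  "knorm_le K c \<longleftrightarrow> c \<ge> 0 \<and>
     (\<forall>S x y. finite S \<longrightarrow>
        cmod (\<Sum>\<omega>\<in>S. \<Sum>\<eta>\<in>S. cnj (x \<omega>) * K \<omega> \<eta> * y \<eta>) \<le>
          c * sqrt (\<Sum>\<omega>\<in>S. (cmod (x \<omega>))\<^sup>2) * sqrt (\<Sum>\<eta>\<in>S. (cmod (y \<eta>))\<^sup>2))"

definition kclosure :: "'d kernel set \<Rightarrow> 'd kernel set" where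
  "kclosure N = {K. \<forall>\<epsilon>>0. \<exists>L\<in>N. knorm_le (\<lambda>\<omega> \<eta>. K \<omega> \<eta> - L \<omega> \<eta>) \<epsilon>}"

definition agree_on :: "int set \<Rightarrow> (int \<Rightarrow> 'd) \<Rightarrow> (int \<Rightarrow> 'd) \<Rightarrow> bool" where
  "agree_on \<Lambda> \<omega> \<eta> \<longleftrightarrow> (\<forall>i\<in>\<Lambda>. \<omega> i = \<eta> i)"

text \<open>
  For finite \<open>\<Lambda>\<close>, the operators \<open>T \<otimes> 1\<close> with \<open>T\<close> acting on the coordinates in \<open>\<Lambda>\<close>: the kernel
  vanishes unless its arguments agree off \<open>\<Lambda>\<close>, and then depends only on their restrictions to \<open>\<Lambda>\<close>.
\<close>

definition local_algebra :: "int set \<Rightarrow> 'd kernel set" where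
  "local_algebra \<Lambda> = {K.
     (\<forall>\<omega> \<eta>. \<not> agree_on (- \<Lambda>) \<omega> \<eta> \<longrightarrow> K \<omega> \<eta> = 0) \<and>
     (\<forall>\<omega> \<eta> \<omega>' \<eta>'. agree_on (- \<Lambda>) \<omega> \<eta> \<longrightarrow> agree_on (- \<Lambda>) \<omega>' \<eta>' \<longrightarrow>
        agree_on \<Lambda> \<omega> \<omega>' \<longrightarrow> agree_on \<Lambda> \<eta> \<eta>' \<longrightarrow> K \<omega> \<eta> = K \<omega>' \<eta>')}"

definition tensor_algebra :: "'d kernel set" where
  "tensor_algebra = kclosure (\<Union>n\<in>{1::nat..}. local_algebra {- int n..int n})"

text \<open>For finite \<open>\<Lambda>\<close>, the elementary tensor with factor \<open>a i\<close> at each site \<open>i \<in> \<Lambda>\<close>.\<close>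

definition site_tensor :: "int set \<Rightarrow> (int \<Rightarrow> complex^'d^'d) \<Rightarrow> 'd kernel" where
  "site_tensor \<Lambda> a =
     (\<lambda>\<omega> \<eta>. if agree_on (- \<Lambda>) \<omega> \<eta> then \<Prod>i\<in>\<Lambda>. a i $ \<omega> i $ \<eta> i else 0)"

definition gauge_action :: "int set \<Rightarrow> complex^'d^'d \<Rightarrow> 'd kernel \<Rightarrow> 'd kernel" where
  "gauge_action \<Lambda> g K =
     kmult (kmult (site_tensor \<Lambda> (\<lambda>_. g)) K) (kadj (site_tensor \<Lambda> (\<lambda>_. g)))"

definition gauge_local_algebra :: "(complex^'d^'d) set \<Rightarrow> int set \<Rightarrow> 'd kernel set" where
  "gauge_local_algebra G \<Lambda> = {K \<in> local_algebra \<Lambda>. \<forall>g\<in>G. gauge_action \<Lambda> g K = K}"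

definition gauge_algebra :: "(complex^'d^'d) set \<Rightarrow> 'd kernel set" where
  "gauge_algebra G = kclosure (\<Union>n\<in>{1::nat..}. gauge_local_algebra G {- int n..int n})"

section \<open>States\<close>

definition state_on :: "'d kernel set \<Rightarrow> ('d kernel \<Rightarrow> complex) \<Rightarrow> bool" where
  "state_on N \<psi> \<longleftrightarrow>
     (\<forall>K\<in>N. \<forall>L\<in>N. \<psi> (kadd K L) = \<psi> K + \<psi> L) \<and>
     (\<forall>c. \<forall>K\<in>N. \<psi> (kscale c K) = c * \<psi> K) \<and>
     (\<forall>K\<in>N. \<psi> (kmult (kadj K) K) \<in> \<real>\<^sub>\<ge>\<^sub>0) \<and>
     \<psi> kone = 1"

text \<open>
  The defining formula is required for \<open>A\<^sub>1 \<otimes> \<dots> \<otimes> A\<^sub>n\<close> placed at any \<open>n\<close> consecutive sites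
  \<open>k + 1, \<dots>, k + n\<close>; this is what determines the state on the two-sided chain and makes it
  translation-invariant.
\<close>

definition finitely_correlated ::
  "(complex^('d::finite \<times> 'd)^('d \<times> 'd) \<Rightarrow> complex^'d^'d) \<Rightarrow> (complex^'d^'d \<Rightarrow> complex) \<Rightarrow>
     ('d kernel \<Rightarrow> complex) \<Rightarrow> bool" where
  "finitely_correlated E \<rho> \<psi> \<longleftrightarrow>
     completely_positive E \<and> matrix_state \<rho> \<and> state_on tensor_algebra \<psi> \<and>
     (\<forall>C. \<rho> (E (kron (mat 1) C)) = \<rho> C) \<and>
     (\<forall>k As. \<psi> (site_tensor {k + 1..k + int (length As)} (\<lambda>i. As ! nat (i - k - 1))) =
        \<rho> (foldr (\<lambda>A C. E (kron A C)) As (mat 1)))"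

text \<open>The generalized Markov chain: the restriction of a finitely correlated state.\<close>

definition markov_chain ::
  "(complex^'d^'d) set \<Rightarrow> ('d kernel \<Rightarrow> complex) \<Rightarrow> 'd kernel \<Rightarrow> complex" where
  "markov_chain G \<psi> = restrict \<psi> (gauge_algebra G)"

section \<open>Entropy\<close>

text \<open>
  Below, \<open>N\<close> is a finite-dimensional unital \<open>*\<close>-subalgebra of some \<open>local_algebra \<Lambda>\<close>.
  Projections there are self-adjoint idempotents.
\<close>

definition projection_in :: "'d kernel set \<Rightarrow> 'd kernel \<Rightarrow> bool" where
  "projection_in N p \<longleftrightarrow> p \<in> N \<and> kadj p = p \<and> kmult p p = p"

definition minimal_projection :: "'d kernel set \<Rightarrow> 'd kernel \<Rightarrow> bool" where
  "minimal_projection N p \<longleftrightarrow> projection_in N p \<and> p \<noteq> kzero \<and>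
     (\<forall>q. projection_in N q \<and> kmult q p = q \<longrightarrow> q = kzero \<or> q = p)"

definition is_canonical_trace :: "'d kernel set \<Rightarrow> ('d kernel \<Rightarrow> complex) \<Rightarrow> bool" where
  "is_canonical_trace N \<tau> \<longleftrightarrow> \<tau> \<in> extensional N \<and>
     (\<forall>K\<in>N. \<forall>L\<in>N. \<tau> (kadd K L) = \<tau> K + \<tau> L) \<and>
     (\<forall>c. \<forall>K\<in>N. \<tau> (kscale c K) = c * \<tau> K) \<and>
     (\<forall>K\<in>N. \<forall>L\<in>N. \<tau> (kmult K L) = \<tau> (kmult L K)) \<and>
     (\<forall>p. minimal_projection N p \<longrightarrow> \<tau> p = 1)"

definition canonical_trace :: "'d kernel set \<Rightarrow> 'd kernel \<Rightarrow> complex" where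
  "canonical_trace N = (THE \<tau>. is_canonical_trace N \<tau>)"

definition density :: "'d kernel set \<Rightarrow> ('d kernel \<Rightarrow> complex) \<Rightarrow> 'd kernel" where
  "density N \<psi> = (THE D. D \<in> N \<and> (\<forall>K\<in>N. \<psi> K = canonical_trace N (kmult D K)))"

text \<open>\<open>D = (\<Sum>\<lambda>\<in>F. \<lambda> P\<^sub>\<lambda>)\<close> with mutually orthogonal projections in \<open>N\<close> adding up to the unit.\<close>

definition spectral_resolution ::
  "'d kernel set \<Rightarrow> 'd kernel \<Rightarrow> real set \<Rightarrow> (real \<Rightarrow> 'd kernel) \<Rightarrow> bool" where
  "spectral_resolution N D F P \<longleftrightarrow> finite F \<and>
     (\<forall>l\<in>F. projection_in N (P l)) \<and>
     (\<forall>l\<in>F. \<forall>m\<in>F. l \<noteq> m \<longrightarrow> kmult (P l) (P m) = kzero) \<and>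
     kone = (\<lambda>\<omega> \<eta>. \<Sum>l\<in>F. P l \<omega> \<eta>) \<and>
     D = (\<lambda>\<omega> \<eta>. \<Sum>l\<in>F. of_real l * P l \<omega> \<eta>)"

definition functional_calculus ::
  "'d kernel set \<Rightarrow> (real \<Rightarrow> real) \<Rightarrow> 'd kernel \<Rightarrow> 'd kernel" where
  "functional_calculus N f D =
     (THE X. \<exists>F P. spectral_resolution N D F P \<and>
        X = (\<lambda>\<omega> \<eta>. \<Sum>l\<in>F. of_real (f l) * P l \<omega> \<eta>))"

text \<open>
  \<open>S(D) = - Tr D log D\<close> for the density \<open>D\<close> of \<open>\<psi>\<close> on \<open>N\<close>. The value \<open>ln 0\<close> is immaterial, as
  it is multiplied by the eigenvalue \<open>0\<close>.
\<close>

definition entropy :: "'d kernel set \<Rightarrow> ('d kernel \<Rightarrow> complex) \<Rightarrow> real" where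
  "entropy N \<psi> =
     - Re (canonical_trace N (kmult (density N \<psi>) (functional_calculus N ln (density N \<psi>))))"

text \<open>
  Here \<open>\<A>\<close> is the net of local algebras. The junk value of \<open>lim\<close> for divergent sequences makes
  convergence a separate assertion.
\<close>

definition entropy_rate :: "(int set \<Rightarrow> 'd kernel set) \<Rightarrow> ('d kernel \<Rightarrow> complex) \<Rightarrow> nat \<Rightarrow> real" where
  "entropy_rate \<A> \<psi> n = entropy (\<A> {1..int n}) \<psi> / real n"

definition mean_entropy :: "(int set \<Rightarrow> 'd kernel set) \<Rightarrow> ('d kernel \<Rightarrow> complex) \<Rightarrow> real" where
  "mean_entropy \<A> \<psi> = lim (entropy_rate \<A> \<psi>)"

end

theory Submission
  imports Defs
    "HOL-Library.Function_Algebras"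
    "HOL-Computational_Algebra.Fundamental_Theorem_Algebra"
    "HOL-Real_Asymp.Real_Asymp"
begin

text \<open>
  Write \<open>\<eta>(x) = - x ln x\<close>. The entropy of a state on a finite-dimensional \<open>*\<close>-algebra \<open>N\<close> is the
  minimum of \<open>\<Sum> \<eta>(\<phi>(p))\<close> over all partitions of the unit into minimal projections \<open>p\<close> of \<open>N\<close>;
  hence any orthogonal partition \<open>R\<^sub>1, \<dots>, R\<^sub>m\<close> of the unit into projections of rank at most \<open>r\<close>
  gives \<open>S \<le> \<Sum> \<eta>(\<phi>(R\<^sub>k)) + ln r\<close>.

  Let \<open>M\<close> be the full algebra of \<open>n\<close> sites and \<open>N\<close> the commutant of the unitaries
  \<open>g \<otimes> \<dots> \<otimes> g\<close>. The entries of these unitaries are monomials of degree \<open>n\<close>, so the cyclic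
  subspace of any vector has dimension at most \<open>r = (n + 1)\<^bsup>d\<^sup>2\<^esup>\<close>. Minimal projections of \<open>N\<close> thus
  have rank at most \<open>r\<close>, which gives \<open>S\<^sub>M \<le> S\<^sub>N + ln r\<close>. Conversely, list the eigenvectors of
  the density on \<open>M\<close> by decreasing eigenvalue and let \<open>R\<^sub>k \<in> N\<close> project onto what the cyclic
  subspace of the \<open>k\<close>-th one adds to the previous ones. The probabilities \<open>\<phi>(R\<^sub>k)\<close> majorize the
  eigenvalues, so \<open>S\<^sub>N \<le> S\<^sub>M + ln r\<close>. Since \<open>ln r = O(ln n)\<close>, both mean entropies
  agree as soon as one exists, and that of \<open>M\<close> exists by subadditivity.
\<close>

section \<open>Row- and column-finite matrices\<close>

text \<open>The entropy rests on three definite descriptions: canonical trace, density and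
  functional calculus. Each has to be shown to exist uniquely on an algebra \<open>N\<close> that is
  known only as a commutant. Instead of decomposing \<open>N\<close> into matrix blocks, the proof
  works with its minimal projections: they span \<open>N\<close>, they compress \<open>N\<close> to
  scalars, and two of them that some element of \<open>N\<close> connects have the same trace. This
  suffices to build the canonical trace as a reweighted matrix trace and to represent states by
  densities. The choice \<open>U = {1}\<close> turns the full algebra into a commutant too, so both
  entropies obey the same lemmas. A second obstacle is that \<open>kmult\<close> is an infinite sum,
  for which ring laws fail in general. Local operators have finitely many nonzero entries in each
  row and column; such matrices form a genuine ring, and \<open>ent\<close> carries its operations
  to those on kernels.\<close>

typedef 'x fmat = "{K :: 'x \<Rightarrow> 'x \<Rightarrow> complex. (\<forall>a. finite {b. K a b \<noteq> 0}) \<and> (\<forall>b. finite {a. K a b \<noteq> 0})}"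
  morphisms ent Fmat
  by (rule exI[of _ "\<lambda>_ _. 0"]) simp

lemma finite_row: "finite {b. ent A a b \<noteq> 0}"
  and finite_col: "finite {a. ent A a b \<noteq> 0}"
  using ent[of A] by auto

lemma ent_Fmat: "(\<And>a. finite {b. K a b \<noteq> 0}) \<Longrightarrow> (\<And>b. finite {a. K a b \<noteq> 0}) \<Longrightarrow> ent (Fmat K) = K"
  by (simp add: Fmat_inverse)

lemma fmat_eqI: "(\<And>a b. ent A a b = ent B a b) \<Longrightarrow> A = B"
  by (simp add: ent_inject[symmetric] fun_eq_iff)

definition mulent :: "'x fmat \<Rightarrow> 'x fmat \<Rightarrow> 'x \<Rightarrow> 'x \<Rightarrow> complex" where
  "mulent A B a b = (\<Sum>x | ent A a x \<noteq> 0. ent A a x * ent B x b)"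

text \<open>The definition sums over the support of a row of \<open>A\<close>; a column of
  \<open>B\<close>, or any finite set that catches the nonzero products, serves as well.
  Associativity uses both readings.\<close>

lemma mulent_eq:
  assumes "finite S" "\<And>x. ent A a x \<noteq> 0 \<Longrightarrow> ent B x b \<noteq> 0 \<Longrightarrow> x \<in> S"
  shows "mulent A B a b = (\<Sum>x\<in>S. ent A a x * ent B x b)"
proof -
  let ?R = "{x. ent A a x \<noteq> 0}"
  have "mulent A B a b = (\<Sum>x\<in>?R \<inter> S. ent A a x * ent B x b)"
    unfolding mulent_def using assms finite_row[of A a] by (intro sum.mono_neutral_right) auto
  also have "\<dots> = (\<Sum>x\<in>S. ent A a x * ent B x b)"
    using assms by (intro sum.mono_neutral_left) auto
  finally show ?thesis .
qed

lemma mulent_nz: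
  assumes "mulent A B a b \<noteq> 0"
  shows "\<exists>x. ent A a x \<noteq> 0 \<and> ent B x b \<noteq> 0"
proof (rule ccontr)
  assume "\<not> ?thesis"
  then have "mulent A B a b = 0"
    unfolding mulent_def by (intro sum.neutral) auto
  with assms show False by simp
qed

lemma mulent_finite: "finite {b. mulent A B a b \<noteq> 0}" "finite {a. mulent A B a b \<noteq> 0}"
proof -
  have "{b. mulent A B a b \<noteq> 0} \<subseteq> (\<Union>x\<in>{x. ent A a x \<noteq> 0}. {b. ent B x b \<noteq> 0})"
    using mulent_nz by fastforce
  then show "finite {b. mulent A B a b \<noteq> 0}"
    by (rule finite_subset) (auto intro: finite_row)
  have "{a. mulent A B a b \<noteq> 0} \<subseteq> (\<Union>x\<in>{x. ent B x b \<noteq> 0}. {a. ent A a x \<noteq> 0})"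
    using mulent_nz by fastforce
  then show "finite {a. mulent A B a b \<noteq> 0}"
    by (rule finite_subset) (auto intro: finite_col)
qed

lemma finite_nonzero_comb:
  "finite {b. f b \<noteq> (0::complex)} \<Longrightarrow> finite {b. g b \<noteq> 0} \<Longrightarrow> finite {b. f b + g b \<noteq> 0}"
  "finite {b. f b \<noteq> (0::complex)} \<Longrightarrow> finite {b. g b \<noteq> 0} \<Longrightarrow> finite {b. f b - g b \<noteq> 0}"
  by (rule finite_subset[of _ "{b. f b \<noteq> 0} \<union> {b. g b \<noteq> 0}"]; auto)+

instantiation fmat :: (type) ring_1
begin
definition "0 = Fmat (\<lambda>_ _. 0)"
definition "1 = Fmat (\<lambda>a b. if a = b then 1 else 0)"
definition "A + B = Fmat (\<lambda>a b. ent A a b + ent B a b)"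
definition "A - B = Fmat (\<lambda>a b. ent A a b - ent B a b)"
definition "- A = Fmat (\<lambda>a b. - ent A a b)"
definition "A * B = Fmat (mulent A B)"

lemma ent_simps0:
  "ent 0 a b = 0"
  "ent 1 a b = (if a = b then 1 else 0)"
  "ent (A + B) a b = ent A a b + ent B a b"
  "ent (A - B) a b = ent A a b - ent B a b"
  "ent (- A) a b = - ent A a b"
  "ent (A * B) a b = mulent A B a b"
       apply (simp add: zero_fmat_def ent_Fmat)
      apply (simp add: one_fmat_def ent_Fmat)
     apply (simp add: plus_fmat_def ent_Fmat finite_nonzero_comb finite_row finite_col)
    apply (simp add: minus_fmat_def ent_Fmat finite_row finite_col
        finite_nonzero_comb(2)[simplified])
   apply (simp add: uminus_fmat_def ent_Fmat finite_row finite_col)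
  apply (simp add: times_fmat_def ent_Fmat mulent_finite)
  done

instance
proof
  fix A B C :: "'a fmat"
  show "A * B * C = A * (B * C)"
  proof (rule fmat_eqI)
    fix a b
    have "ent (A * B * C) a b = (\<Sum>y\<in>{y. ent C y b \<noteq> 0}. mulent A B a y * ent C y b)"
      unfolding ent_simps0 by (subst mulent_eq[OF finite_col[of C b]]) (auto simp: ent_simps0)
    also have "\<dots> = (\<Sum>y\<in>{y. ent C y b \<noteq> 0}. \<Sum>x | ent A a x \<noteq> 0. ent A a x * ent B x y * ent C y b)"
      by (simp add: mulent_def sum_distrib_right)
    also have "\<dots> = (\<Sum>x | ent A a x \<noteq> 0. ent A a x * (\<Sum>y\<in>{y. ent C y b \<noteq> 0}. ent B x y * ent C y b))"
      by (subst sum.swap) (simp add: sum_distrib_left mult.assoc)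
    also have "\<dots> = (\<Sum>x | ent A a x \<noteq> 0. ent A a x * mulent B C x b)"
      by (intro sum.cong refl arg_cong2[where f="(*)"])
         (subst mulent_eq[OF finite_col[of C b]], auto)
    also have "\<dots> = ent (A * (B * C)) a b"
      by (simp add: ent_simps0 mulent_def[of A])
    finally show "ent (A * B * C) a b = ent (A * (B * C)) a b" .
  qed
  show "1 * A = A"
  proof (rule fmat_eqI)
    fix a b show "ent (1 * A) a b = ent A a b"
      unfolding ent_simps0 by (subst mulent_eq[of "{a}"]) (auto simp: ent_simps0 split: if_splits)
  qed
  show "A * 1 = A"
  proof (rule fmat_eqI)
    fix a b show "ent (A * 1) a b = ent A a b"
      unfolding ent_simps0 by (subst mulent_eq[of "{b}"]) (auto simp: ent_simps0 split: if_splits)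
  qed
  show "(A + B) * C = A * C + B * C"
    by (rule fmat_eqI)
       (simp add: ent_simps0 mulent_eq[OF finite_col[of C]] algebra_simps sum.distrib)
  show "A * (B + C) = A * B + A * C"
    by (rule fmat_eqI)
       (simp add: ent_simps0 mulent_def[of A] algebra_simps sum.distrib)
  show "A + B + C = A + (B + C)" "A + B = B + A" "0 + A = A" "- A + A = 0" "A - B = A + - B"
    by (rule fmat_eqI, simp add: ent_simps0)+
  have "ent 0 undefined undefined \<noteq> ent (1 :: 'a fmat) undefined undefined"
    by (simp add: ent_simps0)
  then show "(0 :: 'a fmat) \<noteq> 1"
    by metis
qed

end

lemmas ent_simps [simp] = ent_simps0(1-5)

lemma ent_mult:
  assumes "finite S" "\<And>x. ent A a x \<noteq> 0 \<Longrightarrow> ent B x b \<noteq> 0 \<Longrightarrow> x \<in> S"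
  shows "ent (A * B) a b = (\<Sum>x\<in>S. ent A a x * ent B x b)"
  using mulent_eq[OF assms] by (simp add: ent_simps0)

lemma ent_sum [simp]: "ent (sum f S) a b = (\<Sum>s\<in>S. ent (f s) a b)"
  by (induction S rule: infinite_finite_induct) auto

definition cscale :: "complex \<Rightarrow> 'x fmat \<Rightarrow> 'x fmat"  (infixr \<open>*\<^sub>C\<close> 75) where
  "c *\<^sub>C A = Fmat (\<lambda>a b. c * ent A a b)"

definition star :: "'x fmat \<Rightarrow> 'x fmat" where
  "star A = Fmat (\<lambda>a b. cnj (ent A b a))"

lemma ent_cscale [simp]: "ent (c *\<^sub>C A) a b = c * ent A a b"
  unfolding cscale_def
  by (cases "c = 0") (simp_all add: ent_Fmat finite_row finite_col)

lemma ent_star [simp]: "ent (star A) a b = cnj (ent A b a)"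
  unfolding star_def by (simp add: ent_Fmat finite_row finite_col)

lemma cscale_simps [simp]:
  "0 *\<^sub>C A = 0" "1 *\<^sub>C A = A" "c *\<^sub>C 0 = 0" "a *\<^sub>C b *\<^sub>C A = (a * b) *\<^sub>C A"
  by (rule fmat_eqI, simp)+

lemma cscale_add_left: "(a + b) *\<^sub>C A = a *\<^sub>C A + b *\<^sub>C A"
  and cscale_diff_left: "(a - b) *\<^sub>C A = a *\<^sub>C A - b *\<^sub>C A"
  by (rule fmat_eqI, simp add: algebra_simps)+

lemma cscale_sum_right: "c *\<^sub>C (\<Sum>s\<in>S. f s) = (\<Sum>s\<in>S. c *\<^sub>C f s)"
  by (rule fmat_eqI) (simp add: sum_distrib_left)

lemma cscale_mult [simp]: "c *\<^sub>C A * B = c *\<^sub>C (A * B)" "A * c *\<^sub>C B = c *\<^sub>C (A * B)"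
proof -
  show "c *\<^sub>C A * B = c *\<^sub>C (A * B)"
  proof (rule fmat_eqI)
    fix a b show "ent (c *\<^sub>C A * B) a b = ent (c *\<^sub>C (A * B)) a b"
      by (subst ent_mult[OF finite_row[of A a]])
         (auto simp: ent_mult[OF finite_row[of A a]] sum_distrib_left mult.assoc)
  qed
  show "A * c *\<^sub>C B = c *\<^sub>C (A * B)"
    by (rule fmat_eqI) (simp add: ent_mult[OF finite_row[of A]] sum_distrib_left algebra_simps)
qed

lemma cscale_cancel: "c *\<^sub>C A = c *\<^sub>C B \<Longrightarrow> c \<noteq> 0 \<Longrightarrow> A = B"
  by (metis cscale_simps(2,4) left_inverse)

lemma cscale_eq_0: "c *\<^sub>C A = 0 \<longleftrightarrow> c = 0 \<or> A = 0"
  using cscale_cancel[of c A 0] by auto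

lemma star_simps [simp]:
  "star 0 = 0" "star 1 = 1" "star (star A) = A" "star (A + B) = star A + star B"
  "star (A - B) = star A - star B" "star (c *\<^sub>C A) = cnj c *\<^sub>C star A"
  by (rule fmat_eqI, auto)+

lemma star_sum: "star (\<Sum>s\<in>S. f s) = (\<Sum>s\<in>S. star (f s))"
  by (rule fmat_eqI) simp

lemma star_mult [simp]: "star (A * B) = star B * star A"
proof (rule fmat_eqI)
  fix a b
  show "ent (star (A * B)) a b = ent (star B * star A) a b"
    unfolding ent_star
    by (subst (1 2) ent_mult[OF finite_row[of A b]]) (auto simp: mult.commute)
qed

lemma kadd_ent: "kadd (ent A) (ent B) = ent (A + B)"
  and kscale_ent: "kscale c (ent A) = ent (c *\<^sub>C A)"
  and kzero_ent: "kzero = ent 0"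
  and kone_ent: "kone = ent 1"
  and kadj_ent: "kadj (ent A) = ent (star A)"
  for A B :: "(int \<Rightarrow> 'd) fmat"
  by (auto simp: fun_eq_iff kadd_def kscale_def kzero_def kone_def kadj_def)

text \<open>Only the finite support of a row of \<open>A\<close> contributes, so the infinite sum
  collapses to the ring product.\<close>

lemma kmult_ent: "kmult (ent A) (ent B) = ent (A * B)"
  for A B :: "(int \<Rightarrow> 'd) fmat"
proof (intro ext)
  fix a b
  have "kmult (ent A) (ent B) a b = infsum (\<lambda>x. ent A a x * ent B x b) {x. ent A a x \<noteq> 0}"
    unfolding kmult_def by (rule infsum_cong_neutral) auto
  also have "\<dots> = ent (A * B) a b"
    by (subst ent_mult[OF finite_row[of A a]]) (auto simp: finite_row)
  finally show "kmult (ent A) (ent B) a b = ent (A * B) a b" .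
qed

lemmas kernel_ent = kadd_ent kscale_ent kzero_ent kone_ent kadj_ent kmult_ent

section \<open>Finitely supported vectors\<close>

definition fscale :: "complex \<Rightarrow> ('x \<Rightarrow> complex) \<Rightarrow> 'x \<Rightarrow> complex" where
  "fscale c f = (\<lambda>x. c * f x)"

global_interpretation fv: vector_space fscale
  by unfold_locales (auto simp: fscale_def fun_eq_iff algebra_simps)

text \<open>Vectors are functions on the whole index type that vanish off \<open>X\<close>, so that
  a single vector space structure and a single notion of span serve every \<open>X\<close>.\<close>

definition vecs :: "'x set \<Rightarrow> ('x \<Rightarrow> complex) set" where
  "vecs X = {u. \<forall>x. x \<notin> X \<longrightarrow> u x = 0}"

definition ip :: "'x set \<Rightarrow> ('x \<Rightarrow> complex) \<Rightarrow> ('x \<Rightarrow> complex) \<Rightarrow> complex" where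
  "ip X u v = (\<Sum>x\<in>X. cnj (u x) * v x)"

definition orthonormal :: "'x set \<Rightarrow> ('x \<Rightarrow> complex) set \<Rightarrow> bool" where
  "orthonormal X E \<longleftrightarrow> finite E \<and> (\<forall>e\<in>E. \<forall>f\<in>E. ip X e f = (if e = f then 1 else 0))"

lemma sum_fun_apply: "(\<Sum>s\<in>S. f s) x = (\<Sum>s\<in>S. f s x)"
  for f :: "'s \<Rightarrow> 'x \<Rightarrow> complex"
  by (induction S rule: infinite_finite_induct) auto

lemma subspace_vecs: "fv.subspace (vecs X)"
  by (auto simp: fv.subspace_def vecs_def fscale_def)

lemma ip_diff_right: "ip X u (v - w) = ip X u v - ip X u w"
  and ip_scale_right: "ip X u (fscale c v) = c * ip X u v"
  and ip_scale_left: "ip X (fscale c u) v = cnj c * ip X u v"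
  and ip_zero_right: "ip X u 0 = 0"
  by (simp_all add: ip_def fscale_def algebra_simps sum.distrib sum_subtractf sum_distrib_left)

lemma ip_sum_right: "ip X u (\<Sum>s\<in>S. f s) = (\<Sum>s\<in>S. ip X u (f s))"
  by (simp add: ip_def sum_fun_apply sum_distrib_left) (rule sum.swap)

lemma cnj_ip: "cnj (ip X u v) = ip X v u"
  by (simp add: ip_def mult.commute)

lemma ip_self: "ip X u u = of_real (\<Sum>x\<in>X. (cmod (u x))\<^sup>2)"
  unfolding ip_def of_real_sum by (intro sum.cong) (simp_all only: complex_norm_square mult.commute)

lemma ip_self_eq_0:
  assumes "finite X" "u \<in> vecs X" "ip X u u = 0"
  shows "u = 0"
proof
  fix x
  have "(\<Sum>x\<in>X. (cmod (u x))\<^sup>2) = 0"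
    using assms(3) unfolding ip_self of_real_eq_0_iff .
  then have "\<forall>x\<in>X. u x = 0"
    using assms(1) by (simp add: sum_nonneg_eq_0_iff)
  then show "u x = 0 x"
    using assms(2) by (auto simp: vecs_def)
qed

lemma normalized_exists:
  assumes "finite X" "u \<in> vecs X" "u \<noteq> 0"
  obtains c where "ip X (fscale c u) (fscale c u) = 1" "c \<noteq> 0"
proof -
  let ?s = "\<Sum>x\<in>X. (cmod (u x))\<^sup>2"
  have "?s \<noteq> 0"
    using ip_self_eq_0[OF assms(1,2)] assms(3) ip_self[of X u] by (metis of_real_0)
  then have "?s > 0"
    by (simp add: sum_nonneg less_le)
  then have "complex_of_real (1 / sqrt ?s) * complex_of_real (1 / sqrt ?s) * of_real ?s = 1"
    unfolding of_real_mult[symmetric] by (simp add: real_sqrt_mult_self field_simps del: of_real_sum)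
  then have "ip X (fscale (of_real (1 / sqrt ?s)) u) (fscale (of_real (1 / sqrt ?s)) u) = 1"
    unfolding ip_scale_left ip_scale_right ip_self[of X u] complex_cnj_complex_of_real mult.assoc .
  then show ?thesis
    using that by (metis ip_scale_left complex_cnj_zero mult_zero_left zero_neq_one)
qed

lemma orthonormal_independent:
  assumes "orthonormal X E"
  shows "fv.independent E"
proof -
  have fin: "finite E"
    using assms by (simp add: orthonormal_def)
  have "c f = 0" if "(\<Sum>e\<in>E. fscale (c e) e) = 0" "f \<in> E" for c f
  proof -
    have "0 = (\<Sum>e\<in>E. c e * ip X f e)"
      using arg_cong[OF that(1), of "ip X f"] by (simp add: ip_sum_right ip_scale_right ip_zero_right)
    also have "\<dots> = (\<Sum>e\<in>E. if e = f then c e else 0)"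
      using assms that(2) by (intro sum.cong) (auto simp: orthonormal_def)
    finally show ?thesis
      using fin that(2) by simp
  qed
  then show ?thesis
    unfolding fv.dependent_finite[OF fin] by blast
qed

lemma orthonormal_card_le:
  assumes "orthonormal X E" "E \<subseteq> fv.span T" "finite T"
  shows "card E \<le> card T"
  using fv.independent_span_bound[OF assms(3) orthonormal_independent[OF assms(1)] assms(2)] by blast

definition unit_vec :: "'x \<Rightarrow> 'x \<Rightarrow> complex" where
  "unit_vec a = (\<lambda>x. if x = a then 1 else 0)"

lemma vecs_expansion:
  assumes "finite X" "u \<in> vecs X"
  shows "u = (\<Sum>a\<in>X. fscale (u a) (unit_vec a))"
proof
  fix x
  have "(\<Sum>a\<in>X. fscale (u a) (unit_vec a)) x = (\<Sum>a\<in>X. if a = x then u a else 0)"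
    by (auto simp: sum_fun_apply fscale_def unit_vec_def intro!: sum.cong)
  then show "u x = (\<Sum>a\<in>X. fscale (u a) (unit_vec a)) x"
    using assms by (auto simp: vecs_def)
qed

lemma vecs_subset_span:
  assumes "finite X"
  shows "vecs X \<subseteq> fv.span (unit_vec ` X)"
proof
  fix u assume "u \<in> vecs X"
  from vecs_expansion[OF assms this] show "u \<in> fv.span (unit_vec ` X)"
    by (metis (no_types, lifting) fv.span_sum fv.span_scale fv.span_base imageI)
qed

lemma card_le_of_independent:
  assumes "finite X" "fv.independent S" "S \<subseteq> vecs X"
  shows "finite S" "card S \<le> card X"
proof -
  have "finite S \<and> card S \<le> card (unit_vec ` X)"
    using assms vecs_subset_span[OF assms(1)] by (intro fv.independent_span_bound) auto
  then show "finite S" "card S \<le> card X"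
    using card_image_le[OF assms(1), of unit_vec] by auto
qed

text \<open>An orthonormal subset of \<open>V\<close> of largest cardinality works: the residue
  \<open>w\<close> of a vector that it fails to expand could be normalized and adjoined.\<close>

lemma orthonormal_basis_exists:
  assumes X: "finite X" and V: "fv.subspace V" "V \<subseteq> vecs X"
  obtains E where "orthonormal X E" "E \<subseteq> V" "\<And>v. v \<in> V \<Longrightarrow> v = (\<Sum>e\<in>E. fscale (ip X e v) e)"
proof -
  let ?P = "\<lambda>E. orthonormal X E \<and> E \<subseteq> V"
  have bound: "\<forall>E. ?P E \<longrightarrow> card E < Suc (card X)"
    using card_le_of_independent(2)[OF X orthonormal_independent] V(2) by (meson le_imp_less_Suc subset_trans)
  have "?P {}"
    by (simp add: orthonormal_def)
  from ex_has_greatest_nat[of ?P, OF this bound]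
  obtain E where E: "?P E" and mx: "\<And>F. ?P F \<Longrightarrow> card F \<le> card E"
    by blast
  have "v = (\<Sum>e\<in>E. fscale (ip X e v) e)" if v: "v \<in> V" for v
  proof (rule ccontr)
    assume ne: "\<not> ?thesis"
    define w where "w = v - (\<Sum>e\<in>E. fscale (ip X e v) e)"
    have w: "w \<in> V" "w \<noteq> 0"
      using ne E v V(1) unfolding w_def
      by (auto intro!: fv.subspace_diff fv.subspace_sum fv.subspace_scale)
    have ort: "ip X f w = 0" if "f \<in> E" for f
    proof -
      have "(\<Sum>e\<in>E. ip X e v * ip X f e) = (\<Sum>e\<in>E. if e = f then ip X e v else 0)"
        using E that by (intro sum.cong) (auto simp: orthonormal_def)
      also have "\<dots> = ip X f v"
        using E that by (simp add: orthonormal_def)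
      finally show ?thesis
        by (simp add: w_def ip_diff_right ip_sum_right ip_scale_right)
    qed
    obtain c where c: "ip X (fscale c w) (fscale c w) = 1"
      using normalized_exists[OF X _ w(2)] w(1) V(2) by blast
    have z: "ip X f (fscale c w) = 0" "ip X (fscale c w) f = 0" if "f \<in> E" for f
    proof -
      show "ip X f (fscale c w) = 0"
        using ort[OF that] by (simp add: ip_scale_right)
      then show "ip X (fscale c w) f = 0"
        by (metis cnj_ip complex_cnj_zero)
    qed
    have nE: "fscale c w \<notin> E"
      using z c by auto
    have "?P (insert (fscale c w) E)"
      using E w(1) c z V(1) by (auto simp: orthonormal_def fv.subspace_scale)
    from mx[OF this] show False
      using nE E by (simp add: orthonormal_def)
  qed
  with E that show ?thesis by blast
qed

section \<open>Eigenvectors\<close>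

text \<open>For \<open>u i = (T ^^ i) v0\<close> and \<open>k\<close> above the degree of
  \<open>p\<close>, this is the vector \<open>p(T) v0\<close>.\<close>

definition poly_orbit :: "(nat \<Rightarrow> 'x \<Rightarrow> complex) \<Rightarrow> nat \<Rightarrow> complex poly \<Rightarrow> 'x \<Rightarrow> complex" where
  "poly_orbit u k p = (\<Sum>i<k. fscale (coeff p i) (u i))"

lemma poly_orbit_mono:
  assumes "degree p < k" "k \<le> l"
  shows "poly_orbit u l p = poly_orbit u k p"
  unfolding poly_orbit_def using assms
  by (intro sum.mono_neutral_right) (auto simp: coeff_eq_0 fscale_def zero_fun_def)

text \<open>Any \<open>card X + 1\<close> vectors are dependent, and a relation among the
  \<open>u i\<close> lists the coefficients of \<open>p\<close>. Dependence is a property of sets,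
  so a repeated vector is handled apart, by \<open>x^j - x^i\<close>.\<close>

lemma annihilating_poly_exists:
  assumes "finite X" "range u \<subseteq> vecs X"
  shows "\<exists>p. p \<noteq> 0 \<and> poly_orbit u (Suc (degree p)) p = 0"
proof -
  have *: "\<exists>p. p \<noteq> 0 \<and> poly_orbit u (Suc (degree p)) p = 0" if "p \<noteq> 0" "poly_orbit u k p = 0" "degree p < k" for p k
    using that poly_orbit_mono[of p "Suc (degree p)" k u] by auto
  show ?thesis
  proof (cases "inj_on u {..card X}")
    case True
    have "card (u ` {..card X}) = Suc (card X)"
      using True by (simp add: card_image)
    then have "fv.dependent (u ` {..card X})"
      using card_le_of_independent(2)[OF assms(1), of "u ` {..card X}"] assms(2) by (metis Suc_n_not_le_n image_subset_iff rangeI subset_iff)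
    then obtain c v where c: "v \<in> u ` {..card X}" "c v \<noteq> 0" "(\<Sum>v\<in>u ` {..card X}. fscale (c v) v) = 0"
      by (auto simp: fv.dependent_finite)
    define p where "p = (\<Sum>i\<le>card X. monom (c (u i)) i)"
    have cf: "coeff p i = (if i \<le> card X then c (u i) else 0)" for i
      by (simp add: p_def coeff_sum)
    have "poly_orbit u (Suc (card X)) p = (\<Sum>i\<le>card X. fscale (c (u i)) (u i))"
      unfolding poly_orbit_def lessThan_Suc_atMost by (intro sum.cong) (auto simp: cf)
    also have "\<dots> = 0"
      using c(3) True by (simp add: sum.reindex)
    finally have "poly_orbit u (Suc (card X)) p = 0" .
    moreover have "p \<noteq> 0"
    proof -
      obtain i where "i \<le> card X" "v = u i"
        using c(1) by auto
      then have "coeff p i \<noteq> 0"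
        using c(2) by (simp add: cf)
      then show ?thesis
        by auto
    qed
    moreover have "degree p < Suc (card X)"
      by (metis cf degree_le le_imp_less_Suc not_less)
    ultimately show ?thesis
      using * by blast
  next
    case False
    then obtain i j where ij: "u i = u j" "i < j"
      unfolding inj_on_def by (metis linorder_neqE_nat)
    define p :: "complex poly" where "p = monom 1 j - monom 1 i"
    have "coeff p j \<noteq> 0"
      using ij by (simp add: p_def)
    then have "p \<noteq> 0"
      by auto
    moreover have "degree p < Suc j"
      using ij(2) unfolding p_def
      by (metis degree_diff_le degree_monom_le le_imp_less_Suc less_imp_le order_trans)
    moreover have "poly_orbit u (Suc j) p = 0"
    proof -
      have "poly_orbit u (Suc j) p = (\<Sum>k<Suc j. fscale (coeff (monom 1 j) k) (u k)) - (\<Sum>k<Suc j. fscale (coeff (monom 1 i) k) (u k))"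
        by (simp add: poly_orbit_def p_def fv.scale_left_diff_distrib sum_subtractf del: coeff_monom sum.lessThan_Suc)
      also have "\<dots> = (\<Sum>k<Suc j. if k = j then u k else 0) - (\<Sum>k<Suc j. if k = i then u k else 0)"
        by (intro arg_cong2[where f="(-)"] sum.cong) (auto simp: fscale_def fun_eq_iff)
      also have "\<dots> = 0"
        using ij by (simp del: sum.lessThan_Suc)
      finally show ?thesis .
    qed
    ultimately show ?thesis
      using * by blast
  qed
qed

text \<open>Let \<open>p\<close> of least degree annihilate \<open>v0\<close>. It is not constant,
  so it has a root \<open>a\<close> and \<open>p = (x - a) q\<close>. By minimality
  \<open>w = q(T) v0\<close> is nonzero, while \<open>(T - a) w = p(T) v0 = 0\<close>.\<close>

lemma eigenvector_exists:
  assumes X: "finite X" and V: "fv.subspace V" "V \<subseteq> vecs X"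
    and T: "\<And>v. v \<in> V \<Longrightarrow> T v \<in> V"
      "\<And>v w. v \<in> V \<Longrightarrow> w \<in> V \<Longrightarrow> T (v + w) = T v + T w"
      "\<And>c v. v \<in> V \<Longrightarrow> T (fscale c v) = fscale c (T v)"
    and v0: "v0 \<in> V" "v0 \<noteq> 0"
  obtains l v where "v \<in> V" "v \<noteq> 0" "T v = fscale l v"
proof -
  define u where "u = (\<lambda>i. (T ^^ i) v0)"
  have uV: "u i \<in> V" for i
    by (induction i) (simp_all add: u_def v0 T)
  have "range u \<subseteq> vecs X"
    using uV V(2) by blast
  from annihilating_poly_exists[OF X this]
  obtain p' where "p' \<noteq> 0 \<and> poly_orbit u (Suc (degree p')) p' = 0"
    by blast
  from ex_has_least_nat[of "\<lambda>p. p \<noteq> 0 \<and> poly_orbit u (Suc (degree p)) p = 0", OF this, of degree]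
  obtain p where p: "p \<noteq> 0" "poly_orbit u (Suc (degree p)) p = 0"
    and mn: "\<And>q. q \<noteq> 0 \<Longrightarrow> poly_orbit u (Suc (degree q)) q = 0 \<Longrightarrow> degree p \<le> degree q"
    by blast
  have "degree p \<noteq> 0"
  proof
    assume "degree p = 0"
    then obtain a where a: "p = [:a:]"
      by (metis degree_eq_zeroE)
    then have "fscale a v0 = 0" "a \<noteq> 0"
      using p by (auto simp: poly_orbit_def u_def)
    then show False
      using v0(2) by simp
  qed
  then obtain a where "poly p a = 0"
    using fundamental_theorem_of_algebra[of p] by (auto simp: constant_degree)
  then obtain q where q: "p = [:-a, 1:] * q"
    by (auto simp: poly_eq_0_iff_dvd elim: dvdE)
  have q0: "q \<noteq> 0"
    using p(1) q by auto
  have dq: "degree p = Suc (degree q)"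
    unfolding q using q0 by (subst degree_mult_eq) auto
  define w where "w = poly_orbit u (Suc (degree q)) q"
  have w0: "w \<noteq> 0"
    using mn[OF q0] dq unfolding w_def by force
  have wV: "w \<in> V"
    unfolding w_def poly_orbit_def using uV V(1) by (intro fv.subspace_sum fv.subspace_scale) auto
  have T0: "T 0 = 0"
    using T(3)[OF v0(1), of 0] by simp
  have Tsum: "T (\<Sum>i\<in>S. fscale (c i) (u i)) = (\<Sum>i\<in>S. fscale (c i) (u (Suc i)))" if "finite S" for c and S :: "nat set"
    using that
  proof (induction S rule: finite_induct)
    case (insert i S)
    have "(\<Sum>j\<in>S. fscale (c j) (u j)) \<in> V"
      using uV V(1) by (intro fv.subspace_sum fv.subspace_scale) auto
    then have "T (fscale (c i) (u i) + (\<Sum>j\<in>S. fscale (c j) (u j))) =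
        fscale (c i) (T (u i)) + T (\<Sum>j\<in>S. fscale (c j) (u j))"
      using uV V(1) T(2,3) by (metis fv.subspace_scale)
    moreover have "T (u i) = u (Suc i)"
      by (simp add: u_def)
    ultimately show ?case
      unfolding sum.insert[OF insert(1,2)] insert(3) by (simp only:)
  qed (simp only: sum.empty T0)
  \<comment> \<open>The coefficients of \<open>(x - a) q\<close>: the shifted part sums to
    \<open>T w\<close>, the other part to \<open>a w\<close>.\<close>
  have "coeff p i = (case i of 0 \<Rightarrow> 0 | Suc j \<Rightarrow> coeff q j) - a * coeff q i" for i
    unfolding q by (simp add: coeff_pCons split: nat.split)
  then have "poly_orbit u (Suc (degree p)) p =
      (\<Sum>i<Suc (Suc (degree q)). fscale (case i of 0 \<Rightarrow> 0 | Suc j \<Rightarrow> coeff q j) (u i)) -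
      fscale a (poly_orbit u (Suc (Suc (degree q))) q)"
    unfolding poly_orbit_def dq
    by (simp add: fv.scale_left_diff_distrib sum_subtractf fv.scale_sum_right del: sum.lessThan_Suc)
  also have "(\<Sum>i<Suc (Suc (degree q)). fscale (case i of 0 \<Rightarrow> 0 | Suc j \<Rightarrow> coeff q j) (u i)) =
      (\<Sum>i<Suc (degree q). fscale (coeff q i) (u (Suc i)))"
    unfolding sum.lessThan_Suc_shift[of _ "Suc (degree q)"] by (simp only: nat.case fv.scale_zero_left add_0_left)
  also have "\<dots> = T w"
    unfolding w_def poly_orbit_def by (rule Tsum[symmetric]) simp
  also have "poly_orbit u (Suc (Suc (degree q))) q = w"
    unfolding w_def by (rule poly_orbit_mono) auto
  finally have "T w = fscale a w"
    using p(2) eq_iff_diff_eq_0[of "T w" "fscale a w"] by metis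
  then show ?thesis
    by (rule that[OF wV w0])
qed

section \<open>Commutants on a finite sector\<close>

definition proj :: "'x fmat \<Rightarrow> bool" where
  "proj p \<longleftrightarrow> star p = p \<and> p * p = p"

text \<open>For projections, \<open>q * p = q\<close> means that the range of \<open>q\<close> lies
  in that of \<open>p\<close>. Minimality is relative to \<open>N\<close>, so \<open>p\<close> may
  have rank above one as a matrix.\<close>

definition minproj :: "'x fmat set \<Rightarrow> 'x fmat \<Rightarrow> bool" where
  "minproj N p \<longleftrightarrow> p \<in> N \<and> proj p \<and> p \<noteq> 0 \<and> (\<forall>q\<in>N. proj q \<and> q * p = q \<longrightarrow> q = 0 \<or> q = p)"

definition minpartition :: "'x fmat set \<Rightarrow> 'x fmat \<Rightarrow> 'x fmat set \<Rightarrow> bool" where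
  "minpartition N s Q \<longleftrightarrow> finite Q \<and> (\<forall>p\<in>Q. minproj N p) \<and>
     (\<forall>p\<in>Q. \<forall>q\<in>Q. p \<noteq> q \<longrightarrow> p * q = 0) \<and> \<Sum>Q = s"

text \<open>
  Elements of \<open>M\<close> leave the finite set \<open>X\<close> of basis vectors invariant and are determined by their
  action on it, so that \<open>M\<close> is a copy of the full matrix algebra over \<open>X\<close>.
\<close>

locale sector =
  fixes X :: "'x set" and M :: "'x fmat set"
  assumes fin: "finite X"
    and M_one: "1 \<in> M"
    and M_add: "A \<in> M \<Longrightarrow> B \<in> M \<Longrightarrow> A + B \<in> M"
    and M_mult: "A \<in> M \<Longrightarrow> B \<in> M \<Longrightarrow> A * B \<in> M"
    and M_scale: "A \<in> M \<Longrightarrow> c *\<^sub>C A \<in> M"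
    and M_star: "A \<in> M \<Longrightarrow> star A \<in> M"
    and M_inv: "A \<in> M \<Longrightarrow> ent A a b \<noteq> 0 \<Longrightarrow> a \<in> X \<longleftrightarrow> b \<in> X"
    and M_faithful: "A \<in> M \<Longrightarrow> (\<And>a b. a \<in> X \<Longrightarrow> b \<in> X \<Longrightarrow> ent A a b = 0) \<Longrightarrow> A = 0"
    and M_full: "\<exists>A\<in>M. \<forall>a\<in>X. \<forall>b\<in>X. ent A a b = f a b"
begin

section \<open>Action on vectors, trace and rank\<close>

definition act :: "'x fmat \<Rightarrow> ('x \<Rightarrow> complex) \<Rightarrow> 'x \<Rightarrow> complex" where
  "act A v = (\<lambda>a. if a \<in> X then \<Sum>b\<in>X. ent A a b * v b else 0)"

definition tr :: "'x fmat \<Rightarrow> complex" where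
  "tr A = (\<Sum>a\<in>X. ent A a a)"

lemma M_zero: "0 \<in> M"
  using M_scale[OF M_one, of 0] by simp

lemma M_diff: "A \<in> M \<Longrightarrow> B \<in> M \<Longrightarrow> A - B \<in> M"
proof -
  assume "A \<in> M" "B \<in> M"
  moreover have "A - B = A + (-1) *\<^sub>C B"
    by (rule fmat_eqI) simp
  ultimately show ?thesis
    by (simp only: M_add M_scale)
qed

lemma M_sum: "(\<And>s. s \<in> S \<Longrightarrow> f s \<in> M) \<Longrightarrow> (\<Sum>s\<in>S. f s) \<in> M"
  by (induction S rule: infinite_finite_induct) (auto simp: M_zero M_add)

lemma M_eqI:
  assumes "A \<in> M" "B \<in> M" "\<And>a b. a \<in> X \<Longrightarrow> b \<in> X \<Longrightarrow> ent A a b = ent B a b"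
  shows "A = B"
  using M_faithful[OF M_diff[OF assms(1,2)]] assms(3) by simp

lemma act_vecs: "act A v \<in> vecs X"
  by (simp add: act_def vecs_def)

lemma act_add_right: "act A (v + w) = act A v + act A w"
  and act_scale_right: "act A (fscale c v) = fscale c (act A v)"
  and act_scale_left: "act (c *\<^sub>C A) v = fscale c (act A v)"
  and act_diff_left: "act (A - B) v = act A v - act B v"
  and act_add_left: "act (A + B) v = act A v + act B v"
  and act_zero_left: "act 0 v = 0"
  by (auto simp: act_def fscale_def fun_eq_iff algebra_simps sum.distrib sum_subtractf sum_distrib_left)

lemma act_one: "v \<in> vecs X \<Longrightarrow> act 1 v = v"
  using fin by (auto simp: act_def fun_eq_iff vecs_def if_distrib[of "\<lambda>c. c * _"] cong: if_cong)

lemma ent_mult_sector: "A \<in> M \<Longrightarrow> a \<in> X \<Longrightarrow> ent (A * B) a b = (\<Sum>x\<in>X. ent A a x * ent B x b)"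
  using M_inv by (intro ent_mult fin) blast

text \<open>\<open>A\<close> preserves \<open>X\<close>, so intermediate indices outside
  \<open>X\<close>, which \<open>act\<close> ignores, contribute nothing to the entries of
  \<open>A * B\<close> over \<open>X\<close>.\<close>

lemma act_mult:
  assumes "A \<in> M"
  shows "act (A * B) v = act A (act B v)"
proof
  fix a
  show "act (A * B) v a = act A (act B v) a"
  proof (cases "a \<in> X")
    case True
    then have "act (A * B) v a = (\<Sum>b\<in>X. \<Sum>x\<in>X. ent A a x * ent B x b * v b)"
      by (simp add: act_def ent_mult_sector[OF assms] sum_distrib_right)
    also have "\<dots> = (\<Sum>x\<in>X. \<Sum>b\<in>X. ent A a x * ent B x b * v b)"
      by (rule sum.swap)
    also have "\<dots> = act A (act B v) a"
      using True by (simp add: act_def sum_distrib_left mult.assoc)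
    finally show ?thesis .
  qed (simp add: act_def)
qed

lemma act_unit_vec: "a \<in> X \<Longrightarrow> b \<in> X \<Longrightarrow> act A (unit_vec b) a = ent A a b"
  using fin by (simp add: act_def unit_vec_def if_distrib[of "\<lambda>c. _ * c"] cong: if_cong)

lemma unit_vec_vecs: "b \<in> X \<Longrightarrow> unit_vec b \<in> vecs X"
  by (auto simp: unit_vec_def vecs_def)

lemma act_eqI:
  assumes "A \<in> M" "B \<in> M" "\<And>v. v \<in> vecs X \<Longrightarrow> act A v = act B v"
  shows "A = B"
proof (rule M_eqI[OF assms(1,2)])
  fix a b assume "a \<in> X" "b \<in> X"
  then show "ent A a b = ent B a b"
    using assms(3)[OF unit_vec_vecs[of b]] by (metis act_unit_vec)
qed

lemma tr_add: "tr (A + B) = tr A + tr B"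
  and tr_diff: "tr (A - B) = tr A - tr B"
  and tr_scale: "tr (c *\<^sub>C A) = c * tr A"
  and tr_star: "tr (star A) = cnj (tr A)"
  and tr_zero: "tr 0 = 0"
  by (simp_all add: tr_def sum.distrib sum_subtractf sum_distrib_left)

lemma tr_sum: "tr (\<Sum>s\<in>S. f s) = (\<Sum>s\<in>S. tr (f s))"
  by (simp add: tr_def) (rule sum.swap)

lemma tr_commute:
  assumes "A \<in> M" "B \<in> M"
  shows "tr (A * B) = tr (B * A)"
proof -
  have "tr (A * B) = (\<Sum>a\<in>X. \<Sum>b\<in>X. ent A a b * ent B b a)"
    using assms by (simp add: tr_def ent_mult_sector)
  also have "\<dots> = (\<Sum>b\<in>X. \<Sum>a\<in>X. ent A a b * ent B b a)"
    by (rule sum.swap)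
  also have "\<dots> = tr (B * A)"
    using assms by (simp add: tr_def ent_mult_sector mult.commute)
  finally show ?thesis .
qed

text \<open>The squared Hilbert-Schmidt norm, from which positivity and faithfulness of the trace
  follow.\<close>

lemma tr_star_mult:
  assumes "A \<in> M"
  shows "tr (star A * A) = of_real (\<Sum>a\<in>X. \<Sum>b\<in>X. (cmod (ent A b a))\<^sup>2)"
  using assms M_star[OF assms]
  by (auto simp: tr_def ent_mult_sector mult.commute complex_norm_square simp del: of_real_power intro!: sum.cong)

lemma tr_star_mult_nonneg: "A \<in> M \<Longrightarrow> \<exists>t\<ge>0. tr (star A * A) = of_real t"
  by (metis (no_types, lifting) sum_nonneg tr_star_mult zero_le_power2)

lemma tr_star_mult_eq_0:
  assumes "A \<in> M" "tr (star A * A) = 0"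
  shows "A = 0"
proof (rule M_faithful[OF assms(1)])
  fix a b assume ab: "a \<in> X" "b \<in> X"
  have "(\<Sum>a\<in>X. \<Sum>b\<in>X. (cmod (ent A b a))\<^sup>2) = 0"
    using assms(2) unfolding tr_star_mult[OF assms(1)] of_real_eq_0_iff .
  then show "ent A a b = 0"
    using ab fin by (simp add: sum_nonneg_eq_0_iff sum_nonneg)
qed

text \<open>The matrix is the sum of the rank-one matrices \<open>e a * cnj (e b)\<close>. Fullness
  of \<open>M\<close> supplies it, and each unit vector adds one to the trace.\<close>

lemma orthonormal_projection:
  assumes E: "orthonormal X E" "E \<subseteq> vecs X"
  obtains P where "P \<in> M" "proj P" "\<And>v. act P v = (\<Sum>e\<in>E. fscale (ip X e v) e)" "tr P = of_nat (card E)"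
proof -
  have finE: "finite E"
    using E by (simp add: orthonormal_def)
  obtain P where P: "P \<in> M" "\<And>a b. a \<in> X \<Longrightarrow> b \<in> X \<Longrightarrow> ent P a b = (\<Sum>e\<in>E. e a * cnj (e b))"
    using M_full[of "\<lambda>a b. \<Sum>e\<in>E. e a * cnj (e b)"] by blast
  have act: "act P v = (\<Sum>e\<in>E. fscale (ip X e v) e)" for v
  proof
    fix a
    show "act P v a = (\<Sum>e\<in>E. fscale (ip X e v) e) a"
    proof (cases "a \<in> X")
      case True
      then have "act P v a = (\<Sum>b\<in>X. \<Sum>e\<in>E. e a * cnj (e b) * v b)"
        by (simp add: act_def P sum_distrib_right)
      also have "\<dots> = (\<Sum>e\<in>E. \<Sum>b\<in>X. e a * cnj (e b) * v b)"
        by (rule sum.swap)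
      also have "\<dots> = (\<Sum>e\<in>E. fscale (ip X e v) e) a"
        by (simp add: sum_fun_apply fscale_def ip_def sum_distrib_left mult_ac)
      finally show ?thesis .
    next
      case False
      then have "(\<Sum>e\<in>E. fscale (ip X e v) e) a = 0"
        using E(2) by (auto simp: sum_fun_apply fscale_def vecs_def intro!: sum.neutral)
      with False show ?thesis
        by (simp add: act_def)
    qed
  qed
  have "star P = P"
    by (rule M_eqI) (simp_all add: P M_star mult.commute)
  moreover have "P * P = P"
  proof (rule act_eqI)
    fix v
    have "ip X f (\<Sum>e\<in>E. fscale (ip X e v) e) = ip X f v" if "f \<in> E" for f
    proof -
      have "ip X f (\<Sum>e\<in>E. fscale (ip X e v) e) = (\<Sum>e\<in>E. if e = f then ip X e v else 0)"
        unfolding ip_sum_right ip_scale_right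
        using E that by (intro sum.cong) (auto simp: orthonormal_def)
      then show ?thesis
        using finE that by simp
    qed
    then show "act (P * P) v = act P v"
      unfolding act_mult[OF P(1)] act by (intro sum.cong) simp_all
  qed (simp_all add: P M_mult)
  moreover have "tr P = of_nat (card E)"
  proof -
    have "tr P = (\<Sum>a\<in>X. \<Sum>e\<in>E. e a * cnj (e a))"
      by (simp add: tr_def P)
    also have "\<dots> = (\<Sum>e\<in>E. ip X e e)"
      by (subst sum.swap) (simp add: ip_def mult.commute)
    also have "\<dots> = of_nat (card E)"
      using E by (simp add: orthonormal_def)
    finally show ?thesis .
  qed
  ultimately show ?thesis
    using that P(1) act by (simp add: proj_def)
qed

lemma subspace_projection:
  assumes V: "fv.subspace V" "V \<subseteq> vecs X"
  obtains P E where "P \<in> M" "proj P" "\<And>v. act P v \<in> V" "\<And>v. v \<in> V \<Longrightarrow> act P v = v"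
    "orthonormal X E" "E \<subseteq> V" "tr P = of_nat (card E)" "P \<noteq> 0 \<Longrightarrow> E \<noteq> {}"
proof -
  obtain E where E: "orthonormal X E" "E \<subseteq> V" "\<And>v. v \<in> V \<Longrightarrow> v = (\<Sum>e\<in>E. fscale (ip X e v) e)"
    by (rule orthonormal_basis_exists[OF fin V]) (rule that)
  obtain P where P: "P \<in> M" "proj P" "\<And>v. act P v = (\<Sum>e\<in>E. fscale (ip X e v) e)" "tr P = of_nat (card E)"
    using orthonormal_projection[OF E(1)] E(2) V(2) by blast
  have "act P v \<in> V" for v
    unfolding P(3) using E(2) V(1) by (intro fv.subspace_sum fv.subspace_scale) auto
  moreover have "act P v = v" if "v \<in> V" for v
    using E(3)[OF that] P(3) by metis
  moreover have "P = 0" if "E = {}"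
    by (rule act_eqI[OF P(1) M_zero]) (simp only: P(3) that sum.empty act_zero_left)
  ultimately show ?thesis
    by (intro that[OF P(1,2)]) (use P(4) E in auto)
qed

lemma range_subspace: "fv.subspace {v \<in> vecs X. act p v = v}"
  using subspace_vecs[of X]
  by (auto simp: fv.subspace_def act_add_right act_scale_right) (simp add: act_def fun_eq_iff)

lemma range_subset: "{v \<in> vecs X. act p v = v} \<subseteq> vecs X"
  by blast

text \<open>\<open>p\<close> coincides with the orthogonal projection \<open>P\<close> onto its own
  range: \<open>p * P = P\<close> and \<open>P * p = p\<close>, and both are self-adjoint. The trace
  therefore counts an orthonormal basis.\<close>

lemma proj_trace:
  assumes "p \<in> M" "proj p"
  obtains n where "tr p = of_nat n" "p \<noteq> 0 \<Longrightarrow> n \<ge> 1"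
proof -
  let ?V = "{v \<in> vecs X. act p v = v}"
  obtain P E where P: "P \<in> M" "proj P" "\<And>v. act P v \<in> ?V" "\<And>v. v \<in> ?V \<Longrightarrow> act P v = v"
    "orthonormal X E" "E \<subseteq> ?V" "tr P = of_nat (card E)" "P \<noteq> 0 \<Longrightarrow> E \<noteq> {}"
    by (rule subspace_projection[OF range_subspace[of p] range_subset]) (rule that)
  have "p * P = P"
    by (rule act_eqI) (use assms P M_mult act_mult[OF assms(1)] in auto)
  moreover have "P * p = p"
  proof (rule act_eqI)
    fix v
    have "act p v \<in> ?V"
      using assms act_vecs act_mult[OF assms(1), of p v] by (simp add: proj_def)
    then show "act (P * p) v = act p v"
      using P(4) act_mult[OF P(1)] by simp
  qed (use assms P M_mult in auto)
  ultimately have "P = p"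
    using assms(2) P(2) by (metis proj_def star_mult)
  moreover have "finite E"
    using P(5) by (simp add: orthonormal_def)
  ultimately show ?thesis
    using that[of "card E"] P by (metis One_nat_def Suc_leI card_gt_0_iff)
qed

text \<open>On projections of \<open>M\<close> the trace is a natural number, so rounding loses
  nothing. A rank in \<open>nat\<close> permits induction and the choice of a projection of least
  rank.\<close>

definition rk :: "'x fmat \<Rightarrow> nat" where
  "rk p = nat \<lfloor>Re (tr p)\<rfloor>"

lemma tr_rk: "p \<in> M \<Longrightarrow> proj p \<Longrightarrow> tr p = of_nat (rk p)"
  by (erule (1) proj_trace) (simp add: rk_def)

lemma rk_pos: "p \<in> M \<Longrightarrow> proj p \<Longrightarrow> p \<noteq> 0 \<Longrightarrow> 1 \<le> rk p"
  by (erule (1) proj_trace) (simp add: rk_def)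

lemma rk_diff:
  assumes "p \<in> M" "proj p" "q \<in> M" "proj q" "q * p = q"
  shows "proj (p - q)" "rk p = rk (p - q) + rk q"
proof -
  have "p * q = q"
    using assms by (metis proj_def star_mult)
  then show *: "proj (p - q)"
    using assms by (auto simp: proj_def algebra_simps)
  have "of_nat (rk p) = (of_nat (rk (p - q) + rk q) :: complex)"
    using tr_rk[OF assms(1,2)] tr_rk[OF assms(3,4)] tr_rk[OF M_diff[OF assms(1,3)] *]
    by (simp add: tr_diff diff_eq_eq)
  then show "rk p = rk (p - q) + rk q"
    using of_nat_eq_iff by blast
qed

end

text \<open>A unit and products make the span of an orbit \<open>U v\<close> invariant and let it
  contain \<open>v\<close>. Adjoints make the commutant a \<open>*\<close>-algebra that contains the
  projections onto invariant subspaces.\<close>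

locale commutant = sector X M for X :: "'x set" and M +
  fixes U :: "'x fmat set"
  assumes U_sub: "U \<subseteq> M"
    and U_one: "1 \<in> U"
    and U_mult: "u \<in> U \<Longrightarrow> w \<in> U \<Longrightarrow> u * w \<in> U"
    and U_star: "u \<in> U \<Longrightarrow> star u \<in> U"
begin

definition N :: "'x fmat set" where
  "N = {A \<in> M. \<forall>u\<in>U. u * A = A * u}"

lemma N_M: "A \<in> N \<Longrightarrow> A \<in> M"
  by (simp add: N_def)

lemma N_one: "1 \<in> N"
  and N_zero: "0 \<in> N"
  and N_add: "A \<in> N \<Longrightarrow> B \<in> N \<Longrightarrow> A + B \<in> N"
  and N_diff: "A \<in> N \<Longrightarrow> B \<in> N \<Longrightarrow> A - B \<in> N"
  and N_scale: "A \<in> N \<Longrightarrow> c *\<^sub>C A \<in> N"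
  by (simp_all add: N_def M_one M_zero M_add M_diff M_scale algebra_simps)

lemma N_mult: "A \<in> N \<Longrightarrow> B \<in> N \<Longrightarrow> A * B \<in> N"
  by (auto simp: N_def M_mult mult.assoc) (metis mult.assoc)

lemma N_star: "A \<in> N \<Longrightarrow> star A \<in> N"
  unfolding N_def using U_star by (auto simp: M_star) (metis star_mult star_simps(3))

lemma N_sum: "(\<And>s. s \<in> S \<Longrightarrow> f s \<in> N) \<Longrightarrow> (\<Sum>s\<in>S. f s) \<in> N"
  by (induction S rule: infinite_finite_induct) (auto simp: N_zero N_add)

lemmas N_closed = N_one N_zero N_add N_diff N_scale N_mult N_star N_sum

text \<open>Invariance under \<open>u\<close> gives \<open>P u P = u P\<close>. The same identity
  for \<open>star u\<close>, after taking adjoints, gives \<open>P u P = P u\<close>, so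
  \<open>P\<close> commutes with \<open>u\<close>.\<close>

lemma invariant_projection:
  assumes V: "fv.subspace V" "V \<subseteq> vecs X" and inv: "\<And>u v. u \<in> U \<Longrightarrow> v \<in> V \<Longrightarrow> act u v \<in> V"
  obtains P E where "P \<in> N" "proj P" "\<And>v. act P v \<in> V" "\<And>v. v \<in> V \<Longrightarrow> act P v = v"
    "orthonormal X E" "E \<subseteq> V" "tr P = of_nat (card E)"
proof -
  obtain P E where P: "P \<in> M" "proj P" "\<And>v. act P v \<in> V" "\<And>v. v \<in> V \<Longrightarrow> act P v = v"
    "orthonormal X E" "E \<subseteq> V" "tr P = of_nat (card E)"
    by (rule subspace_projection[OF V]) (rule that)
  have inv': "P * (u * P) = u * P" if "u \<in> U" for u
    using that U_sub P M_mult inv by (intro act_eqI) (auto simp: act_mult subset_eq)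
  have "u * P = P * u" if u: "u \<in> U" for u
  proof -
    have "P * u = star (star u * P)"
      using P(2) by (simp add: proj_def)
    also have "\<dots> = star (P * (star u * P))"
      using inv'[OF U_star[OF u]] by simp
    also have "\<dots> = P * (u * P)"
      using P(2) by (simp add: proj_def mult.assoc)
    finally show ?thesis
      using inv'[OF u] by simp
  qed
  then have "P \<in> N"
    using P(1) by (simp add: N_def)
  then show ?thesis
    by (rule that[OF _ P(2-7)])
qed

text \<open>An eigenspace \<open>W\<close> of \<open>D\<close> inside the range of \<open>s\<close>
  is invariant under \<open>U\<close>, whose elements commute with \<open>D\<close> and
  \<open>s\<close>; hence its projection lies in \<open>N\<close>. Among the nonzero projections of
  \<open>N\<close> inside \<open>W\<close>, one of least rank is minimal.\<close>

lemma minproj_eigen: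
  assumes D: "D \<in> N" "star D = D" and s: "s \<in> N" "proj s" "s \<noteq> 0" "D * s = s * D"
  obtains p l where "minproj N p" "s * p = p" "D * p = complex_of_real l *\<^sub>C p"
proof -
  let ?V = "{v \<in> vecs X. act s v = v}"
  have DM: "D \<in> M" and sM: "s \<in> M"
    using D s N_M by auto
  have Vinv: "act A v \<in> ?V" if "v \<in> ?V" "A \<in> M" "A * s = s * A" for A v
    using that act_mult[OF sM, of A v] act_mult[OF that(2), of s v] by (simp add: act_vecs)
  obtain v0 where v0: "v0 \<in> vecs X" "act s v0 \<noteq> 0"
    using act_eqI[OF sM M_zero] s(3) act_zero_left by metis
  have v1: "act s v0 \<in> ?V"
    using act_vecs act_mult[OF sM, of s v0] s(2) by (simp add: proj_def)
  obtain l v where v: "v \<in> ?V" "v \<noteq> 0" "act D v = fscale l v"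
    by (rule eigenvector_exists[OF fin range_subspace[of s] range_subset Vinv[OF _ DM s(4)]
          act_add_right act_scale_right v1 v0(2)]) (assumption, rule that)
  define W where "W = {w \<in> ?V. act D w = fscale l w}"
  have "fv.subspace W"
    using range_subspace[of s] unfolding W_def fv.subspace_def
    by (auto simp: act_add_right act_scale_right fv.scale_right_distrib mult.commute)
       (simp add: act_def fscale_def fun_eq_iff)
  moreover have "W \<subseteq> vecs X"
    by (auto simp: W_def)
  moreover have "act u w \<in> W" if "u \<in> U" "w \<in> W" for u w
  proof -
    have uM: "u \<in> M" and us: "u * s = s * u" and uD: "u * D = D * u"
      using that U_sub s(1) D(1) by (auto simp: N_def)
    have "act D (act u w) = act u (act D w)"
      using act_mult[OF DM, of u w] act_mult[OF uM, of D w] uD by simp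
    then show ?thesis
      using that(2) Vinv[OF _ uM us, of w] by (simp add: W_def act_scale_right)
  qed
  ultimately obtain P where P: "P \<in> N" "proj P" "\<And>v. act P v \<in> W" "\<And>v. v \<in> W \<Longrightarrow> act P v = v"
    by (rule invariant_projection) (assumption, assumption, rule that)
  have PM: "P \<in> M"
    using P(1) N_M by blast
  have sP: "s * P = P"
    using P(3) by (intro act_eqI M_mult sM PM) (simp add: act_mult[OF sM] W_def)
  have DP: "D * P = l *\<^sub>C P"
    using P(3) by (intro act_eqI M_mult M_scale DM PM) (simp add: act_mult[OF DM] W_def act_scale_left)
  have "v \<in> W"
    using v by (simp add: W_def)
  then have P0: "P \<noteq> 0"
    using P(4) v(2) act_zero_left by metis
  \<comment> \<open>Letting \<open>D\<close> act to the right and to the left in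
    \<open>P * D * P\<close> gives \<open>l\<close> and \<open>cnj l\<close>, so the eigenvalue is
    real.\<close>
  have "l *\<^sub>C P = P * (D * P)"
    using DP P(2) by (simp add: proj_def)
  also have "\<dots> = star (D * P) * P"
    using P(2) D(2) by (simp add: proj_def mult.assoc)
  also have "\<dots> = cnj l *\<^sub>C P"
    using P(2) by (simp add: DP proj_def)
  finally have "(l - cnj l) *\<^sub>C P = 0"
    by (simp add: cscale_diff_left)
  then have "l = cnj l"
    using P0 by (simp add: cscale_eq_0)
  then have lr: "l = complex_of_real (Re l)"
    by (simp add: complex_eq_iff)
  \<comment> \<open>A nonzero projection of \<open>N\<close> below one with \<open>?C\<close> again
    satisfies \<open>?C\<close>. Least rank within \<open>?C\<close> is therefore minimality in all
    of \<open>N\<close>.\<close>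
  let ?C = "\<lambda>q. q \<in> N \<and> proj q \<and> q \<noteq> 0 \<and> s * q = q \<and> D * q = l *\<^sub>C q"
  have "?C P"
    using P P0 sP DP by simp
  from ex_has_least_nat[of ?C, OF this, of rk]
  obtain p where p: "?C p" and least: "\<And>q. ?C q \<Longrightarrow> rk p \<le> rk q"
    by blast
  have "q = 0 \<or> q = p" if q: "q \<in> N" "proj q" "q * p = q" for q
  proof (rule ccontr)
    assume ne: "\<not> ?thesis"
    have pq: "p * q = q"
      using p q by (metis proj_def star_mult)
    have "s * q = q" "D * q = l *\<^sub>C q"
      using p pq cscale_mult(1)[of l p q] by (metis mult.assoc)+
    then have "rk p \<le> rk q"
      using least ne q by blast
    moreover have "rk p = rk (p - q) + rk q" "proj (p - q)"
      using rk_diff[of p q] p q N_M by auto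
    moreover have "1 \<le> rk (p - q)"
      using rk_pos[of "p - q"] ne p q calculation(3) N_M N_diff by auto
    ultimately show False
      by linarith
  qed
  then have "minproj N p"
    using p by (auto simp: minproj_def)
  then show ?thesis
    using that[of p "Re l"] p lr by simp
qed

text \<open>Induction on the rank of \<open>s\<close>: an eigenprojection \<open>p\<close> of
  \<open>D\<close> is split off, and \<open>s - p\<close> has smaller rank and still commutes with
  \<open>D\<close>.\<close>

lemma minpartition_exists:
  assumes D: "D \<in> N" "star D = D"
  shows "s \<in> N \<Longrightarrow> proj s \<Longrightarrow> D * s = s * D \<Longrightarrow>
    \<exists>Q. minpartition N s Q \<and> (\<forall>p\<in>Q. s * p = p \<and> (\<exists>l. D * p = complex_of_real l *\<^sub>C p))"
proof (induction "rk s" arbitrary: s rule: less_induct)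
  case less
  show ?case
  proof (cases "s = 0")
    case True
    then show ?thesis
      by (intro exI[of _ "{}"]) (simp add: minpartition_def)
  next
    case False
    obtain p l where p: "minproj N p" "s * p = p" "D * p = complex_of_real l *\<^sub>C p"
      using minproj_eigen[OF D less.prems(1,2) False less.prems(3)] by blast
    have pN: "p \<in> N" "proj p" "p \<noteq> 0"
      using p(1) by (auto simp: minproj_def)
    have ps: "p * s = p"
      using p(2) pN(2) less.prems(2) by (metis proj_def star_mult)
    have "p * D = star (D * p)"
      using pN(2) D(2) by (simp add: proj_def)
    also have "\<dots> = D * p"
      using pN(2) by (simp add: p(3) proj_def)
    finally have "D * (s - p) = (s - p) * D"
      using less.prems(3) by (simp add: algebra_simps)
    moreover have "proj (s - p)" "rk s = rk (s - p) + rk p"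
      using rk_diff[of s p] less.prems pN ps N_M by auto
    moreover have "1 \<le> rk p"
      using rk_pos pN N_M by auto
    ultimately obtain Q where Q: "minpartition N (s - p) Q"
      "\<forall>q\<in>Q. (s - p) * q = q \<and> (\<exists>l. D * q = complex_of_real l *\<^sub>C q)"
      using less.hyps[of "s - p"] less.prems(1) pN(1) N_diff by auto
    have orth: "p * q = 0 \<and> q * p = 0 \<and> s * q = q" if "q \<in> Q" for q
    proof -
      have q: "(s - p) * q = q" "star q = q"
        using Q that by (auto simp: minpartition_def minproj_def proj_def)
      have "p * q = p * ((s - p) * q)"
        using q by simp
      also have "\<dots> = 0"
        using ps pN(2) by (simp add: mult.assoc[symmetric] algebra_simps proj_def)
      finally have "p * q = 0" .
      moreover have "q * p = 0"
        using arg_cong[OF calculation, of star] q(2) pN(2) by (simp add: proj_def)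
      ultimately show ?thesis
        using q(1) by (simp add: algebra_simps)
    qed
    have "p \<notin> Q"
      using orth pN by (auto simp: proj_def)
    then have "minpartition N s (insert p Q)"
      using Q(1) p(1) orth by (auto simp: minpartition_def)
    then show ?thesis
      using Q(2) orth p by (intro exI[of _ "insert p Q"]) auto
  qed
qed

lemma minpartition_exists': "s \<in> N \<Longrightarrow> proj s \<Longrightarrow> \<exists>Q. minpartition N s Q \<and> (\<forall>p\<in>Q. s * p = p)"
  using minpartition_exists[OF N_one star_simps(2), of s] by auto

lemma cartesian_decomposition:
  assumes "K \<in> N"
  obtains A B where "A \<in> N" "star A = A" "B \<in> N" "star B = B" "K = A + \<i> *\<^sub>C B"
proof
  let ?A = "(1/2) *\<^sub>C (K + star K)" and ?B = "(- \<i>/2) *\<^sub>C (K - star K)"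
  show "?A \<in> N" "?B \<in> N"
    using assms by (simp_all add: N_closed)
  show "star ?A = ?A" "star ?B = ?B" "K = ?A + \<i> *\<^sub>C ?B"
    by (rule fmat_eqI, simp add: algebra_simps)+
qed

text \<open>For self-adjoint \<open>H\<close>, the element \<open>p * H * p\<close> has a minimal
  eigenprojection below \<open>p\<close>, which can only be \<open>p\<close> itself. Real and
  imaginary parts reduce any \<open>K\<close> to this case.\<close>

lemma minproj_corner:
  assumes p: "minproj N p" and K: "K \<in> N"
  obtains c where "p * K * p = c *\<^sub>C p"
proof -
  have pN: "p \<in> N" "proj p" "p \<noteq> 0"
    using p by (auto simp: minproj_def)
  have herm: "\<exists>c. p * H * p = c *\<^sub>C p" if H: "H \<in> N" "star H = H" for H
  proof -
    let ?D = "p * H * p"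
    have "?D \<in> N" "star ?D = ?D" "?D * p = p * ?D"
      using H pN N_mult by (auto simp: proj_def mult.assoc) (metis mult.assoc)
    then obtain q l where q: "minproj N q" "p * q = q" "?D * q = complex_of_real l *\<^sub>C q"
      using minproj_eigen[of ?D p] pN by blast
    have "q * p = q"
      using q pN by (metis minproj_def proj_def star_mult)
    then have "q = p"
      using q(1) p by (auto simp: minproj_def)
    moreover have "?D * p = ?D"
      using pN(2) by (simp add: proj_def mult.assoc)
    ultimately show ?thesis
      using q(3) by auto
  qed
  obtain A B where AB: "A \<in> N" "star A = A" "B \<in> N" "star B = B" "K = A + \<i> *\<^sub>C B"
    by (rule cartesian_decomposition[OF K])
  then obtain a b where "p * A * p = a *\<^sub>C p" "p * B * p = b *\<^sub>C p"
    using herm by blast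
  then have "p * K * p = (a + \<i> * b) *\<^sub>C p"
    by (simp add: AB(5) algebra_simps cscale_add_left)
  then show ?thesis
    using that by blast
qed

text \<open>By \<open>minproj_corner\<close>, \<open>x = p * K * q\<close> satisfies
  \<open>star x * x = c q\<close> and \<open>x * star x = d p\<close>. Evaluating
  \<open>x * star x * x\<close> in two ways gives \<open>c = d\<close>, which is nonzero, and the
  two products have equal trace: up to a factor, \<open>x\<close> is a partial isometry between the
  ranges.\<close>

lemma minproj_equal_trace:
  assumes p: "minproj N p" and q: "minproj N q" and K: "K \<in> N" and ne: "p * K * q \<noteq> 0"
  shows "tr p = tr q"
proof -
  define x where "x = p * K * q"
  have N: "p \<in> N" "q \<in> N" "proj p" "proj q"
    using p q by (auto simp: minproj_def)
  have xM: "x \<in> M" "star x \<in> M"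
    using N K by (auto simp: x_def N_M N_closed)
  obtain c where c: "star x * x = c *\<^sub>C q"
    using minproj_corner[OF q, of "star K * p * K"] N K
    by (metis (no_types, lifting) N_mult N_star mult.assoc proj_def star_mult x_def)
  obtain d where d: "x * star x = d *\<^sub>C p"
    using minproj_corner[OF p, of "K * q * star K"] N K
    by (metis (no_types, lifting) N_mult N_star mult.assoc proj_def star_mult x_def)
  have "c \<noteq> 0"
    using c tr_star_mult_eq_0[OF xM(1)] ne tr_zero by (auto simp: x_def)
  have "p * x = x" "x * q = x"
    using N by (simp_all add: x_def proj_def mult.assoc) (simp add: mult.assoc[symmetric])
  then have "c *\<^sub>C x = x * (star x * x)"
    by (simp only: c cscale_mult)
  also have "\<dots> = d *\<^sub>C x"
    using \<open>p * x = x\<close> by (simp only: mult.assoc[symmetric] d cscale_mult)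
  finally have "(c - d) *\<^sub>C x = 0"
    by (simp add: cscale_diff_left)
  then have "c = d"
    using ne by (auto simp: cscale_eq_0 x_def)
  moreover have "c * tr q = d * tr p"
    using tr_commute[OF xM] c d tr_scale by metis
  ultimately show ?thesis
    using \<open>c \<noteq> 0\<close> by simp
qed

end

section \<open>Entropy inequalities\<close>

definition eta :: "real \<Rightarrow> real" where
  "eta x = - x * ln x"

lemma eta_zero [simp]: "eta 0 = 0"
  by (simp add: eta_def)

lemma eta_nonneg: "0 \<le> x \<Longrightarrow> x \<le> 1 \<Longrightarrow> 0 \<le> eta x"
  unfolding eta_def by (cases "x = 0") (auto intro!: mult_nonneg_nonpos)

text \<open>This is \<open>ln t \<le> t - 1\<close> at \<open>t = y / x\<close>. The linear terms
  \<open>y - x\<close> cancel when families of equal total are summed, which makes this the common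
  source of the entropy estimates below.\<close>

lemma gibbs:
  assumes "0 \<le> x" "0 < y"
  shows "eta x \<le> - x * ln y + y - x"
proof (cases "x = 0")
  case False
  then have "x > 0"
    using assms by simp
  have "ln (y / x) \<le> y / x - 1"
    using \<open>x > 0\<close> assms by (intro ln_le_minus_one) simp
  then have "x * ln (y / x) \<le> x * (y / x - 1)"
    using \<open>x > 0\<close> by (intro mult_left_mono) auto
  then show ?thesis
    using \<open>x > 0\<close> assms by (simp add: eta_def ln_div algebra_simps)
qed (use assms in simp)

text \<open>Jensen's inequality, obtained from \<open>gibbs\<close> with the mean as
  \<open>y\<close> throughout. A vanishing mean is set apart since \<open>gibbs\<close> requires
  \<open>y > 0\<close>.\<close>

lemma eta_concave:
  fixes a x :: "'i \<Rightarrow> real"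
  assumes "finite I" "\<And>i. i \<in> I \<Longrightarrow> 0 \<le> a i" "\<And>i. i \<in> I \<Longrightarrow> 0 \<le> x i" "sum a I = 1"
  shows "(\<Sum>i\<in>I. a i * eta (x i)) \<le> eta (\<Sum>i\<in>I. a i * x i)"
proof (cases "(\<Sum>i\<in>I. a i * x i) = 0")
  case True
  then have "a i * x i = 0" if "i \<in> I" for i
    using assms that by (simp add: sum_nonneg_eq_0_iff)
  then have "(\<Sum>i\<in>I. a i * eta (x i)) = 0"
    by (intro sum.neutral) (auto simp: eta_def)
  with True show ?thesis
    by simp
next
  case False
  define y where "y = (\<Sum>i\<in>I. a i * x i)"
  have "y > 0"
    using False assms by (simp add: y_def less_le sum_nonneg)
  then have "(\<Sum>i\<in>I. a i * eta (x i)) \<le> (\<Sum>i\<in>I. a i * (- x i * ln y + y - x i))"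
    using assms gibbs by (intro sum_mono mult_left_mono) auto
  also have "\<dots> = (\<Sum>i\<in>I. (a i * x i) * (- ln y) + a i * y - a i * x i)"
    by (simp add: algebra_simps)
  also have "\<dots> = y * (- ln y) + sum a I * y - y"
    by (simp only: sum.distrib sum_subtractf sum_distrib_right[symmetric] y_def[symmetric])
  finally show ?thesis
    using assms by (simp add: eta_def y_def)
qed

text \<open>\<open>gibbs\<close> against the total spread evenly over \<open>r\<close> cells; if
  there are fewer than \<open>r\<close> terms, the linear part becomes nonpositive instead of
  zero.\<close>

lemma eta_refine:
  fixes x :: "'i \<Rightarrow> real"
  assumes "finite I" "\<And>i. i \<in> I \<Longrightarrow> 0 \<le> x i" "card I \<le> r" "1 \<le> r"
  shows "(\<Sum>i\<in>I. eta (x i)) \<le> eta (sum x I) + sum x I * ln r"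
proof (cases "sum x I = 0")
  case True
  then have "(\<Sum>i\<in>I. eta (x i)) = 0"
    using assms by (intro sum.neutral) (auto simp: sum_nonneg_eq_0_iff)
  with True show ?thesis
    by simp
next
  case False
  let ?s = "sum x I"
  have s: "?s > 0"
    using False assms by (simp add: less_le sum_nonneg)
  have r: "real r > 0"
    using assms by simp
  have "(\<Sum>i\<in>I. eta (x i)) \<le> (\<Sum>i\<in>I. - x i * ln (?s / r) + ?s / r - x i)"
    using assms gibbs s r by (intro sum_mono) auto
  also have "\<dots> = - ?s * ln (?s / r) + card I * (?s / r) - ?s"
    by (simp add: sum.distrib sum_subtractf sum_negf sum_distrib_right)
  also have "\<dots> \<le> - ?s * ln (?s / r) + r * (?s / r) - ?s"
    using s r assms(3) by (intro diff_right_mono add_left_mono mult_right_mono) auto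
  also have "\<dots> = eta ?s + ?s * ln r"
    using s r by (simp add: eta_def ln_div algebra_simps)
  finally show ?thesis .
qed

section \<open>Kernels of matrices\<close>

lemma projection_in_ent:
  "projection_in (ent ` N) (ent p) \<longleftrightarrow> p \<in> N \<and> proj p" for p :: "(int \<Rightarrow> 'd) fmat"
  by (auto simp: projection_in_def proj_def kernel_ent ent_inject image_iff)

lemma projection_in_entE:
  assumes "projection_in (ent ` N) K"
  obtains p where "K = ent p" "p \<in> N" "proj p"
  using assms projection_in_ent by (metis imageE projection_in_def)

lemma minimal_projection_ent:
  "minimal_projection (ent ` N) (ent p) \<longleftrightarrow> minproj N p" for p :: "(int \<Rightarrow> 'd) fmat"
proof -
  have "(\<forall>K. projection_in (ent ` N) K \<and> kmult K (ent p) = K \<longrightarrow> K = kzero \<or> K = ent p) \<longleftrightarrow>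
      (\<forall>q\<in>N. proj q \<and> q * p = q \<longrightarrow> q = 0 \<or> q = p)"
  proof (intro iffI ballI allI impI)
    fix q assume *: "\<forall>K. projection_in (ent ` N) K \<and> kmult K (ent p) = K \<longrightarrow> K = kzero \<or> K = ent p"
      and "q \<in> N" "proj q \<and> q * p = q"
    then show "q = 0 \<or> q = p"
      using *[rule_format, of "ent q"] by (simp add: projection_in_ent kernel_ent ent_inject)
  next
    fix K assume *: "\<forall>q\<in>N. proj q \<and> q * p = q \<longrightarrow> q = 0 \<or> q = p"
      and K: "projection_in (ent ` N) K \<and> kmult K (ent p) = K"
    then obtain q where "K = ent q" "q \<in> N" "proj q"
      using projection_in_entE by blast
    then show "K = kzero \<or> K = ent p"
      using * K by (auto simp: kernel_ent ent_inject)
  qed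
  then show ?thesis
    by (auto simp: minimal_projection_def minproj_def projection_in_ent kzero_ent ent_inject)
qed

lemma minimal_projection_ent_iff:
  "minimal_projection (ent ` N) K \<longleftrightarrow> (\<exists>p. K = ent p \<and> minproj N p)"
  by (metis minimal_projection_def minimal_projection_ent projection_in_entE)

section \<open>The canonical trace and the density of a state\<close>

context commutant
begin

section \<open>Linear functionals and spectral expansions in the commutant\<close>

definition linear_on_N :: "('x fmat \<Rightarrow> complex) \<Rightarrow> bool" where
  "linear_on_N f \<longleftrightarrow> (\<forall>A\<in>N. \<forall>B\<in>N. f (A + B) = f A + f B) \<and> (\<forall>c. \<forall>A\<in>N. f (c *\<^sub>C A) = c * f A)"

lemma linear_on_N_zero: "linear_on_N f \<Longrightarrow> f 0 = 0"
  unfolding linear_on_N_def using N_zero by (metis cscale_simps(1) mult_zero_left)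

lemma linear_on_N_sum: "linear_on_N f \<Longrightarrow> (\<And>s. s \<in> S \<Longrightarrow> g s \<in> N) \<Longrightarrow> f (\<Sum>s\<in>S. g s) = (\<Sum>s\<in>S. f (g s))"
  by (induction S rule: infinite_finite_induct) (auto simp: linear_on_N_zero, auto simp: linear_on_N_def N_sum)

lemma linear_on_N_cscale: "linear_on_N f \<Longrightarrow> A \<in> N \<Longrightarrow> f (c *\<^sub>C A) = c * f A"
  by (simp add: linear_on_N_def)

lemma linear_on_N_add: "linear_on_N f \<Longrightarrow> A \<in> N \<Longrightarrow> B \<in> N \<Longrightarrow> f (A + B) = f A + f B"
  by (simp add: linear_on_N_def)

lemma hermitian_expansion:
  assumes "D \<in> N" "star D = D"
  obtains Q l where "minpartition N 1 Q" "D = (\<Sum>p\<in>Q. complex_of_real (l p) *\<^sub>C p)"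
    "\<And>p. p \<in> Q \<Longrightarrow> D * p = complex_of_real (l p) *\<^sub>C p"
proof -
  obtain Q where Q: "minpartition N 1 Q" "\<forall>p\<in>Q. \<exists>l. D * p = complex_of_real l *\<^sub>C p"
    using minpartition_exists[OF assms, of 1] N_one by (auto simp: proj_def)
  then obtain l where l: "\<And>p. p \<in> Q \<Longrightarrow> D * p = complex_of_real (l p) *\<^sub>C p"
    by metis
  have "D = D * \<Sum>Q"
    using Q(1) by (simp add: minpartition_def)
  also have "\<dots> = (\<Sum>p\<in>Q. complex_of_real (l p) *\<^sub>C p)"
    using l by (simp add: sum_distrib_left)
  finally show ?thesis
    using that Q(1) l by blast
qed

lemma minpartitionD:
  assumes "minpartition N s Q"
  shows "finite Q" "\<And>p. p \<in> Q \<Longrightarrow> p \<in> N" "\<And>p. p \<in> Q \<Longrightarrow> proj p" "\<And>p. p \<in> Q \<Longrightarrow> p \<noteq> 0"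
    "\<And>p. p \<in> Q \<Longrightarrow> minproj N p" "\<And>p q. p \<in> Q \<Longrightarrow> q \<in> Q \<Longrightarrow> p * q = (if p = q then p else 0)" "\<Sum>Q = s"
  using assms by (auto simp: minpartition_def minproj_def proj_def)

text \<open>Minimal projections span \<open>N\<close>: self-adjoint elements by their spectral
  expansion, the others through real and imaginary parts. Uniqueness of the canonical trace rests on
  this.\<close>

lemma linear_on_N_eqI:
  assumes f: "linear_on_N f" and g: "linear_on_N g" and eq: "\<And>p. minproj N p \<Longrightarrow> f p = g p"
    and A: "A \<in> N"
  shows "f A = g A"
proof -
  have herm: "f D = g D" if "D \<in> N" "star D = D" for D
  proof -
    obtain Q l where Q: "minpartition N 1 Q" and D: "D = (\<Sum>p\<in>Q. complex_of_real (l p) *\<^sub>C p)"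
      using hermitian_expansion[OF \<open>D \<in> N\<close> \<open>star D = D\<close>] by blast
    have "f D = (\<Sum>p\<in>Q. complex_of_real (l p) * f p)"
      unfolding D using minpartitionD[OF Q] f by (simp add: linear_on_N_sum linear_on_N_cscale N_scale)
    moreover have "g D = (\<Sum>p\<in>Q. complex_of_real (l p) * g p)"
      unfolding D using minpartitionD[OF Q] g by (simp add: linear_on_N_sum linear_on_N_cscale N_scale)
    ultimately show ?thesis
      using eq minpartitionD[OF Q] by simp
  qed
  obtain B C where BC: "B \<in> N" "star B = B" "C \<in> N" "star C = C" "A = B + \<i> *\<^sub>C C"
    using cartesian_decomposition[OF A] by blast
  show ?thesis
    using f g herm[OF BC(1,2)] herm[OF BC(3,4)] BC
    by (simp add: linear_on_N_add linear_on_N_cscale N_scale)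
qed

section \<open>The canonical trace\<close>

definition Q0 :: "'x fmat set" where
  "Q0 = (SOME Q. minpartition N 1 Q)"

lemma Q0: "minpartition N 1 Q0"
  unfolding Q0_def by (rule someI_ex) (use minpartition_exists'[of 1] N_one in \<open>auto simp: proj_def\<close>)

lemmas Q0D = minpartitionD[OF Q0]

lemma minproj_rk: "minproj N p \<Longrightarrow> tr p = of_nat (rk p)" "minproj N p \<Longrightarrow> 1 \<le> rk p"
  using tr_rk rk_pos N_M by (auto simp: minproj_def)

lemma Q0_tr: "p \<in> Q0 \<Longrightarrow> tr p \<noteq> 0"
  using minproj_rk[of p] Q0D by force

text \<open>
  In a factor of \<open>N\<close> isomorphic to a matrix algebra, all minimal projections have the same trace;
  dividing by it factor by factor turns the trace of \<open>M\<close> into the canonical trace of \<open>N\<close>.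
\<close>

definition tau :: "'x fmat \<Rightarrow> complex" where
  "tau A = (\<Sum>p\<in>Q0. tr (p * A) / tr p)"

lemma tau_linear: "linear_on_N tau"
  by (simp add: linear_on_N_def tau_def algebra_simps tr_add tr_scale add_divide_distrib sum.distrib sum_distrib_left)

lemma tau_diff: "tau (A - B) = tau A - tau B"
  by (simp add: tau_def right_diff_distrib tr_diff diff_divide_distrib sum_subtractf)

text \<open>Inserting \<open>\<Sum>Q0 = 1\<close> between the factors splits both sides into terms
  indexed by pairs \<open>p\<close>, \<open>q\<close>. If \<open>p * A * q = 0\<close>, both terms
  of the pair vanish; otherwise \<open>tr p = tr q\<close>, the denominators agree, and
  \<open>tr_commute\<close> applies.\<close>

lemma tau_commute:
  assumes A: "A \<in> N" and B: "B \<in> N"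
  shows "tau (A * B) = tau (B * A)"
proof -
  have expand: "tau (A * B) = (\<Sum>p\<in>Q0. \<Sum>q\<in>Q0. tr (p * A * q * B) / tr p)" for A B
  proof -
    have "tr (p * (A * B)) = (\<Sum>q\<in>Q0. tr (p * A * q * B))" for p
    proof -
      have "p * (A * B) = p * A * \<Sum>Q0 * B"
        using Q0D(7) by (simp add: mult.assoc)
      also have "\<dots> = (\<Sum>q\<in>Q0. p * A * q * B)"
        by (simp add: sum_distrib_left sum_distrib_right)
      finally show ?thesis
        by (simp add: tr_sum)
    qed
    then show ?thesis
      by (simp add: tau_def sum_divide_distrib)
  qed
  have "tr (p * A * q * B) / tr p = tr (q * B * p * A) / tr q" if "p \<in> Q0" "q \<in> Q0" for p q
  proof (cases "p * A * q = 0")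
    case True
    have "tr (q * B * p * A) = tr (q * (B * p * A * q))"
    proof -
      have "tr (q * (q * B * p * A)) = tr (q * B * p * A * q)"
        using that A B Q0D(2) by (intro tr_commute) (auto intro!: N_M N_closed)
      then show ?thesis
        using Q0D(6)[OF that(2,2)] by (simp add: mult.assoc[symmetric])
    qed
    also have "\<dots> = tr (q * B * (p * A * q))"
      by (simp add: mult.assoc)
    finally show ?thesis
      using True tr_zero by simp
  next
    case False
    then have "tr p = tr q"
      using minproj_equal_trace that Q0D(5) A by blast
    moreover have "tr ((p * A) * (q * B)) = tr ((q * B) * (p * A))"
      using that A B Q0D(2) by (intro tr_commute) (auto intro!: N_M N_closed)
    ultimately show ?thesis
      by (simp add: mult.assoc)
  qed
  then have "tau (A * B) = (\<Sum>p\<in>Q0. \<Sum>q\<in>Q0. tr (q * B * p * A) / tr q)"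
    unfolding expand by (intro sum.cong) auto
  also have "\<dots> = tau (B * A)"
    unfolding expand by (rule sum.swap)
  finally show ?thesis .
qed

text \<open>The denominator \<open>tr p\<close> may be replaced by \<open>tr q\<close>, since the
  two agree unless \<open>p * q = 0\<close>; then the \<open>p\<close> in \<open>Q0\<close> sum to
  the unit.\<close>

lemma tau_minproj:
  assumes "minproj N q"
  shows "tau q = 1"
proof -
  have "tr (p * q) / tr p = tr (p * q) / tr q" if "p \<in> Q0" for p
    using minproj_equal_trace[OF Q0D(5)[OF that] assms N_one] tr_zero by (cases "p * q = 0") auto
  then have "tau q = (\<Sum>p\<in>Q0. tr (p * q) / tr q)"
    unfolding tau_def by (intro sum.cong refl)
  also have "\<dots> = tr (\<Sum>Q0 * q) / tr q"
    by (simp add: sum_distrib_right tr_sum sum_divide_distrib)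
  also have "\<dots> = 1"
    using Q0D(7) minproj_rk[OF assms] by simp
  finally show ?thesis .
qed

lemma tau_star: "A \<in> N \<Longrightarrow> tau (star A) = cnj (tau A)"
proof -
  assume A: "A \<in> N"
  have "tr (p * star A) / tr p = cnj (tr (p * A) / tr p)" if "p \<in> Q0" for p
  proof -
    have "star p = p"
      using Q0D(3)[OF that] by (simp add: proj_def)
    then have "p * star A = star (A * p)"
      by simp
    then have "tr (p * star A) = cnj (tr (A * p))"
      by (simp only: tr_star)
    also have "tr (A * p) = tr (p * A)"
      using A that Q0D(2) by (intro tr_commute N_M)
    finally show ?thesis
      using minproj_rk(1)[OF Q0D(5)[OF that]] by simp
  qed
  then show ?thesis
    by (simp add: tau_def)
qed

lemma tau_star_mult_term:
  assumes "A \<in> N" "p \<in> Q0"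
  shows "tr (p * (star A * A)) = tr (star (A * p) * (A * p))"
proof -
  have p: "star p = p" "p * p = p"
    using Q0D(3)[OF assms(2)] by (simp_all add: proj_def)
  have "tr (p * (p * (star A * A))) = tr (p * (star A * A) * p)"
    using assms Q0D(2) by (intro tr_commute N_M N_closed)
  then show ?thesis
    using p by (simp add: mult.assoc[symmetric])
qed

text \<open>The summand for \<open>p\<close> is a positive multiple of the squared Hilbert-Schmidt
  norm of \<open>A * p\<close>. Positivity and faithfulness of \<open>tau\<close> are both read off
  from this.\<close>

lemma tau_star_mult_sum:
  assumes "A \<in> N"
  obtains t where "\<And>p. p \<in> Q0 \<Longrightarrow> t p \<ge> 0" "\<And>p. p \<in> Q0 \<Longrightarrow> t p = 0 \<Longrightarrow> A * p = 0"
    "tau (star A * A) = of_real (\<Sum>p\<in>Q0. t p)"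
proof -
  have "\<exists>t\<ge>0. tr (p * (star A * A)) / tr p = complex_of_real t \<and> (t = 0 \<longrightarrow> A * p = 0)" if p: "p \<in> Q0" for p
  proof -
    have M: "A * p \<in> M"
      using assms p Q0D(2) by (intro N_M N_closed)
    obtain t where t: "t \<ge> 0" "tr (star (A * p) * (A * p)) = of_real t"
      using tr_star_mult_nonneg[OF M] by blast
    have "rk p \<ge> 1" and eq: "tr p = complex_of_real (real (rk p))"
      using minproj_rk[OF Q0D(5)[OF p]] by auto
    then show ?thesis
      using t tr_star_mult_eq_0[OF M] tau_star_mult_term[OF assms p]
      by (intro exI[of _ "t / real (rk p)"]) (auto simp: of_real_divide)
  qed
  then obtain t where t: "\<And>p. p \<in> Q0 \<Longrightarrow> t p \<ge> 0 \<and> tr (p * (star A * A)) / tr p = complex_of_real (t p) \<and> (t p = 0 \<longrightarrow> A * p = 0)"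
    by metis
  then have "tau (star A * A) = of_real (\<Sum>p\<in>Q0. t p)"
    by (simp add: tau_def)
  with t that show ?thesis
    by blast
qed

lemma tau_star_mult_nonneg: "A \<in> N \<Longrightarrow> \<exists>t\<ge>0. tau (star A * A) = complex_of_real t"
  by (erule tau_star_mult_sum) (metis sum_nonneg)

lemma tau_star_mult_eq_0:
  assumes "A \<in> N" "tau (star A * A) = 0"
  shows "A = 0"
proof -
  obtain t where t: "\<And>p. p \<in> Q0 \<Longrightarrow> t p \<ge> 0" "\<And>p. p \<in> Q0 \<Longrightarrow> t p = 0 \<Longrightarrow> A * p = 0"
    "tau (star A * A) = of_real (\<Sum>p\<in>Q0. t p)"
    using tau_star_mult_sum[OF assms(1)] by blast
  have "(\<Sum>p\<in>Q0. t p) = 0"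
    using t(3) assms(2) by (metis of_real_eq_0_iff)
  then have "\<And>p. p \<in> Q0 \<Longrightarrow> A * p = 0"
    using t(1,2) Q0D(1) by (simp add: sum_nonneg_eq_0_iff)
  then have "A * \<Sum>Q0 = 0"
    by (simp add: sum_distrib_left)
  then show ?thesis
    using Q0D(7) by simp
qed

text \<open>Restricting entries embeds \<open>N\<close> into the functions on
  \<open>X \<times> X\<close>, with inner product \<open>tr (star A * B)\<close>. An orthonormal
  basis of the image, lifted to elements \<open>h e\<close>, expands every \<open>K\<close> in
  \<open>N\<close>; applying \<open>f\<close> to the expansion yields the sum of
  \<open>f (h e)\<close> times \<open>star (h e)\<close> as \<open>D\<close>.\<close>

lemma tr_riesz:
  assumes f: "linear_on_N f"
  obtains D where "D \<in> N" "\<And>K. K \<in> N \<Longrightarrow> f K = tr (D * K)"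
proof -
  let ?v = "\<lambda>A (a, b). if a \<in> X \<and> b \<in> X then ent A a b else 0"
  have ip: "ip (X \<times> X) (?v A) (?v B) = tr (star A * B)" if "A \<in> M" for A B
  proof -
    have "ip (X \<times> X) (?v A) (?v B) = (\<Sum>a\<in>X. \<Sum>b\<in>X. cnj (ent A a b) * ent B a b)"
      unfolding ip_def sum.cartesian_product by (intro sum.cong) auto
    also have "\<dots> = (\<Sum>b\<in>X. \<Sum>a\<in>X. cnj (ent A a b) * ent B a b)"
      by (rule sum.swap)
    also have "\<dots> = tr (star A * B)"
      using M_star[OF that] by (simp add: tr_def ent_mult_sector)
    finally show ?thesis .
  qed
  have sub: "fv.subspace (?v ` N)"
  proof (unfold fv.subspace_def, intro conjI ballI allI)
    show "0 \<in> ?v ` N"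
      by (rule image_eqI[of _ _ 0]) (auto simp: N_zero)
    show "x + y \<in> ?v ` N" if xy: "x \<in> ?v ` N" "y \<in> ?v ` N" for x y
    proof -
      obtain A B where "A \<in> N" "B \<in> N" "x = ?v A" "y = ?v B"
        using xy by (elim imageE) (rule that)
      then show ?thesis
        by (intro image_eqI[of _ _ "A + B"]) (auto simp: N_add)
    qed
    show "fscale c x \<in> ?v ` N" if x: "x \<in> ?v ` N" for c x
    proof -
      obtain A where "A \<in> N" "x = ?v A"
        using x by (elim imageE) (rule that)
      then show ?thesis
        by (intro image_eqI[of _ _ "c *\<^sub>C A"]) (auto simp: N_scale fscale_def)
    qed
  qed
  have "?v ` N \<subseteq> vecs (X \<times> X)"
    by (auto simp: vecs_def)
  then obtain E where E: "orthonormal (X \<times> X) E" "E \<subseteq> ?v ` N"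
    "\<And>v. v \<in> ?v ` N \<Longrightarrow> v = (\<Sum>e\<in>E. fscale (ip (X \<times> X) e v) e)"
    by (rule orthonormal_basis_exists[OF finite_cartesian_product[OF fin fin] sub]) (rule that)
  have "\<forall>e\<in>E. \<exists>A. A \<in> N \<and> e = ?v A"
    using E(2) by auto
  then obtain h where h: "\<And>e. e \<in> E \<Longrightarrow> h e \<in> N \<and> e = ?v (h e)"
    unfolding bchoice_iff by (elim exE) (rule that, drule bspec)
  have exp: "K = (\<Sum>e\<in>E. tr (star (h e) * K) *\<^sub>C h e)" if K: "K \<in> N" for K
  proof (rule M_eqI)
    fix a b assume ab: "a \<in> X" "b \<in> X"
    have "ent K a b = ?v K (a, b)"
      using ab by simp
    also have "\<dots> = (\<Sum>e\<in>E. fscale (ip (X \<times> X) e (?v K)) e) (a, b)"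
      by (rule fun_cong[OF E(3)[OF imageI[OF K]]])
    also have "\<dots> = (\<Sum>e\<in>E. tr (star (h e) * K) * ent (h e) a b)"
      unfolding sum_fun_apply fscale_def
    proof (rule sum.cong)
      fix e assume e: "e \<in> E"
      have "ip (X \<times> X) e (?v K) = tr (star (h e) * K)"
        by (subst conjunct2[OF h[OF e]]) (rule ip[OF N_M[OF conjunct1[OF h[OF e]]]])
      moreover have "e (a, b) = ent (h e) a b"
        by (subst conjunct2[OF h[OF e]]) (simp add: ab)
      ultimately show "ip (X \<times> X) e (?v K) * e (a, b) = tr (star (h e) * K) * ent (h e) a b"
        by simp
    qed simp
    finally show "ent K a b = ent (\<Sum>e\<in>E. tr (star (h e) * K) *\<^sub>C h e) a b"
      by simp
  qed (use K h in \<open>auto intro!: N_M N_closed\<close>)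
  let ?D = "\<Sum>e\<in>E. f (h e) *\<^sub>C star (h e)"
  have "f K = tr (?D * K)" if K: "K \<in> N" for K
  proof -
    have "f K = f (\<Sum>e\<in>E. tr (star (h e) * K) *\<^sub>C h e)"
      using exp[OF K] by simp
    also have "\<dots> = (\<Sum>e\<in>E. tr (star (h e) * K) * f (h e))"
      using h f by (simp add: linear_on_N_sum linear_on_N_cscale N_scale)
    also have "\<dots> = tr (?D * K)"
      by (simp add: sum_distrib_right tr_sum tr_scale mult.commute)
    finally show ?thesis .
  qed
  moreover have "?D \<in> N"
    using h by (auto intro!: N_closed)
  ultimately show ?thesis
    using that by blast
qed

text \<open>The weight \<open>W\<close> undoes the division in \<open>tau\<close>:
  \<open>p * W\<close> is \<open>p\<close> scaled by \<open>tr p\<close>, so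
  \<open>tau (W * D * K) = tr (D * K)\<close>.\<close>

lemma tau_riesz:
  assumes f: "linear_on_N f"
  obtains D where "D \<in> N" "\<And>K. K \<in> N \<Longrightarrow> f K = tau (D * K)"
proof -
  obtain D where D: "D \<in> N" "\<And>K. K \<in> N \<Longrightarrow> f K = tr (D * K)"
    using tr_riesz[OF f] by blast
  define W where "W = (\<Sum>p\<in>Q0. tr p *\<^sub>C p)"
  have W: "p * W = tr p *\<^sub>C p" if "p \<in> Q0" for p
  proof -
    have "p * W = (\<Sum>q\<in>Q0. if p = q then tr p *\<^sub>C p else 0)"
      using that Q0D(6) by (simp add: W_def sum_distrib_left if_distrib cong: if_cong) (intro sum.cong; auto)
    then show ?thesis
      using that Q0D(1) by simp
  qed
  have "tau (W * D * K) = tr (D * K)" for K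
  proof -
    have "tr (p * (W * D * K)) / tr p = tr (p * (D * K))" if "p \<in> Q0" for p
    proof -
      have "p * (W * D * K) = tr p *\<^sub>C (p * (D * K))"
        using W[OF that] by (simp add: mult.assoc[symmetric])
      then show ?thesis
        using Q0_tr[OF that] by (simp add: tr_scale)
    qed
    then have "tau (W * D * K) = tr (\<Sum>Q0 * (D * K))"
      by (simp add: tau_def tr_sum sum_distrib_right)
    then show ?thesis
      using Q0D(7) by simp
  qed
  moreover have "W * D \<in> N"
    using D(1) Q0D(2) by (auto simp: W_def intro!: N_closed)
  ultimately show ?thesis
    using that D(2) by simp
qed

text \<open>The test element \<open>star (D - D')\<close> reduces this to faithfulness. It will make
  the density unique.\<close>

lemma tau_nondegenerate:
  assumes "D \<in> N" "D' \<in> N" "\<And>K. K \<in> N \<Longrightarrow> tau (D * K) = tau (D' * K)"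
  shows "D = D'"
proof -
  let ?A = "D - D'"
  have A: "?A \<in> N" "star ?A \<in> N"
    using assms by (simp_all only: N_diff N_star)
  have "tau (?A * star ?A) = 0"
    using assms(3)[OF A(2)] by (simp add: left_diff_distrib tau_diff)
  then have "tau (star ?A * ?A) = 0"
    using tau_commute[OF A] by simp
  then show ?thesis
    using tau_star_mult_eq_0[OF A(1)] by simp
qed

section \<open>Spectral resolutions and functional calculus\<close>

definition resolution :: "'x fmat \<Rightarrow> real set \<Rightarrow> (real \<Rightarrow> 'x fmat) \<Rightarrow> bool" where
  "resolution D F R \<longleftrightarrow> finite F \<and> (\<forall>l\<in>F. R l \<in> N \<and> proj (R l)) \<and>
     (\<forall>l\<in>F. \<forall>m\<in>F. l \<noteq> m \<longrightarrow> R l * R m = 0) \<and>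
     (\<Sum>l\<in>F. R l) = 1 \<and> (\<Sum>l\<in>F. complex_of_real l *\<^sub>C R l) = D"

lemma resolution_mult:
  assumes "resolution D F R" "l \<in> F"
  shows "D * R l = complex_of_real l *\<^sub>C R l" "R l * D = complex_of_real l *\<^sub>C R l"
proof -
  have R: "R m * R l = (if m = l then R l else 0)" "R l * R m = (if m = l then R l else 0)" if "m \<in> F" for m
    using assms that by (auto simp: resolution_def proj_def)
  have fin: "finite F" and D: "D = (\<Sum>m\<in>F. complex_of_real m *\<^sub>C R m)"
    using assms by (auto simp: resolution_def)
  have "D * R l = (\<Sum>m\<in>F. if m = l then complex_of_real l *\<^sub>C R l else 0)"
    unfolding D sum_distrib_right by (intro sum.cong) (auto simp: R)
  then show "D * R l = complex_of_real l *\<^sub>C R l"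
    using fin assms(2) by simp
  have "R l * D = (\<Sum>m\<in>F. if m = l then complex_of_real l *\<^sub>C R l else 0)"
    unfolding D sum_distrib_left by (intro sum.cong) (auto simp: R)
  then show "R l * D = complex_of_real l *\<^sub>C R l"
    using fin assms(2) by simp
qed

text \<open>\<open>R l * S m\<close> vanishes unless \<open>l = m\<close>, as seen by letting
  \<open>D\<close> act from either side. Only the resulting sums are compared: the index sets can
  differ, because the projections in a resolution may be zero.\<close>

lemma resolution_unique:
  assumes F: "resolution D F R" and G: "resolution D G S"
  shows "(\<Sum>l\<in>F. complex_of_real (f l) *\<^sub>C R l) = (\<Sum>m\<in>G. complex_of_real (f m) *\<^sub>C S m)"
proof -
  have eq: "complex_of_real (f l) *\<^sub>C (R l * S m) = complex_of_real (f m) *\<^sub>C (R l * S m)" if "l \<in> F" "m \<in> G" for l m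
  proof -
    have "complex_of_real l *\<^sub>C (R l * S m) = R l * D * S m"
      using resolution_mult[OF F that(1)] by simp
    also have "\<dots> = complex_of_real m *\<^sub>C (R l * S m)"
      using resolution_mult[OF G that(2)] by (simp add: mult.assoc)
    finally have "(complex_of_real l - complex_of_real m) *\<^sub>C (R l * S m) = 0"
      by (simp add: cscale_diff_left)
    then show ?thesis
      by (auto simp: cscale_eq_0)
  qed
  have "(\<Sum>l\<in>F. complex_of_real (f l) *\<^sub>C R l) = (\<Sum>l\<in>F. complex_of_real (f l) *\<^sub>C (R l * (\<Sum>m\<in>G. S m)))"
    using G by (simp add: resolution_def)
  also have "\<dots> = (\<Sum>l\<in>F. \<Sum>m\<in>G. complex_of_real (f m) *\<^sub>C (R l * S m))"
    unfolding sum_distrib_left cscale_sum_right by (intro sum.cong refl eq)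
  also have "\<dots> = (\<Sum>m\<in>G. \<Sum>l\<in>F. complex_of_real (f m) *\<^sub>C (R l * S m))"
    by (rule sum.swap)
  also have "\<dots> = (\<Sum>m\<in>G. complex_of_real (f m) *\<^sub>C ((\<Sum>l\<in>F. R l) * S m))"
    by (simp add: sum_distrib_right cscale_sum_right)
  also have "\<dots> = (\<Sum>m\<in>G. complex_of_real (f m) *\<^sub>C S m)"
    using F by (simp add: resolution_def)
  finally show ?thesis .
qed

text \<open>A resolution has one projection per real number, so the minimal projections that share
  an eigenvalue are added up.\<close>

lemma resolution_of_minpartition:
  assumes Q: "minpartition N 1 Q" and D: "D = (\<Sum>p\<in>Q. complex_of_real (l p) *\<^sub>C p)"
  shows "resolution D (l ` Q) (\<lambda>c. \<Sum>{p \<in> Q. l p = c})"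
    "(\<Sum>c\<in>l ` Q. complex_of_real (f c) *\<^sub>C (\<Sum>{p \<in> Q. l p = c})) = (\<Sum>p\<in>Q. complex_of_real (f (l p)) *\<^sub>C p)"
proof -
  note QD = minpartitionD[OF Q]
  have gen: "(\<Sum>c\<in>l ` Q. complex_of_real (f c) *\<^sub>C (\<Sum>{p \<in> Q. l p = c})) = (\<Sum>p\<in>Q. complex_of_real (f (l p)) *\<^sub>C p)" for f
    unfolding sum.image_gen[OF QD(1), of "\<lambda>p. complex_of_real (f (l p)) *\<^sub>C p" l] cscale_sum_right
    by (auto intro!: sum.cong)
  then show "(\<Sum>c\<in>l ` Q. complex_of_real (f c) *\<^sub>C (\<Sum>{p \<in> Q. l p = c})) = (\<Sum>p\<in>Q. complex_of_real (f (l p)) *\<^sub>C p)" .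
  have mult: "\<Sum>A * \<Sum>B = \<Sum>(A \<inter> B)" if "A \<subseteq> Q" "B \<subseteq> Q" for A B
  proof -
    have fin: "finite A" "finite B"
      using that QD(1) finite_subset by blast+
    have "\<Sum>A * \<Sum>B = (\<Sum>p\<in>A. \<Sum>q\<in>B. if p = q then p else 0)"
      unfolding sum_product using that QD(6) by (intro sum.cong) (auto simp: subset_eq)
    also have "\<dots> = (\<Sum>p\<in>A. if p \<in> B then p else 0)"
      using fin by simp
    also have "\<dots> = \<Sum>(A \<inter> B)"
      using fin by (simp add: sum.inter_restrict)
    finally show ?thesis .
  qed
  have "star (\<Sum>A) = \<Sum>A" if "A \<subseteq> Q" for A
    using that QD(3) by (auto simp: star_sum proj_def intro!: sum.cong)
  then have "proj (\<Sum>{p \<in> Q. l p = c})" for c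
    by (simp add: proj_def mult)
  moreover have "\<Sum>{p \<in> Q. l p = c} * \<Sum>{p \<in> Q. l p = d} = 0" if "c \<noteq> d" for c d
    using that by (subst mult) (auto intro!: sum.neutral)
  moreover have "(\<Sum>c\<in>l ` Q. \<Sum>{p \<in> Q. l p = c}) = 1"
    using gen[of "\<lambda>_. 1"] QD(7) by simp
  ultimately show "resolution D (l ` Q) (\<lambda>c. \<Sum>{p \<in> Q. l p = c})"
    using QD gen[of "\<lambda>x. x"] by (auto simp: resolution_def D intro!: N_sum)
qed

end

section \<open>Entropy of a state on a commutant\<close>

text \<open>Summation by parts: as long as the partial sum of \<open>d\<close> is nonnegative,
  replacing its factor \<open>a k\<close> by the larger \<open>a (Suc k)\<close> can only raise the
  bound. The full sum of \<open>d\<close> may have either sign.\<close>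

lemma abel_le:
  fixes a d :: "nat \<Rightarrow> real"
  assumes "\<And>i. i < k \<Longrightarrow> a i \<le> a (Suc i)" "\<And>j. j \<le> k \<Longrightarrow> 0 \<le> (\<Sum>i<j. d i)"
  shows "(\<Sum>i<Suc k. d i * a i) \<le> (\<Sum>i<Suc k. d i) * a k"
  using assms
proof (induction k)
  case (Suc k)
  have "(\<Sum>i<Suc k. d i * a i) \<le> (\<Sum>i<Suc k. d i) * a k"
    using Suc.prems by (intro Suc.IH) auto
  also have "\<dots> \<le> (\<Sum>i<Suc k. d i) * a (Suc k)"
    using Suc.prems(1)[of k] Suc.prems(2)[of "Suc k"] by (intro mult_left_mono) auto
  finally show ?case
    by (simp add: algebra_simps)
qed simp

text \<open>\<open>gibbs\<close> with \<open>y = m i\<close> leaves the claim that the sum of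
  \<open>(x i - m i) * (- ln (m i))\<close> is nonpositive. As \<open>- ln (m i)\<close> increases
  with \<open>i\<close>, \<open>abel_le\<close> bounds it by a multiple of the vanishing total of
  \<open>x i - m i\<close>. The \<open>x i\<close> need no ordering.\<close>

lemma eta_majorization:
  fixes x m :: "nat \<Rightarrow> real"
  assumes x: "\<And>i. i < n \<Longrightarrow> 0 \<le> x i" and m: "\<And>i. i < n \<Longrightarrow> 0 \<le> m i"
    and decr: "\<And>i j. i \<le> j \<Longrightarrow> j < n \<Longrightarrow> m j \<le> m i"
    and major: "\<And>k. k \<le> n \<Longrightarrow> (\<Sum>i<k. m i) \<le> (\<Sum>i<k. x i)"
    and total: "(\<Sum>i<n. x i) = (\<Sum>i<n. m i)"
  shows "(\<Sum>i<n. eta (x i)) \<le> (\<Sum>i<n. eta (m i))"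
proof -
  define K where "K = (LEAST k. k = n \<or> m k \<le> 0)"
  have K: "K = n \<or> m K \<le> 0"
    unfolding K_def by (rule LeastI[of _ n]) simp
  have Kn: "K \<le> n"
    unfolding K_def by (rule Least_le) simp
  have pos: "0 < m i" if "i < K" for i
    using not_less_Least[OF that[unfolded K_def]] by auto
  have zero: "m i = 0" if "K \<le> i" "i < n" for i
    using K decr[OF that] m[OF that(2)] that by auto
  have split: "(\<Sum>i<n. f i) = (\<Sum>i<K. f i) + (\<Sum>i=K..<n. f i)" for f :: "nat \<Rightarrow> real"
    using Kn by (metis atLeast0LessThan sum.atLeastLessThan_concat zero_le)
  have "(\<Sum>i<n. m i) = (\<Sum>i<K. m i)"
    using split[of m] zero by simp
  then have tail: "(\<Sum>i=K..<n. x i) \<le> 0" and eqK: "(\<Sum>i<K. x i) \<ge> (\<Sum>i<n. m i)"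
    using major[OF Kn] total split[of x] by auto
  have "x i = 0" if "K \<le> i" "i < n" for i
  proof -
    have "(\<Sum>i=K..<n. x i) = 0"
      using tail by (intro antisym) (auto intro!: sum_nonneg x)
    then have "\<forall>j\<in>{K..<n}. x j = 0"
      using x by (subst (asm) sum_nonneg_eq_0_iff) auto
    then show ?thesis
      using that by simp
  qed
  then have etax: "(\<Sum>i<n. eta (x i)) = (\<Sum>i<K. eta (x i))" and sumx: "(\<Sum>i<n. x i) = (\<Sum>i<K. x i)"
    using split[of "\<lambda>i. eta (x i)"] split[of x] by simp_all
  have etam: "(\<Sum>i<n. eta (m i)) = (\<Sum>i<K. eta (m i))"
    using split[of "\<lambda>i. eta (m i)"] zero by simp
  have sumK: "(\<Sum>i<K. x i) = (\<Sum>i<K. m i)"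
    using sumx total \<open>(\<Sum>i<n. m i) = (\<Sum>i<K. m i)\<close> by simp
  have "(\<Sum>i<K. eta (x i)) \<le> (\<Sum>i<K. - x i * ln (m i) + m i - x i)"
    using pos x Kn by (intro sum_mono gibbs) auto
  also have "\<dots> = (\<Sum>i<K. - x i * ln (m i))"
    using sumK by (simp add: sum.distrib sum_subtractf sum_negf)
  also have "\<dots> \<le> (\<Sum>i<K. eta (m i))"
  proof (cases K)
    case (Suc k)
    have "(\<Sum>i<Suc k. (x i - m i) * (- ln (m i))) \<le> (\<Sum>i<Suc k. x i - m i) * (- ln (m k))"
    proof (rule abel_le)
      fix i assume "i < k"
      then show "- ln (m i) \<le> - ln (m (Suc i))"
        using pos[of i] pos[of "Suc i"] decr[of i "Suc i"] Kn Suc by simp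
    next
      fix j assume "j \<le> k"
      then show "0 \<le> (\<Sum>i<j. x i - m i)"
        using major[of j] Kn Suc by (simp add: sum_subtractf)
    qed
    also have "\<dots> = 0"
      using sumK Suc by (simp add: sum_subtractf del: sum.lessThan_Suc)
    finally have "(\<Sum>i<K. - x i * ln (m i)) - (\<Sum>i<K. eta (m i)) \<le> 0"
      unfolding Suc sum_subtractf[symmetric] by (simp add: eta_def algebra_simps del: sum.lessThan_Suc)
    then show ?thesis
      by simp
  qed simp
  finally show ?thesis
    using etax etam by simp
qed

section \<open>States on a sector\<close>

locale sector_state = sector X M for X :: "(int \<Rightarrow> 'd) set" and M +
  fixes psi :: "'d kernel \<Rightarrow> complex"
  assumes psi_add: "A \<in> M \<Longrightarrow> B \<in> M \<Longrightarrow> psi (ent (A + B)) = psi (ent A) + psi (ent B)"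
    and psi_scale: "A \<in> M \<Longrightarrow> psi (ent (c *\<^sub>C A)) = c * psi (ent A)"
    and psi_pos: "A \<in> M \<Longrightarrow> psi (ent (star A * A)) \<in> \<real>\<^sub>\<ge>\<^sub>0"
    and psi_one: "psi (ent 1) = 1"
begin

definition pr :: "(int \<Rightarrow> 'd) fmat \<Rightarrow> real" where
  "pr A = Re (psi (ent A))"

lemma psi_proj:
  assumes "p \<in> M" "proj p"
  shows "psi (ent p) = of_real (pr p)" "0 \<le> pr p"
proof -
  have "psi (ent p) \<in> \<real>\<^sub>\<ge>\<^sub>0"
    using psi_pos[OF assms(1)] assms(2) by (simp add: proj_def)
  then show "psi (ent p) = of_real (pr p)" "0 \<le> pr p"
    by (auto simp: pr_def elim!: nonneg_Reals_cases)
qed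

lemma pr_add: "A \<in> M \<Longrightarrow> B \<in> M \<Longrightarrow> pr (A + B) = pr A + pr B"
  by (simp add: pr_def psi_add)

lemma pr_zero: "pr 0 = 0"
  using psi_scale[OF M_zero, of 0] by (simp add: pr_def)

lemma pr_one: "pr 1 = 1"
  by (simp add: pr_def psi_one)

lemma pr_sum: "(\<And>s. s \<in> S \<Longrightarrow> f s \<in> M) \<Longrightarrow> pr (\<Sum>s\<in>S. f s) = (\<Sum>s\<in>S. pr (f s))"
  by (induction S rule: infinite_finite_induct) (auto simp: pr_zero pr_add M_sum)

lemma pr_mono:
  assumes "p \<in> M" "proj p" "q \<in> M" "proj q" "q * p = q"
  shows "pr q \<le> pr p"
proof -
  have "pr p = pr (p - q) + pr q"
    using pr_add[of "p - q" q] assms M_diff by simp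
  then show ?thesis
    using psi_proj(2)[OF M_diff[OF assms(1,3)] rk_diff(1)[OF assms]] by simp
qed

end

locale commutant_state = sector_state X M psi + commutant X M U
  for X :: "(int \<Rightarrow> 'd) set" and M psi U
begin

abbreviation "S \<equiv> entropy (ent ` N) psi"

lemma psi_linear: "linear_on_N (\<lambda>A. psi (ent A))"
  by (simp add: linear_on_N_def psi_add psi_scale N_M)

text \<open>Positivity is given for squares; it makes \<open>psi\<close> real on projections, hence
  on self-adjoint elements by their spectral expansion.\<close>

lemma psi_star:
  assumes "K \<in> N"
  shows "psi (ent (star K)) = cnj (psi (ent K))"
proof -
  have herm: "psi (ent D) = cnj (psi (ent D))" if D: "D \<in> N" "star D = D" for D
  proof -
    obtain Q l where Q: "minpartition N 1 Q" and l: "D = (\<Sum>p\<in>Q. complex_of_real (l p) *\<^sub>C p)"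
      using hermitian_expansion[OF D] by blast
    have "psi (ent D) = (\<Sum>p\<in>Q. complex_of_real (l p) * psi (ent p))"
      unfolding l using minpartitionD[OF Q] psi_scale N_M N_scale
        linear_on_N_sum[OF psi_linear, of Q "\<lambda>p. complex_of_real (l p) *\<^sub>C p"] by simp
    also have "\<dots> = of_real (\<Sum>p\<in>Q. l p * pr p)"
      using minpartitionD[OF Q] psi_proj N_M by simp
    finally show ?thesis
      by simp
  qed
  obtain A B where AB: "A \<in> N" "star A = A" "B \<in> N" "star B = B" "K = A + \<i> *\<^sub>C B"
    using cartesian_decomposition[OF assms] by blast
  have "star K = A + (- \<i>) *\<^sub>C B"
    using AB by simp
  then have "psi (ent (star K)) = psi (ent A) - \<i> * psi (ent B)"
    using AB psi_add psi_scale M_scale N_M by simp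
  moreover have "psi (ent K) = psi (ent A) + \<i> * psi (ent B)"
    using AB psi_add psi_scale M_scale N_M by simp
  ultimately show ?thesis
    using herm[OF AB(1,2)] herm[OF AB(3,4)] by simp
qed

lemma is_canonical_trace_tau:
  "is_canonical_trace (ent ` N) (restrict (\<lambda>K. tau (Fmat K)) (ent ` N))"
  using tau_linear tau_commute tau_minproj
  by (auto simp: is_canonical_trace_def minimal_projection_ent_iff kernel_ent ent_inverse
      linear_on_N_def N_closed minproj_def)

text \<open>Any competitor agrees with \<open>tau\<close> on minimal projections, thus on all of
  \<open>N\<close>, and extensionality fixes it elsewhere. So the definite description
  denotes.\<close>

lemma canonical_trace_ent:
  assumes "A \<in> N"
  shows "canonical_trace (ent ` N) (ent A) = tau A"
proof -
  have "t = restrict (\<lambda>K. tau (Fmat K)) (ent ` N)" if t: "is_canonical_trace (ent ` N) t" for t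
  proof (rule extensionalityI)
    show "t \<in> extensional (ent ` N)" "restrict (\<lambda>K. tau (Fmat K)) (ent ` N) \<in> extensional (ent ` N)"
      using t by (auto simp: is_canonical_trace_def)
    have lin: "linear_on_N (\<lambda>A. t (ent A))"
      using t by (auto simp: is_canonical_trace_def linear_on_N_def kernel_ent)
    have "t (ent p) = tau p" if "minproj N p" for p
      using t that by (auto simp: is_canonical_trace_def minimal_projection_ent tau_minproj)
    from linear_on_N_eqI[OF lin tau_linear this]
    show "t K = restrict (\<lambda>K. tau (Fmat K)) (ent ` N) K" if "K \<in> ent ` N" for K
      using that by (auto simp: ent_inverse)
  qed
  then have "canonical_trace (ent ` N) = restrict (\<lambda>K. tau (Fmat K)) (ent ` N)"
    unfolding canonical_trace_def
    by (rule the_equality[where P = "is_canonical_trace (ent ` N)", OF is_canonical_trace_tau])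
  then show ?thesis
    using assms by (simp add: ent_inverse)
qed

text \<open>\<open>tau_riesz\<close> gives existence and \<open>tau_nondegenerate\<close>
  uniqueness. Since \<open>psi\<close> and \<open>tau\<close> respect adjoints,
  \<open>star D\<close> represents the same functional as \<open>D\<close> and must equal
  it.\<close>

lemma density_ent:
  obtains D where "D \<in> N" "star D = D" "density (ent ` N) psi = ent D"
    "\<And>K. K \<in> N \<Longrightarrow> psi (ent K) = tau (D * K)"
proof -
  obtain D where D: "D \<in> N" "\<And>K. K \<in> N \<Longrightarrow> psi (ent K) = tau (D * K)"
    using tau_riesz[OF psi_linear] by blast
  have uniq: "D' = D" if "D' \<in> N" "\<And>K. K \<in> N \<Longrightarrow> psi (ent K) = tau (D' * K)" for D'
    using tau_nondegenerate[OF that(1) D(1)] that(2) D(2) by simp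
  have "tau (star D * K) = psi (ent K)" if K: "K \<in> N" for K
  proof -
    have "tau (star D * K) = tau (star (star K * D))"
      by simp
    also have "\<dots> = cnj (tau (D * star K))"
      using tau_star[of "star K * D"] tau_commute[of D "star K"] K D(1) by (simp only: N_closed)
    also have "\<dots> = psi (ent K)"
      using D(2)[OF N_star[OF K]] psi_star[OF K] by (metis complex_cnj_cnj)
    finally show ?thesis .
  qed
  then have "star D = D"
    using uniq[of "star D"] D(1) N_star by simp
  moreover have "density (ent ` N) psi = ent D"
    unfolding density_def
  proof (rule the_equality)
    show "ent D \<in> ent ` N \<and> (\<forall>K\<in>ent ` N. psi K = canonical_trace (ent ` N) (kmult (ent D) K))"
      using D by (auto simp: kmult_ent canonical_trace_ent N_mult)
    fix K assume K: "K \<in> ent ` N \<and> (\<forall>L\<in>ent ` N. psi L = canonical_trace (ent ` N) (kmult K L))"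
    then obtain D' where D': "K = ent D'" "D' \<in> N"
      by blast
    have "psi (ent L) = tau (D' * L)" if "L \<in> N" for L
      using K that D' canonical_trace_ent[OF N_mult[OF D'(2) that]] by (auto simp: kmult_ent)
    then show "K = ent D"
      using uniq D' by blast
  qed
  ultimately show ?thesis
    using that D by blast
qed

lemma ent_Fmat_image: "K \<in> ent ` N \<Longrightarrow> ent (Fmat K) = K"
  by (auto simp: ent_inverse)

lemma spectral_resolution_ent:
  "spectral_resolution (ent ` N) (ent D) F P \<longleftrightarrow> resolution D F (\<lambda>l. Fmat (P l)) \<and> (\<forall>l\<in>F. P l \<in> ent ` N)"
proof -
  have sums: "(\<lambda>\<omega> \<eta>. \<Sum>l\<in>F. P l \<omega> \<eta>) = ent (\<Sum>l\<in>F. Fmat (P l))"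
    "(\<lambda>\<omega> \<eta>. \<Sum>l\<in>F. complex_of_real l * P l \<omega> \<eta>) = ent (\<Sum>l\<in>F. complex_of_real l *\<^sub>C Fmat (P l))"
    if "\<forall>l\<in>F. P l \<in> ent ` N"
    using that by (auto simp: fun_eq_iff ent_Fmat_image intro!: sum.cong)
  have P: "P l = ent (Fmat (P l))" if "P l \<in> ent ` N" for l
    using that by (simp add: ent_Fmat_image)
  show ?thesis
  proof (cases "\<forall>l\<in>F. P l \<in> ent ` N")
    case True
    have 1: "projection_in (ent ` N) (P l) \<longleftrightarrow> Fmat (P l) \<in> N \<and> proj (Fmat (P l))" if "l \<in> F" for l
      using projection_in_ent[of N "Fmat (P l)"] P[of l] True that by simp
    have 2: "kmult (P l) (P m) = kzero \<longleftrightarrow> Fmat (P l) * Fmat (P m) = 0" if "l \<in> F" "m \<in> F" for l m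
      using P[of l] P[of m] True that by (metis ent_inject kmult_ent kzero_ent)
    have 3: "kone = (\<lambda>\<omega> \<eta>. \<Sum>l\<in>F. P l \<omega> \<eta>) \<longleftrightarrow> (\<Sum>l\<in>F. Fmat (P l)) = 1"
      unfolding sums(1)[OF True] kone_ent ent_inject by auto
    have 4: "ent D = (\<lambda>\<omega> \<eta>. \<Sum>l\<in>F. of_real l * P l \<omega> \<eta>) \<longleftrightarrow> (\<Sum>l\<in>F. complex_of_real l *\<^sub>C Fmat (P l)) = D"
      unfolding sums(2)[OF True] ent_inject by auto
    show ?thesis
      unfolding spectral_resolution_def resolution_def 3 4 using True 1 2 by auto
  next
    case False
    then show ?thesis
      by (auto simp: spectral_resolution_def projection_in_def)
  qed
qed

lemma functional_calculus_ent:
  assumes Q: "minpartition N 1 Q" and D: "D = (\<Sum>p\<in>Q. complex_of_real (l p) *\<^sub>C p)"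
  shows "functional_calculus (ent ` N) f (ent D) = ent (\<Sum>p\<in>Q. complex_of_real (f (l p)) *\<^sub>C p)"
    (is "_ = ent ?X")
  unfolding functional_calculus_def
proof (rule the_equality)
  let ?R = "\<lambda>c. \<Sum>{p \<in> Q. l p = c}"
  note R = resolution_of_minpartition[OF Q D]
  have "spectral_resolution (ent ` N) (ent D) (l ` Q) (\<lambda>c. ent (?R c))"
    unfolding spectral_resolution_ent using R(1) by (auto simp: ent_inverse resolution_def)
  moreover have "ent ?X = (\<lambda>\<omega> \<eta>. \<Sum>c\<in>l ` Q. of_real (f c) * ent (?R c) \<omega> \<eta>)"
    unfolding R(2)[symmetric] by (simp add: fun_eq_iff)
  ultimately show "\<exists>F P. spectral_resolution (ent ` N) (ent D) F P \<and>
      ent ?X = (\<lambda>\<omega> \<eta>. \<Sum>l\<in>F. of_real (f l) * P l \<omega> \<eta>)"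
    by blast
  fix K assume "\<exists>F P. spectral_resolution (ent ` N) (ent D) F P \<and> K = (\<lambda>\<omega> \<eta>. \<Sum>l\<in>F. of_real (f l) * P l \<omega> \<eta>)"
  then obtain F P where F: "resolution D F (\<lambda>l. Fmat (P l))" "\<forall>l\<in>F. P l \<in> ent ` N"
    and K: "K = (\<lambda>\<omega> \<eta>. \<Sum>l\<in>F. of_real (f l) * P l \<omega> \<eta>)"
    unfolding spectral_resolution_ent by blast
  have "K = ent (\<Sum>l\<in>F. complex_of_real (f l) *\<^sub>C Fmat (P l))"
    using F(2) by (auto simp: K fun_eq_iff ent_Fmat_image intro!: sum.cong)
  also have "\<dots> = ent ?X"
    unfolding resolution_unique[OF F(1) R(1)] R(2) ..
  finally show "K = ent ?X" .
qed

lemma pr_minpartition: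
  assumes "minpartition N 1 Q"
  shows "\<And>p. p \<in> Q \<Longrightarrow> 0 \<le> pr p" "(\<Sum>p\<in>Q. pr p) = 1"
  using minpartitionD[OF assms] psi_proj(2) N_M pr_sum[of Q "\<lambda>p. p"] pr_one by auto

text \<open>
  The weights \<open>tau (p * q)\<close> form a doubly stochastic matrix, so concavity shows that the
  eigenprojections of the density minimize the Shannon entropy among all minimal partitions.
\<close>

lemma entropy_eq:
  obtains Q where "minpartition N 1 Q" "S = (\<Sum>p\<in>Q. eta (pr p))"
    "\<And>Q'. minpartition N 1 Q' \<Longrightarrow> S \<le> (\<Sum>q\<in>Q'. eta (pr q))"
proof -
  obtain D where D: "D \<in> N" "star D = D" "density (ent ` N) psi = ent D"
    "\<And>K. K \<in> N \<Longrightarrow> psi (ent K) = tau (D * K)"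
    using density_ent by blast
  obtain Q l where Q: "minpartition N 1 Q" and l: "D = (\<Sum>p\<in>Q. complex_of_real (l p) *\<^sub>C p)"
    and Dp: "\<And>p. p \<in> Q \<Longrightarrow> D * p = complex_of_real (l p) *\<^sub>C p"
    using hermitian_expansion[OF D(1,2)] by blast
  note QD = minpartitionD[OF Q]
  have lpr: "l p = pr p" if "p \<in> Q" for p
    using D(4)[OF QD(2)[OF that]] Dp[OF that] linear_on_N_cscale[OF tau_linear QD(2)[OF that]]
      tau_minproj[OF QD(5)[OF that]] by (simp add: pr_def)
  let ?L = "\<Sum>p\<in>Q. complex_of_real (ln (l p)) *\<^sub>C p"
  have L: "?L \<in> N"
    using QD(2) by (auto intro!: N_closed)
  have "D * ?L = (\<Sum>p\<in>Q. complex_of_real (l p * ln (l p)) *\<^sub>C p)"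
    unfolding sum_distrib_left by (intro sum.cong refl) (simp add: Dp mult.commute)
  then have "tau (D * ?L) = (\<Sum>p\<in>Q. complex_of_real (l p * ln (l p)) * tau p)"
    using QD(2) tau_linear by (simp add: linear_on_N_sum linear_on_N_cscale N_scale)
  also have "\<dots> = of_real (\<Sum>p\<in>Q. l p * ln (l p))"
    using tau_minproj QD(5) by simp
  finally have "tau (D * ?L) = of_real (\<Sum>p\<in>Q. l p * ln (l p))" .
  moreover have "S = - Re (tau (D * ?L))"
    unfolding entropy_def D(3) functional_calculus_ent[OF Q l] kmult_ent
      canonical_trace_ent[OF N_mult[OF D(1) L]] ..
  ultimately have "S = - (\<Sum>p\<in>Q. l p * ln (l p))"
    by simp
  then have SQ: "S = (\<Sum>p\<in>Q. eta (pr p))"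
    using lpr by (simp add: eta_def sum_negf)
  moreover have "S \<le> (\<Sum>q\<in>Q'. eta (pr q))" if Q': "minpartition N 1 Q'" for Q'
  proof -
    note Q'D = minpartitionD[OF Q']
    define a where "a p q = Re (tau (p * q))" for p q
    have a: "tau (p * q) = of_real (a p q)" "0 \<le> a p q" if "p \<in> Q" "q \<in> Q'" for p q
    proof -
      have N: "p \<in> N" "q \<in> N" and pq: "proj p" "proj q"
        using that QD Q'D by auto
      have "tau (p * q) = tau (p * (p * q))"
        using pq by (simp add: proj_def mult.assoc[symmetric])
      also have "\<dots> = tau (p * q * p)"
        using tau_commute[OF N(1) N_mult[OF N]] .
      \<comment> \<open>The overlap is written as a square so that the weight is real and
        nonnegative.\<close>
      also have "p * q * p = star (q * p) * (q * p)"
        using pq by (simp add: proj_def mult.assoc) (simp add: mult.assoc[symmetric])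
      finally show "tau (p * q) = of_real (a p q)" "0 \<le> a p q"
        using tau_star_mult_nonneg[OF N_mult[OF N(2,1)]] by (auto simp: a_def)
    qed
    have row: "(\<Sum>q\<in>Q'. a p q) = 1" if "p \<in> Q" for p
    proof -
      have "(\<Sum>q\<in>Q'. tau (p * q)) = tau (p * \<Sum>Q')"
        unfolding sum_distrib_left using that QD Q'D
        by (intro linear_on_N_sum[OF tau_linear, symmetric]) (auto intro!: N_closed)
      also have "\<dots> = 1"
        using tau_minproj QD(5)[OF that] Q'D(7) by simp
      finally show ?thesis
        unfolding a_def Re_sum[symmetric] by simp
    qed
    have col: "(\<Sum>p\<in>Q. a p q) = 1" if "q \<in> Q'" for q
    proof -
      have "(\<Sum>p\<in>Q. tau (p * q)) = tau (\<Sum>Q * q)"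
        unfolding sum_distrib_right using that QD Q'D
        by (intro linear_on_N_sum[OF tau_linear, symmetric]) (auto intro!: N_closed)
      also have "\<dots> = 1"
        using tau_minproj Q'D(5)[OF that] QD(7) by simp
      finally show ?thesis
        unfolding a_def Re_sum[symmetric] by simp
    qed
    have prq: "pr q = (\<Sum>p\<in>Q. a p q * pr p)" if "q \<in> Q'" for q
    proof -
      have "psi (ent q) = tau (\<Sum>p\<in>Q. complex_of_real (pr p) *\<^sub>C (p * q))"
        using D(4)[OF Q'D(2)[OF that]] by (simp add: l lpr sum_distrib_right)
      also have "\<dots> = (\<Sum>p\<in>Q. complex_of_real (pr p) * tau (p * q))"
        using that QD(2) Q'D(2) tau_linear by (simp add: linear_on_N_sum linear_on_N_cscale N_closed)
      also have "\<dots> = of_real (\<Sum>p\<in>Q. a p q * pr p)"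
        using a(1)[OF _ that] by (simp add: mult.commute)
      finally show ?thesis
        by (simp add: pr_def)
    qed
    have "S = (\<Sum>p\<in>Q. \<Sum>q\<in>Q'. a p q * eta (pr p))"
      unfolding SQ using row by (simp add: sum_distrib_right[symmetric])
    also have "\<dots> = (\<Sum>q\<in>Q'. \<Sum>p\<in>Q. a p q * eta (pr p))"
      by (rule sum.swap)
    also have "\<dots> \<le> (\<Sum>q\<in>Q'. eta (\<Sum>p\<in>Q. a p q * pr p))"
      using a(2) col pr_minpartition(1)[OF Q] QD(1) by (intro sum_mono eta_concave) auto
    also have "\<dots> = (\<Sum>q\<in>Q'. eta (pr q))"
      using prq by simp
    finally show ?thesis .
  qed
  ultimately show ?thesis
    using that Q by blast
qed

lemma entropy_nonneg: "0 \<le> S"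
proof -
  obtain Q where Q: "minpartition N 1 Q" "S = (\<Sum>p\<in>Q. eta (pr p))"
    using entropy_eq by blast
  have "pr p \<le> 1" if "p \<in> Q" for p
    using member_le_sum[of p Q pr] pr_minpartition[OF Q(1)] that minpartitionD(1)[OF Q(1)] by auto
  then show ?thesis
    unfolding Q(2) using pr_minpartition[OF Q(1)] by (intro sum_nonneg eta_nonneg) auto
qed

text \<open>Each \<open>R i\<close> is refined into minimal projections of \<open>N\<close>. The
  refined partition bounds \<open>S\<close> from above by \<open>entropy_eq\<close>, and
  \<open>eta_refine\<close> measures what the refinement costs.\<close>

lemma entropy_le_coarse:
  assumes I: "finite I" and R: "\<And>i. i \<in> I \<Longrightarrow> R i \<in> N \<and> proj (R i) \<and> rk (R i) \<le> r"
    and orth: "\<And>i j. i \<in> I \<Longrightarrow> j \<in> I \<Longrightarrow> i \<noteq> j \<Longrightarrow> R i * R j = 0"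
    and one: "(\<Sum>i\<in>I. R i) = 1" and r: "1 \<le> r"
  shows "S \<le> (\<Sum>i\<in>I. eta (pr (R i))) + ln r"
proof -
  have "\<forall>i\<in>I. \<exists>Q. minpartition N (R i) Q \<and> (\<forall>p\<in>Q. R i * p = p)"
    using minpartition_exists' R by blast
  then obtain T where T: "\<And>i. i \<in> I \<Longrightarrow> minpartition N (R i) (T i) \<and> (\<forall>p\<in>T i. R i * p = p)"
    unfolding bchoice_iff by blast
  note TD = minpartitionD[OF conjunct1[OF T]]
  have cross: "p * q = 0" if "p \<in> T i" "q \<in> T j" "i \<in> I" "j \<in> I" "i \<noteq> j" for p q i j
  proof -
    have "p * R i = star (R i * p)"
      using that TD(3)[of i p] R[of i] by (simp add: proj_def)
    then have "p * R i = p"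
      using T that TD(3)[of i p] by (simp add: proj_def)
    then have "p * q = p * (R i * R j) * q"
      using T[OF that(4)] that(2) by (metis mult.assoc)
    then show ?thesis
      using orth that by simp
  qed
  have disj: "T i \<inter> T j = {}" if "i \<in> I" "j \<in> I" "i \<noteq> j" for i j
  proof (rule ccontr)
    assume "T i \<inter> T j \<noteq> {}"
    then obtain p where p: "p \<in> T i" "p \<in> T j"
      by blast
    then have "p = 0"
      using cross[OF p that] TD(3)[of i p] that by (simp add: proj_def)
    then show False
      using TD(4)[of i p] that p by simp
  qed
  have "minpartition N 1 (\<Union>i\<in>I. T i)"
    unfolding minpartition_def
  proof (intro conjI)
    show "finite (\<Union>i\<in>I. T i)"
      using I TD(1) by blast
    show "\<forall>p\<in>\<Union>i\<in>I. T i. minproj N p"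
      using TD(5) by blast
    show "\<forall>p\<in>\<Union>i\<in>I. T i. \<forall>q\<in>\<Union>i\<in>I. T i. p \<noteq> q \<longrightarrow> p * q = 0"
    proof (intro ballI impI)
      fix p q assume "p \<in> (\<Union>i\<in>I. T i)" "q \<in> (\<Union>i\<in>I. T i)" "p \<noteq> q"
      then obtain i j where ij: "i \<in> I" "p \<in> T i" "j \<in> I" "q \<in> T j"
        by blast
      then show "p * q = 0"
        using cross[of p i q j] TD(6)[of i p q] \<open>p \<noteq> q\<close> by (cases "i = j") auto
    qed
    show "\<Sum>(\<Union>i\<in>I. T i) = 1"
      using I TD(1,7) disj one by (simp add: sum.UNION_disjoint)
  qed
  moreover obtain Q where "\<And>Q'. minpartition N 1 Q' \<Longrightarrow> S \<le> (\<Sum>q\<in>Q'. eta (pr q))"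
    using entropy_eq by blast
  ultimately have "S \<le> (\<Sum>q\<in>(\<Union>i\<in>I. T i). eta (pr q))"
    by (simp only:)
  also have "\<dots> = (\<Sum>i\<in>I. \<Sum>q\<in>T i. eta (pr q))"
    using I TD(1) disj by (intro sum.UNION_disjoint) auto
  also have "\<dots> \<le> (\<Sum>i\<in>I. eta (pr (R i)) + pr (R i) * ln r)"
  proof (rule sum_mono)
    fix i assume i: "i \<in> I"
    have "of_nat (rk (R i)) = (\<Sum>p\<in>T i. tr p)"
      using tr_rk[of "R i"] R[OF i] N_M TD(7)[OF i] tr_sum[of "\<lambda>p. p" "T i"] by simp
    also have "\<dots> = of_nat (\<Sum>p\<in>T i. rk p)"
      using minproj_rk(1) TD(5)[OF i] by simp
    finally have "rk (R i) = (\<Sum>p\<in>T i. rk p)"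
      using of_nat_eq_iff by blast
    \<comment> \<open>A minimal projection has rank at least one, so at most \<open>r\<close> of
      them fit into \<open>R i\<close>.\<close>
    also have "\<dots> \<ge> (\<Sum>p\<in>T i. 1)"
      using minproj_rk(2) TD(5)[OF i] by (intro sum_mono) auto
    finally have "card (T i) \<le> r"
      using R[OF i] by simp
    moreover have "pr (R i) = (\<Sum>p\<in>T i. pr p)"
      using TD(2,7)[OF i] pr_sum[of "T i" "\<lambda>p. p"] N_M by auto
    moreover have "0 \<le> pr p" if "p \<in> T i" for p
      using psi_proj(2) N_M TD(2,3)[OF i that] by blast
    ultimately show "(\<Sum>q\<in>T i. eta (pr q)) \<le> eta (pr (R i)) + pr (R i) * ln r"
      using eta_refine[OF TD(1)[OF i], of pr r] r by simp
  qed
  also have "\<dots> = (\<Sum>i\<in>I. eta (pr (R i))) + (\<Sum>i\<in>I. pr (R i)) * ln r"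
    by (simp add: sum.distrib sum_distrib_right)
  also have "(\<Sum>i\<in>I. pr (R i)) = 1"
    using pr_sum[of I R] R N_M one pr_one by simp
  finally show ?thesis
    by simp
qed

end

section \<open>Comparison with the full algebra\<close>

text \<open>The orbit is bounded by the size of a spanning set, the form in which counting monomials
  delivers it; this limits the rank of every cyclic projection.\<close>

locale bounded_commutant = commutant_state X M psi U
  for X :: "(int \<Rightarrow> 'd) set" and M psi U +
  fixes r :: nat
  assumes r_pos: "1 \<le> r"
    and orbit_bound: "v \<in> vecs X \<Longrightarrow> \<exists>T. finite T \<and> card T \<le> r \<and> (\<forall>u\<in>U. act u v \<in> fv.span T)"
begin

text \<open>\<open>R\<close> is the projection onto the span of the orbit \<open>U v\<close>,
  characterized within \<open>N\<close> as the smallest projection that fixes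
  \<open>v\<close>.\<close>

definition cyclic :: "((int \<Rightarrow> 'd) \<Rightarrow> complex) \<Rightarrow> (int \<Rightarrow> 'd) fmat \<Rightarrow> bool" where
  "cyclic v R \<longleftrightarrow> R \<in> N \<and> proj R \<and> act R v = v \<and> rk R \<le> r \<and>
     (\<forall>s\<in>N. proj s \<longrightarrow> act s v = v \<longrightarrow> s * R = R)"

text \<open>The span of the orbit is invariant, so its projection lies in \<open>N\<close>, with
  rank bounded through \<open>orbit_bound\<close>. A projection of \<open>N\<close> that fixes
  \<open>v\<close> commutes with \<open>U\<close>, hence fixes the whole orbit and dominates
  \<open>P\<close>.\<close>

lemma cyclic_exists:
  assumes v: "v \<in> vecs X"
  shows "\<exists>R. cyclic v R"
proof -
  let ?V = "fv.span ((\<lambda>u. act u v) ` U)"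
  have V: "fv.subspace ?V" "?V \<subseteq> vecs X"
    by (rule fv.subspace_span) (rule fv.span_minimal[OF _ subspace_vecs], use act_vecs in blast)
  have ind: "fv.subspace {x. act w x \<in> ?V}" for w
  proof -
    have "act w 0 = 0"
      using act_scale_right[of w 0 0] by simp
    then show ?thesis
      unfolding fv.subspace_def
      by (auto simp: act_add_right act_scale_right fv.span_zero fv.span_add fv.span_scale)
  qed
  have inv: "act w x \<in> ?V" if w: "w \<in> U" and x: "x \<in> ?V" for w x
  proof -
    have "(\<lambda>u. act u v) ` U \<subseteq> {x. act w x \<in> ?V}"
    proof clarsimp
      fix u assume "u \<in> U"
      then have "act w (act u v) = act (w * u) v" "w * u \<in> U"
        using act_mult w U_sub U_mult by auto
      then show "act w (act u v) \<in> ?V"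
        by (simp add: fv.span_base)
    qed
    then show ?thesis
      using fv.span_minimal[OF _ ind] x by blast
  qed
  obtain P E where P: "P \<in> N" "proj P" "\<And>x. act P x \<in> ?V" "\<And>x. x \<in> ?V \<Longrightarrow> act P x = x"
    "orthonormal X E" "E \<subseteq> ?V" "tr P = of_nat (card E)"
    by (rule invariant_projection[OF V inv]) (assumption, assumption, rule that)
  have "v \<in> ?V"
    using act_one[OF v] U_one by (intro fv.span_base image_eqI[of _ _ 1]) simp_all
  moreover have "rk P \<le> r"
  proof -
    obtain T where T: "finite T" "card T \<le> r" "\<forall>u\<in>U. act u v \<in> fv.span T"
      using orbit_bound[OF v] by blast
    have "?V \<subseteq> fv.span T"
      using T(3) by (intro fv.span_minimal) auto
    then have "card E \<le> card T"
      using P(6) by (intro orthonormal_card_le[OF P(5) _ T(1)]) blast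
    moreover have "rk P = card E"
      using P(7) by (simp add: rk_def)
    ultimately show ?thesis
      using T(2) by simp
  qed
  moreover have "s * P = P" if s: "s \<in> N" "proj s" "act s v = v" for s
  proof -
    have "(\<lambda>u. act u v) ` U \<subseteq> {x \<in> vecs X. act s x = x}"
    proof clarsimp
      fix u assume u: "u \<in> U"
      then have "act s (act u v) = act u (act s v)"
        using act_mult[of s u v] act_mult[of u s v] s(1) U_sub by (auto simp: N_def)
      then show "act u v \<in> vecs X \<and> act s (act u v) = act u v"
        using s(3) act_vecs by simp
    qed
    then have "?V \<subseteq> {x \<in> vecs X. act s x = x}"
      by (intro fv.span_minimal range_subspace)
    then have "act s (act P x) = act P x" for x
      using P(3) by blast
    then show ?thesis
      using s(1) P(1) N_M by (intro act_eqI M_mult) (auto simp: act_mult)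
  qed
  ultimately show ?thesis
    using P(1,2,4) by (auto simp: cyclic_def)
qed

text \<open>The cyclic projection of \<open>v\<close> is nonzero and lies below \<open>p\<close>, so
  minimality identifies the two.\<close>

lemma minproj_cyclic:
  assumes p: "minproj N p" and v: "v \<in> vecs X" "v \<noteq> 0" "act p v = v"
  shows "cyclic v p"
proof -
  obtain R where R: "cyclic v R"
    using cyclic_exists[OF v(1)] by blast
  have "p * R = R"
    using R p v(3) by (auto simp: cyclic_def minproj_def)
  then have "R * p = R"
    using R p by (metis cyclic_def minproj_def proj_def star_mult)
  moreover have "R \<noteq> 0"
    using R v(2) act_zero_left by (auto simp: cyclic_def)
  ultimately have "R = p"
    using p R by (auto simp: minproj_def cyclic_def)
  with R show ?thesis
    by simp
qed

lemma minproj_vector: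
  assumes "minproj N p"
  obtains v where "v \<in> vecs X" "v \<noteq> 0" "act p v = v"
proof -
  have p: "p \<in> M" "p * p = p" "p \<noteq> 0"
    using assms N_M by (auto simp: minproj_def proj_def)
  obtain v where "v \<in> vecs X" "act p v \<noteq> 0"
    using act_eqI[OF p(1) M_zero] p(3) act_zero_left by metis
  moreover have "act p (act p v) = act p v"
    using act_mult[OF p(1), of p v] p(2) by simp
  ultimately show ?thesis
    using that[of "act p v"] act_vecs by simp
qed

lemma minproj_rk_le:
  assumes "minproj N p"
  shows "rk p \<le> r"
proof -
  obtain v where v: "v \<in> vecs X" "v \<noteq> 0" "act p v = v"
    by (rule minproj_vector[OF assms])
  show ?thesis
    using minproj_cyclic[OF assms v] by (simp add: cyclic_def)
qed

text \<open>Gram--Schmidt with cyclic subspaces in place of lines.\<close>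

primrec filtration :: "(nat \<Rightarrow> (int \<Rightarrow> 'd) \<Rightarrow> complex) \<Rightarrow> nat \<Rightarrow> (int \<Rightarrow> 'd) fmat" where
  "filtration v 0 = 0"
| "filtration v (Suc k) = filtration v k + (SOME R. cyclic (act (1 - filtration v k) (v k)) R)"

text \<open>With \<open>F k\<close> the sum of the earlier projections, \<open>R k\<close> is the
  cyclic projection of the residue \<open>(1 - F k) v k\<close>. As \<open>v k\<close> is the sum of
  this residue and \<open>F k v k\<close>, the next sum \<open>F k + R k\<close> fixes it.\<close>

lemma filtration:
  fixes v :: "nat \<Rightarrow> (int \<Rightarrow> 'd) \<Rightarrow> complex"
  assumes v: "\<And>k. v k \<in> vecs X"
  obtains R where "\<And>k. R k \<in> N \<and> proj (R k) \<and> rk (R k) \<le> r" "\<And>i j. i \<noteq> j \<Longrightarrow> R i * R j = 0"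
    "\<And>k. (\<Sum>i<k. R i) \<in> N" "\<And>k. proj (\<Sum>i<k. R i)" "\<And>j k. j < k \<Longrightarrow> act (\<Sum>i<k. R i) (v j) = v j"
proof -
  define F where "F = filtration v"
  define R where "R k = (SOME R. cyclic (act (1 - F k) (v k)) R)" for k
  have R: "cyclic (act (1 - F k) (v k)) (R k)" for k
    unfolding R_def using cyclic_exists[OF act_vecs] by (rule someI_ex)
  have F0: "F 0 = 0" and FS: "F (Suc k) = F k + R k" for k
    by (simp_all add: F_def R_def)
  have RN: "R k \<in> N" "proj (R k)" "rk (R k) \<le> r" "act (R k) (act (1 - F k) (v k)) = act (1 - F k) (v k)" for k
    using R[of k] by (auto simp: cyclic_def)
  \<comment> \<open>\<open>1 - F k\<close> is a projection of \<open>N\<close> that fixes the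
    residue, so the smallest such projection \<open>R k\<close> lies below it.\<close>
  have step: "F k * R k = 0" if "F k \<in> N" "proj (F k)" for k
  proof -
    have "(1 - F k) * (1 - F k) = 1 - F k"
      using that(2) by (simp add: proj_def algebra_simps)
    moreover from this have "act (1 - F k) (act (1 - F k) (v k)) = act (1 - F k) (v k)"
      using that(1) act_mult[of "1 - F k" "1 - F k" "v k"] N_M N_one N_diff by simp
    moreover have "1 - F k \<in> N" "star (1 - F k) = 1 - F k"
      using that by (simp_all add: N_closed proj_def)
    ultimately have "(1 - F k) * R k = R k"
      using R[of k] by (auto simp: cyclic_def proj_def)
    then show ?thesis
      by (simp add: algebra_simps)
  qed
  have F: "F k \<in> N \<and> proj (F k)" for k
  proof (induction k)
    case 0
    then show ?case
      by (simp add: F0 N_zero proj_def)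
  next
    case (Suc k)
    have z: "F k * R k = 0"
      using step Suc by blast
    moreover have "R k * F k = 0"
      using arg_cong[OF z, of star] Suc RN(2)[of k] by (simp add: proj_def)
    ultimately show ?case
      using Suc RN(1,2)[of k] by (simp add: FS N_add proj_def algebra_simps)
  qed
  have FR: "F k * R k = 0" "R k * F k = 0" for k
  proof -
    show *: "F k * R k = 0"
      using step F by blast
    show "R k * F k = 0"
      using arg_cong[OF *, of star] F[of k] RN(2)[of k] by (simp add: proj_def)
  qed
  have grow: "F k * R i = R i" if "i < k" for i k
    using that
  proof (induction k)
    case (Suc k)
    show ?case
    proof (cases "i = k")
      case True
      then show ?thesis
        using FR(1)[of k] RN(2)[of k] by (simp add: FS distrib_right proj_def)
    next
      case False
      then have "F k * R i = R i"
        using Suc by simp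
      moreover from this have "R k * R i = R k * F k * R i"
        by (simp add: mult.assoc)
      ultimately show ?thesis
        using FR(2)[of k] by (simp add: FS distrib_right)
    qed
  qed simp
  have orth: "R j * R i = 0" if "i < j" for i j
  proof -
    have "R j * R i = R j * F j * R i"
      using grow[OF that] by (simp add: mult.assoc)
    then show ?thesis
      using FR(2) by simp
  qed
  have orth': "R i * R j = 0" if "i < j" for i j
    using arg_cong[OF orth[OF that], of star] RN(2)[of i] RN(2)[of j] by (simp add: proj_def)
  have FM: "F k \<in> M" "R k \<in> M" for k
    using F RN(1) N_M by blast+
  have fix1: "act (F (Suc j)) (v j) = v j" for j
  proof -
    let ?w = "act (1 - F j) (v j)"
    have w: "?w = v j - act (F j) (v j)"
      by (simp only: act_diff_left act_one[OF v])
    have "act (R j) (v j) = act (R j) ?w + act (R j) (act (F j) (v j))"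
      unfolding act_add_right[symmetric] w diff_add_cancel ..
    also have "act (R j) (act (F j) (v j)) = 0"
      unfolding act_mult[OF FM(2), symmetric] FR(2) act_zero_left ..
    finally have "act (R j) (v j) = v j - act (F j) (v j)"
      using RN(4)[of j] unfolding w add_0_right by (rule trans)
    then show ?thesis
      by (simp only: FS act_add_left add_diff_eq add_diff_cancel_left')
  qed
  have fix2: "act (F k) (v j) = v j" if "j < k" for j k
  proof -
    have "F k * F i = F i" if "i \<le> k" for i
      using that
    proof (induction i)
      case (Suc i)
      then show ?case
        using grow[of i k] by (simp add: FS distrib_left)
    qed (simp add: F0)
    then have "F k * F (Suc j) = F (Suc j)"
      using that by simp
    then show ?thesis
      using act_mult[OF FM(1), of k "F (Suc j)" "v j"] fix1 by simp
  qed
  have Fsum: "F k = (\<Sum>i<k. R i)" for k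
    by (induction k) (simp_all add: F0 FS)
  show ?thesis
    using that[of R] RN F orth orth' fix2 unfolding Fsum by (metis linorder_neqE_nat)
qed

end

context sector_state
begin

text \<open>For trivial \<open>U\<close> every orbit is a single vector, so \<open>r = 1\<close>;
  the commutant is \<open>M\<close>, and its minimal projections have rank one.\<close>

lemma full_commutant: "bounded_commutant X M psi {1} 1"
proof unfold_locales
  fix v assume "v \<in> vecs X"
  then show "\<exists>T. finite T \<and> card T \<le> 1 \<and> (\<forall>u\<in>{1}. act u v \<in> fv.span T)"
    by (intro exI[of _ "{v}"]) (simp add: act_one fv.span_base)
qed (auto simp: M_one)

lemma full_commutant_N: "commutant.N M {1} = M"
proof -
  interpret bounded_commutant X M psi "{1}" 1
    by (rule full_commutant)
  show ?thesis
    by (simp add: N_def)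
qed

end

context bounded_commutant
begin

text \<open>The partition that attains the entropy of \<open>N\<close> is, seen from
  \<open>M\<close>, a coarse partition into projections of rank at most \<open>r\<close>.\<close>

lemma full_entropy_le: "entropy (ent ` M) psi \<le> S + ln r"
proof -
  interpret B: bounded_commutant X M psi "{1}" 1
    by (rule full_commutant)
  obtain Q where Q: "minpartition N 1 Q" "S = (\<Sum>p\<in>Q. eta (pr p))"
    using entropy_eq by blast
  note QD = minpartitionD[OF Q(1)]
  have "B.S \<le> (\<Sum>p\<in>Q. eta (pr p)) + ln r"
    using QD minproj_rk_le r_pos N_M unfolding full_commutant_N
    by (intro B.entropy_le_coarse[unfolded full_commutant_N]) auto
  then show ?thesis
    using Q(2) full_commutant_N by simp
qed

text \<open>A projection that fixes the first \<open>k\<close> eigenvectors dominates their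
  eigenprojections and so has at least their probability. With eigenvalues in decreasing order this
  is the hypothesis of \<open>eta_majorization\<close>.\<close>

lemma entropy_le_full: "S \<le> entropy (ent ` M) psi + ln r"
proof -
  interpret B: bounded_commutant X M psi "{1}" 1
    by (rule full_commutant)
  note BN = full_commutant_N
  obtain Q where Q: "minpartition M 1 Q" "B.S = (\<Sum>p\<in>Q. eta (pr p))"
    using B.entropy_eq unfolding BN by blast
  note QD = B.minpartitionD[unfolded BN, OF Q(1)]
  obtain ys where ys: "set ys = Q" "distinct ys"
    using finite_distinct_list[OF QD(1)] by blast
  \<comment> \<open>The negated key turns increasing into decreasing order of probability.\<close>
  define xs where "xs = sort_key (\<lambda>q. - pr q) ys"
  define n where "n = length xs"
  define q where "q i = xs ! i" for i
  have xs: "set xs = Q" "distinct xs" "sorted (map (\<lambda>q. - pr q) xs)"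
    using ys by (simp_all add: xs_def)
  have bij: "bij_betw q {..<n} Q"
    unfolding q_def n_def using bij_betw_nth[OF xs(2)] xs(1) by simp
  have decr: "pr (q j) \<le> pr (q i)" if "i \<le> j" "j < n" for i j
    using sorted_nth_mono[OF xs(3), of i j] that by (simp add: q_def n_def)
  have qQ: "q i \<in> Q" if "i < n" for i
    using bij that by (auto simp: bij_betw_def)
  \<comment> \<open>\<open>filtration\<close> takes an infinite sequence, so arbitrary vectors are
    supplied from index \<open>n\<close> on.\<close>
  have "\<exists>v. v \<in> vecs X \<and> (i < n \<longrightarrow> v \<noteq> 0 \<and> act (q i) v = v)" for i
  proof (cases "i < n")
    case True
    then show ?thesis
      using B.minproj_vector[unfolded BN, OF QD(5)[OF qQ]] by metis
  next
    case False
    then show ?thesis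
      using act_vecs by blast
  qed
  then obtain v where v: "\<And>i. v i \<in> vecs X" "\<And>i. i < n \<Longrightarrow> v i \<noteq> 0 \<and> act (q i) (v i) = v i"
    by metis
  obtain R where R: "\<And>k. R k \<in> N \<and> proj (R k) \<and> rk (R k) \<le> r" "\<And>i j. i \<noteq> j \<Longrightarrow> R i * R j = 0"
    "\<And>k. (\<Sum>i<k. R i) \<in> N" "\<And>k. proj (\<Sum>i<k. R i)" "\<And>j k. j < k \<Longrightarrow> act (\<Sum>i<k. R i) (v j) = v j"
    by (rule filtration[of v, OF v(1)]) (rule that)
  \<comment> \<open>In \<open>M\<close>, the minimal projection \<open>q j\<close> is itself the
    cyclic projection of \<open>v j\<close>, hence below every projection that fixes
    \<open>v j\<close>.\<close>
  have absorb: "(\<Sum>i<k. R i) * q j = q j" if "j < k" "j < n" for j k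
    using B.minproj_cyclic[unfolded BN, OF QD(5)[OF qQ[OF that(2)]] v(1)] v(2)[OF that(2)]
      R(3,4)[of k] R(5)[OF that(1)] N_M unfolding B.cyclic_def BN by blast
  have sub: "(\<Sum>i<k. R i) * (\<Sum>j<k. q j) = (\<Sum>j<k. q j)" if "k \<le> n" for k
    unfolding sum_distrib_left[of "\<Sum>i<k. R i"] using absorb that by (intro sum.cong) auto
  have qmult: "q i * q j = (if i = j then q i else 0)" if "i < n" "j < n" for i j
    using QD(6)[OF qQ[OF that(1)] qQ[OF that(2)]] bij that by (auto simp: bij_betw_def inj_on_eq_iff)
  have proj_sum: "proj (\<Sum>j<k. q j)" if k: "k \<le> n" for k
  proof -
    have "(\<Sum>j<k. q j) * (\<Sum>j<k. q j) = (\<Sum>i<k. \<Sum>j<k. if i = j then q i else 0)"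
      unfolding sum_product using k by (intro sum.cong refl qmult) auto
    moreover have "star (\<Sum>j<k. q j) = (\<Sum>j<k. q j)"
      unfolding star_sum using QD(3)[OF qQ] k by (intro sum.cong) (auto simp: proj_def)
    ultimately show ?thesis
      by (simp add: proj_def)
  qed
  have major: "(\<Sum>j<k. pr (q j)) \<le> (\<Sum>j<k. pr (R j))" if k: "k \<le> n" for k
  proof -
    have qM: "(\<Sum>j<k. q j) \<in> M"
      using QD(2)[OF qQ] k by (intro M_sum) auto
    have "(\<Sum>j<k. q j) * (\<Sum>i<k. R i) = (\<Sum>j<k. q j)"
      using arg_cong[OF sub[OF k], of star] proj_sum[OF k] R(4)[of k] unfolding star_mult proj_def by simp
    then have "pr (\<Sum>j<k. q j) \<le> pr (\<Sum>i<k. R i)"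
      using R(3,4) N_M qM proj_sum[OF k] by (intro pr_mono) auto
    then show ?thesis
      using pr_sum[of "{..<k}" q] pr_sum[of "{..<k}" R] QD(2)[OF qQ] k R(1) N_M by auto
  qed
  have "(\<Sum>j<n. q j) = 1"
    using sum.reindex_bij_betw[OF bij, of "\<lambda>p. p"] QD(7) by simp
  then have one: "(\<Sum>i<n. R i) = 1"
    using sub[of n] by simp
  have sum1: "(\<Sum>i<n. pr (R i)) = 1"
    using pr_sum[of "{..<n}" R] R(1) N_M one pr_one by simp
  have sumq: "(\<Sum>i<n. f (q i)) = (\<Sum>p\<in>Q. f p)" for f :: "_ \<Rightarrow> real"
    by (rule sum.reindex_bij_betw[OF bij])
  have "S \<le> (\<Sum>i<n. eta (pr (R i))) + ln r"
    using R(1,2) one r_pos by (intro entropy_le_coarse) auto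
  also have "(\<Sum>i<n. eta (pr (R i))) \<le> (\<Sum>i<n. eta (pr (q i)))"
  proof (rule eta_majorization)
    show "0 \<le> pr (R i)" for i
      using psi_proj(2) R(1) N_M by blast
    show "0 \<le> pr (q i)" if "i < n" for i
      using psi_proj(2) QD(2,3) qQ[OF that] by blast
    show "(\<Sum>i<n. pr (R i)) = (\<Sum>i<n. pr (q i))"
      unfolding sum1 sumq using B.pr_minpartition(2)[unfolded BN, OF Q(1)] by simp
  qed (use decr major in auto)
  also have "\<dots> = B.S"
    unfolding Q(2) by (rule sumq)
  finally show ?thesis
    using BN by simp
qed

end

section \<open>Local algebras\<close>

definition local_ops :: "int set \<Rightarrow> (int \<Rightarrow> 'd) fmat set" where
  "local_ops L = {A. ent A \<in> local_algebra L}"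

text \<open>One representative for each configuration on \<open>L\<close>, equal to
  \<open>undefined\<close> elsewhere. Any two of them agree off \<open>L\<close>, so the entries
  over this set form the matrix of the operator acting on the sites in \<open>L\<close>.\<close>

definition confs :: "int set \<Rightarrow> (int \<Rightarrow> 'd) set" where
  "confs L = (L \<rightarrow>\<^sub>E UNIV)"

lemma confs_iff: "w \<in> confs L \<longleftrightarrow> (\<forall>i. i \<notin> L \<longrightarrow> w i = undefined)"
  by (auto simp: confs_def PiE_iff extensional_def)

lemma finite_confs: "finite L \<Longrightarrow> finite (confs L :: (int \<Rightarrow> 'd::finite) set)"
  by (simp add: confs_def finite_PiE)

lemma finite_agree_on:
  assumes "finite L"
  shows "finite {x :: int \<Rightarrow> 'd::finite. agree_on (- L) w x}"
proof (rule finite_subset)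
  show "{x. agree_on (- L) w x} \<subseteq> (\<lambda>z. override_on w z L) ` confs L"
  proof
    fix x assume "x \<in> {x. agree_on (- L) w x}"
    then have "x = override_on w (restrict x L) L" "restrict x L \<in> confs L"
      by (auto simp: agree_on_def override_on_def fun_eq_iff confs_iff)
    then show "x \<in> (\<lambda>z. override_on w z L) ` confs L"
      by blast
  qed
qed (simp add: assms finite_confs)

lemma agree_on_sym: "agree_on L w x \<longleftrightarrow> agree_on L x w"
  by (auto simp: agree_on_def)

lemma local_algebra_agree: "K \<in> local_algebra L \<Longrightarrow> K w x \<noteq> 0 \<Longrightarrow> agree_on (- L) w x"
  by (auto simp: local_algebra_def)

lemma local_algebra_cong:
  "K \<in> local_algebra L \<Longrightarrow> agree_on (- L) w x \<Longrightarrow> agree_on (- L) w' x' \<Longrightarrow>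
    agree_on L w w' \<Longrightarrow> agree_on L x x' \<Longrightarrow> K w x = K w' x'"
  unfolding local_algebra_def by blast

lemma local_opsI:
  assumes "\<And>w x. ent A w x \<noteq> 0 \<Longrightarrow> agree_on (- L) w x"
    and "\<And>w x w' x'. agree_on (- L) w x \<Longrightarrow> agree_on (- L) w' x' \<Longrightarrow>
        agree_on L w w' \<Longrightarrow> agree_on L x x' \<Longrightarrow> ent A w x = ent A w' x'"
  shows "A \<in> local_ops L"
  unfolding local_ops_def local_algebra_def
  using assms(1) by (auto intro: assms(2))

lemma local_opsD:
  assumes "A \<in> local_ops L"
  shows "\<And>w x. ent A w x \<noteq> 0 \<Longrightarrow> agree_on (- L) w x"
    "\<And>w x w' x'. agree_on (- L) w x \<Longrightarrow> agree_on (- L) w' x' \<Longrightarrow>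
        agree_on L w w' \<Longrightarrow> agree_on L x x' \<Longrightarrow> ent A w x = ent A w' x'"
  using assms local_algebra_agree local_algebra_cong unfolding local_ops_def by blast+

lemma ent_Fmat_local:
  assumes "finite L" "K \<in> local_algebra L"
  shows "ent (Fmat K) = (K :: 'd::finite kernel)"
proof (rule ent_Fmat)
  fix w
  show "finite {x. K w x \<noteq> 0}"
    by (rule finite_subset[OF _ finite_agree_on[OF assms(1), of w]])
       (use local_algebra_agree[OF assms(2)] in blast)
  show "finite {x. K x w \<noteq> 0}"
    by (rule finite_subset[OF _ finite_agree_on[OF assms(1), of w]])
       (use local_algebra_agree[OF assms(2)] agree_on_sym in blast)
qed

lemma ent_local_ops:
  assumes L: "finite L"
  shows "ent ` local_ops L = (local_algebra L :: 'd::finite kernel set)"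
proof
  show "ent ` local_ops L \<subseteq> (local_algebra L :: 'd kernel set)"
    by (auto simp: local_ops_def)
  show "local_algebra L \<subseteq> (ent ` local_ops L :: 'd kernel set)"
  proof
    fix K :: "'d kernel" assume "K \<in> local_algebra L"
    then show "K \<in> ent ` local_ops L"
      by (intro image_eqI[of _ _ "Fmat K"]) (simp_all add: local_ops_def ent_Fmat_local[OF L])
  qed
qed

lemma Fmat_local: "finite L \<Longrightarrow> K \<in> local_algebra L \<Longrightarrow> Fmat K \<in> local_ops L"
  for K :: "'d::finite kernel"
  by (simp add: local_ops_def ent_Fmat_local)

text \<open>An intermediate configuration must agree with \<open>w\<close> off \<open>L\<close>, so
  it is determined by its restriction \<open>z\<close> to \<open>L\<close>.\<close>

lemma ent_mult_local:
  fixes A B :: "(int \<Rightarrow> 'd::finite) fmat"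
  assumes L: "finite L" and A: "A \<in> local_ops L"
  shows "ent (A * B) w x = (\<Sum>z\<in>confs L. ent A w (override_on w z L) * ent B (override_on w z L) x)"
proof -
  have inj: "inj_on (\<lambda>z. override_on w z L) (confs L)"
    by (auto simp: inj_on_def override_on_def fun_eq_iff confs_iff) metis
  have "ent (A * B) w x = (\<Sum>y\<in>(\<lambda>z. override_on w z L) ` confs L. ent A w y * ent B y x)"
  proof (rule ent_mult)
    fix y assume y: "ent A w y \<noteq> 0"
    have "y = override_on w (restrict y L) L" "restrict y L \<in> confs L"
      using local_opsD(1)[OF A y] by (auto simp: agree_on_def override_on_def fun_eq_iff confs_iff)
    then show "y \<in> (\<lambda>z. override_on w z L) ` confs L"
      by blast
  qed (simp add: finite_confs L)
  then show ?thesis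
    by (simp add: sum.reindex[OF inj])
qed

lemma local_ops_mult:
  fixes A B :: "(int \<Rightarrow> 'd::finite) fmat"
  assumes L: "finite L" and A: "A \<in> local_ops L" and B: "B \<in> local_ops L"
  shows "A * B \<in> local_ops L"
proof (rule local_opsI)
  fix w x assume "ent (A * B) w x \<noteq> 0"
  then obtain z where "ent A w (override_on w z L) * ent B (override_on w z L) x \<noteq> 0"
    unfolding ent_mult_local[OF L A] by (rule sum.not_neutral_contains_not_neutral)
  then have "agree_on (- L) (override_on w z L) x"
    using local_opsD(1)[OF B] by simp
  then show "agree_on (- L) w x"
    by (simp add: agree_on_def)
next
  fix w x w' x' :: "int \<Rightarrow> 'd"
  assume "agree_on (- L) w x" "agree_on (- L) w' x'" "agree_on L w w'" "agree_on L x x'"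
  then have "ent A w (override_on w z L) = ent A w' (override_on w' z L)"
    "ent B (override_on w z L) x = ent B (override_on w' z L) x'" for z
    by (auto intro!: local_opsD(2)[OF A] local_opsD(2)[OF B] simp: agree_on_def override_on_def)
  then show "ent (A * B) w x = ent (A * B) w' x'"
    unfolding ent_mult_local[OF L A] by simp
qed

lemma local_ops_faithful:
  assumes A: "A \<in> local_ops L" and z: "\<And>a b. a \<in> confs L \<Longrightarrow> b \<in> confs L \<Longrightarrow> ent A a b = 0"
  shows "A = 0"
proof (rule fmat_eqI)
  fix w x
  show "ent A w x = ent 0 w x"
  proof (cases "agree_on (- L) w x")
    case True
    then have "ent A w x = ent A (restrict w L) (restrict x L)"
      by (intro local_opsD(2)[OF A]) (auto simp: agree_on_def)
    also have "\<dots> = 0"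
      by (intro z) (auto simp: confs_iff)
    finally show ?thesis
      by simp
  next
    case False
    then show ?thesis
      using local_opsD(1)[OF A] by auto
  qed
qed

lemma local_ops_full:
  fixes f :: "(int \<Rightarrow> 'd::finite) \<Rightarrow> (int \<Rightarrow> 'd) \<Rightarrow> complex"
  assumes L: "finite L"
  shows "\<exists>A\<in>local_ops L. \<forall>a\<in>confs L. \<forall>b\<in>confs L. ent A a b = f a b"
proof -
  let ?K = "\<lambda>w x. if agree_on (- L) w x then f (restrict w L) (restrict x L) else 0"
  have "restrict w L = restrict w' L" if "agree_on L w w'" for w w' :: "int \<Rightarrow> 'd"
    using that by (auto simp: agree_on_def restrict_def)
  then have K: "?K \<in> local_algebra L"
    unfolding local_algebra_def by auto
  have "restrict a L = a" if "a \<in> confs L" for a :: "int \<Rightarrow> 'd"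
    using that by (auto simp: confs_iff fun_eq_iff)
  moreover have "agree_on (- L) a b" if "a \<in> confs L" "b \<in> confs L" for a b :: "int \<Rightarrow> 'd"
    using that by (auto simp: confs_iff agree_on_def)
  ultimately have "\<forall>a\<in>confs L. \<forall>b\<in>confs L. ent (Fmat ?K) a b = f a b"
    unfolding ent_Fmat_local[OF L K] by simp
  then show ?thesis
    using Fmat_local[OF L K] by blast
qed

lemma local_ops_add: "A \<in> local_ops L \<Longrightarrow> B \<in> local_ops L \<Longrightarrow> A + B \<in> local_ops L"
  by (rule local_opsI) (auto dest: local_opsD(1) intro: arg_cong2[where f="(+)"] local_opsD(2),
      metis local_opsD(1) add_0)

lemma local_ops_scale: "A \<in> local_ops L \<Longrightarrow> c *\<^sub>C A \<in> local_ops L"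
  by (rule local_opsI) (auto dest: local_opsD(1) intro: local_opsD(2))

lemma local_ops_star: "A \<in> local_ops L \<Longrightarrow> star A \<in> local_ops L"
  by (rule local_opsI) (auto dest: local_opsD(1) intro: local_opsD(2) simp: agree_on_sym[of "- L"])

lemma local_ops_one: "1 \<in> local_ops L"
proof (rule local_opsI)
  fix w x w' x' :: "int \<Rightarrow> 'd"
  assume "agree_on (- L) w x" "agree_on (- L) w' x'" "agree_on L w w'" "agree_on L x x'"
  then have "w = x \<longleftrightarrow> w' = x'"
    unfolding agree_on_def fun_eq_iff by (metis ComplI)
  then show "ent 1 w x = ent 1 w' x'"
    by simp
qed (auto simp: agree_on_def split: if_splits)

lemma sector_local_ops:
  assumes L: "finite L"
  shows "sector (confs L) (local_ops L :: (int \<Rightarrow> 'd::finite) fmat set)"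
proof
  show "finite (confs L :: (int \<Rightarrow> 'd) set)"
    by (rule finite_confs[OF L])
  show "a \<in> confs L \<longleftrightarrow> b \<in> confs L" if "A \<in> local_ops L" "ent A a b \<noteq> 0"
    for A and a b :: "int \<Rightarrow> 'd"
    using local_opsD(1)[OF that] by (auto simp: confs_iff agree_on_def)
  show "A = 0" if "A \<in> local_ops L" "\<And>a b. a \<in> confs L \<Longrightarrow> b \<in> confs L \<Longrightarrow> ent A a b = 0"
    for A :: "(int \<Rightarrow> 'd) fmat"
    using local_ops_faithful that by blast
qed (simp_all add: local_ops_one local_ops_add local_ops_mult[OF L] local_ops_scale local_ops_star local_ops_full[OF L])

lemma local_ops_mono:
  assumes "L \<subseteq> L'"
  shows "local_ops L \<subseteq> local_ops L'"
proof
  fix A :: "(int \<Rightarrow> 'd) fmat" assume A: "A \<in> local_ops L"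
  show "A \<in> local_ops L'"
  proof (rule local_opsI)
    fix w x :: "int \<Rightarrow> 'd" assume "ent A w x \<noteq> 0"
    then show "agree_on (- L') w x"
      using local_opsD(1)[OF A] assms by (auto simp: agree_on_def)
  next
    fix w x w' x' :: "int \<Rightarrow> 'd"
    assume *: "agree_on (- L') w x" "agree_on (- L') w' x'" "agree_on L' w w'" "agree_on L' x x'"
    have "agree_on (- L) w x \<longleftrightarrow> agree_on (- L) w' x'"
      using * unfolding agree_on_def by (metis ComplI)
    moreover have "ent A w x = ent A w' x'" if "agree_on (- L) w x" "agree_on (- L) w' x'"
    proof (rule local_opsD(2)[OF A that])
      show "agree_on L w w'" "agree_on L x x'"
        using *(3,4) assms by (auto simp: agree_on_def)
    qed
    ultimately show "ent A w x = ent A w' x'"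
      using local_opsD(1)[OF A] by metis
  qed
qed

section \<open>Products over disjoint regions\<close>

text \<open>Only one intermediate configuration survives: \<open>A\<close> alters sites in
  \<open>L\<close> alone and \<open>B\<close> none of them, so it equals \<open>x\<close> on
  \<open>L\<close> and \<open>w\<close> elsewhere.\<close>

lemma ent_mult_disjoint:
  fixes A B :: "(int \<Rightarrow> 'd) fmat"
  assumes A: "A \<in> local_ops L" and B: "B \<in> local_ops L'" and disj: "L \<inter> L' = {}"
  shows "ent (A * B) w x = ent A w (override_on w x L) * ent B (override_on w x L) x"
proof -
  have "y = override_on w x L" if "ent A w y \<noteq> 0" "ent B y x \<noteq> 0" for y
    using local_opsD(1)[OF A that(1)] local_opsD(1)[OF B that(2)] disj
    unfolding agree_on_def override_on_def fun_eq_iff by (metis ComplI IntI emptyE)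
  then have "ent (A * B) w x = (\<Sum>y\<in>{override_on w x L}. ent A w y * ent B y x)"
    by (intro ent_mult) auto
  then show ?thesis
    by simp
qed

lemma mult_commute_disjoint:
  fixes A B :: "(int \<Rightarrow> 'd) fmat"
  assumes A: "A \<in> local_ops L" and B: "B \<in> local_ops L'" and disj: "L \<inter> L' = {}"
  shows "A * B = B * A"
proof (rule fmat_eqI)
  fix w x :: "int \<Rightarrow> 'd"
  have disj': "L' \<inter> L = {}"
    using disj by blast
  let ?y = "override_on w x L" and ?z = "override_on w x L'"
  show "ent (A * B) w x = ent (B * A) w x"
  proof (cases "agree_on (- (L \<union> L')) w x")
    case True
    have "ent A w ?y = ent A ?z x"
      using True disj by (intro local_opsD(2)[OF A]) (auto simp: agree_on_def override_on_def)
    moreover have "ent B ?y x = ent B w ?z"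
      using True disj by (intro local_opsD(2)[OF B]) (auto simp: agree_on_def override_on_def)
    ultimately show ?thesis
      by (simp add: ent_mult_disjoint[OF A B disj] ent_mult_disjoint[OF B A disj'])
  next
    case False
    then obtain i where i: "i \<notin> L" "i \<notin> L'" "w i \<noteq> x i"
      by (auto simp: agree_on_def)
    then have "\<not> agree_on (- L') ?y x" "\<not> agree_on (- L) ?z x"
      by (auto simp: agree_on_def override_on_def)
    then have "ent B ?y x = 0" "ent A ?z x = 0"
      using local_opsD(1)[OF A] local_opsD(1)[OF B] by blast+
    then show ?thesis
      by (simp add: ent_mult_disjoint[OF A B disj] ent_mult_disjoint[OF B A disj'])
  qed
qed

text \<open>Diagonal entries factor and configurations on the union are pairs. This makes ranks
  multiply for projections in disjoint regions.\<close>

lemma trace_mult_disjoint: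
  fixes A B :: "(int \<Rightarrow> 'd::finite) fmat"
  assumes A: "A \<in> local_ops L" and B: "B \<in> local_ops L'" and disj: "L \<inter> L' = {}"
    and fin: "finite L" "finite L'"
  shows "(\<Sum>w\<in>confs (L \<union> L'). ent (A * B) w w) = (\<Sum>w\<in>confs L. ent A w w) * (\<Sum>w\<in>confs L'. ent B w w)"
proof -
  have diag: "ent (A * B) w w = ent A (restrict w L) (restrict w L) * ent B (restrict w L') (restrict w L')" for w
  proof -
    have "ent A w w = ent A (restrict w L) (restrict w L)" "ent B w w = ent B (restrict w L') (restrict w L')"
      by (auto intro!: local_opsD(2)[OF A] local_opsD(2)[OF B] simp: agree_on_def)
    moreover have "override_on w w L = w"
      by (simp add: override_on_def)
    ultimately show ?thesis
      by (simp add: ent_mult_disjoint[OF A B disj])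
  qed
  have bij: "bij_betw (\<lambda>w. (restrict w L, restrict w L')) (confs (L \<union> L')) (confs L \<times> confs L' :: ((int \<Rightarrow> 'd) \<times> (int \<Rightarrow> 'd)) set)"
    by (rule bij_betw_byWitness[where f' = "\<lambda>(u, v). override_on u v L'"])
       (use disj in \<open>auto simp: confs_iff fun_eq_iff override_on_def restrict_def\<close>)
  have "(\<Sum>w\<in>confs (L \<union> L'). ent (A * B) w w) = (\<Sum>(u, v)\<in>confs L \<times> confs L'. ent A u u * ent B v v)"
    unfolding diag
    by (rule sum.reindex_bij_betw[OF bij, of "\<lambda>(u, v). ent A u u * ent B v v", unfolded case_prod_conv])
  then show ?thesis
    by (simp add: sum_product sum.cartesian_product)
qed

section \<open>Elementary tensors\<close>

definition tens :: "int set \<Rightarrow> (int \<Rightarrow> complex^'d^'d) \<Rightarrow> (int \<Rightarrow> 'd::finite) fmat" where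
  "tens L a = Fmat (site_tensor L a)"

lemma site_tensor_local: "site_tensor L a \<in> local_algebra L"
  unfolding local_algebra_def site_tensor_def by (auto simp: agree_on_def intro!: prod.cong)

lemma ent_tens: "finite L \<Longrightarrow> ent (tens L a) = site_tensor L a"
  unfolding tens_def using ent_Fmat_local site_tensor_local by blast

lemma tens_local: "finite L \<Longrightarrow> tens L a \<in> local_ops L"
  by (simp add: local_ops_def ent_tens site_tensor_local)

lemma tens_eqI:
  assumes L: "finite L" and A: "A \<in> local_ops L"
    and eq: "\<And>w x. agree_on (- L) w x \<Longrightarrow> ent A w x = (\<Prod>i\<in>L. a i $ w i $ x i)"
  shows "A = tens L a"
proof (rule fmat_eqI)
  fix w x
  show "ent A w x = ent (tens L a) w x"
    using eq local_opsD(1)[OF A] by (auto simp: ent_tens[OF L] site_tensor_def)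
qed

lemma tens_mult:
  assumes L: "finite L"
  shows "tens L a * tens L b = tens L (\<lambda>i. a i ** b i)"
proof (rule tens_eqI[OF L local_ops_mult[OF L tens_local[OF L] tens_local[OF L]]])
  fix w x :: "int \<Rightarrow> 'a" assume wx: "agree_on (- L) w x"
  have "ent (tens L a * tens L b) w x = (\<Sum>z\<in>confs L. \<Prod>i\<in>L. a i $ w i $ z i * b i $ z i $ x i)"
    unfolding ent_mult_local[OF L tens_local[OF L]] ent_tens[OF L] site_tensor_def
    using wx by (auto simp: agree_on_def override_on_def prod.distrib intro!: sum.cong)
  \<comment> \<open>A sum over configurations of a product of one-site terms is the product of the
    one-site sums.\<close>
  also have "\<dots> = (\<Prod>i\<in>L. \<Sum>c\<in>UNIV. a i $ w i $ c * b i $ c $ x i)"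
    unfolding confs_def by (rule prod_sum_PiE[symmetric]) (simp_all add: L)
  also have "\<dots> = (\<Prod>i\<in>L. (a i ** b i) $ w i $ x i)"
    by (simp add: matrix_matrix_mult_def)
  finally show "ent (tens L a * tens L b) w x = (\<Prod>i\<in>L. (a i ** b i) $ w i $ x i)" .
qed

lemma tens_one:
  assumes L: "finite L"
  shows "tens L (\<lambda>_. mat 1) = 1"
proof (rule tens_eqI[OF L local_ops_one, symmetric])
  fix w x :: "int \<Rightarrow> 'a" assume wx: "agree_on (- L) w x"
  have "(\<Prod>i\<in>L. (mat 1 :: complex^'a^'a) $ w i $ x i) = (\<Prod>i\<in>L. if w i = x i then 1 else 0)"
    by (simp add: mat_def)
  also have "\<dots> = (if \<forall>i\<in>L. w i = x i then 1 else 0)"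
    using L by (auto simp: prod_zero_iff)
  also have "\<dots> = ent 1 w x"
    using wx by (auto simp: agree_on_def fun_eq_iff)
  finally show "ent 1 w x = (\<Prod>i\<in>L. (mat 1 :: complex^'a^'a) $ w i $ x i)"
    by simp
qed

lemma tens_star:
  assumes L: "finite L"
  shows "star (tens L a) = tens L (\<lambda>i. mat_adj (a i))"
  by (rule tens_eqI[OF L local_ops_star[OF tens_local[OF L]]])
     (simp add: ent_tens[OF L] site_tensor_def mat_adj_def agree_on_sym)

lemma tens_union:
  assumes "finite L" "finite L'" "L \<inter> L' = {}"
  shows "tens L a * tens L' a = tens (L \<union> L') a"
proof (rule tens_eqI)
  show "tens L a * tens L' a \<in> local_ops (L \<union> L')"
    using assms(1,2)
    by (intro local_ops_mult subsetD[OF local_ops_mono tens_local]) auto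
  fix w x :: "int \<Rightarrow> 'a" assume "agree_on (- (L \<union> L')) w x"
  then show "ent (tens L a * tens L' a) w x = (\<Prod>i\<in>L \<union> L'. a i $ w i $ x i)"
    unfolding ent_mult_disjoint[OF tens_local[OF assms(1)] tens_local[OF assms(2)] assms(3)] prod.union_disjoint[OF assms]
    using assms
    by (auto simp: ent_tens site_tensor_def agree_on_def override_on_def intro!: arg_cong2[where f="(*)"] prod.cong)
qed (use assms in auto)

section \<open>Gauge-invariant local algebras\<close>

definition gauge_unitaries :: "(complex^'d^'d) set \<Rightarrow> int set \<Rightarrow> (int \<Rightarrow> 'd::finite) fmat set" where
  "gauge_unitaries G L = (\<lambda>g. tens L (\<lambda>_. g)) ` G"

lemma mat_adj_unique:
  fixes g h :: "complex^'d::finite^'d"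
  assumes "mat_adj g ** g = mat 1" "g ** h = mat 1"
  shows "h = mat_adj g"
  by (metis assms matrix_mul_assoc matrix_mul_lid matrix_mul_rid)

lemma unitary_subgroup:
  fixes G :: "(complex^'d::finite^'d) set"
  assumes G: "subgroup G unitary_group"
  shows "mat 1 \<in> G" "\<And>g h. g \<in> G \<Longrightarrow> h \<in> G \<Longrightarrow> g ** h \<in> G" "\<And>g. g \<in> G \<Longrightarrow> mat_adj g \<in> G"
    "\<And>g. g \<in> G \<Longrightarrow> mat_adj g ** g = mat 1" "\<And>g. g \<in> G \<Longrightarrow> g ** mat_adj g = mat 1"
proof -
  show "mat 1 \<in> G" "\<And>g h. g \<in> G \<Longrightarrow> h \<in> G \<Longrightarrow> g ** h \<in> G"
    using subgroup.one_closed[OF G] subgroup.m_closed[OF G] by (simp_all add: unitary_group_def)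
  show u: "mat_adj g ** g = mat 1" "g ** mat_adj g = mat 1" if "g \<in> G" for g
    using subgroup.mem_carrier[OF G that] by (simp_all add: unitary_group_def)
  show "mat_adj g \<in> G" if g: "g \<in> G" for g
  proof -
    have adj: "mat_adj (mat_adj g) = g"
      by (simp add: mat_adj_def vec_eq_iff)
    have "m_inv unitary_group g = mat_adj g"
      unfolding m_inv_def
      by (rule the_equality) (use u[OF g] mat_adj_unique in \<open>auto simp: unitary_group_def adj\<close>)
    then show ?thesis
      using subgroup.m_inv_closed[OF G g] by simp
  qed
qed

lemma gauge_commutant:
  fixes G :: "(complex^'d::finite^'d) set"
  assumes G: "subgroup G unitary_group" and L: "finite L"
  shows "commutant (confs L) (local_ops L) (gauge_unitaries G L)"
proof -
  interpret sector "confs L" "local_ops L :: (int \<Rightarrow> 'd) fmat set"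
    by (rule sector_local_ops[OF L])
  note U = unitary_subgroup[OF G]
  show ?thesis
  proof
    show "gauge_unitaries G L \<subseteq> local_ops L"
      by (auto simp: gauge_unitaries_def tens_local[OF L])
    show "1 \<in> gauge_unitaries G L"
      unfolding gauge_unitaries_def using U(1) tens_one[OF L] by (intro image_eqI[of _ _ "mat 1"]) auto
    show "u * w \<in> gauge_unitaries G L" if "u \<in> gauge_unitaries G L" "w \<in> gauge_unitaries G L" for u w
      using that U(2) by (auto simp: gauge_unitaries_def tens_mult[OF L])
    show "star u \<in> gauge_unitaries G L" if "u \<in> gauge_unitaries G L" for u
      using that U(3) by (auto simp: gauge_unitaries_def tens_star[OF L])
  qed
qed

lemma gauge_action_ent:
  assumes L: "finite L"
  shows "gauge_action L g (ent A) = ent (tens L (\<lambda>_. g) * A * star (tens L (\<lambda>_. g)))"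
  unfolding gauge_action_def ent_tens[OF L, symmetric] kernel_ent ..

lemma gauge_action_fixed_iff:
  fixes G :: "(complex^'d::finite^'d) set"
  assumes G: "subgroup G unitary_group" and L: "finite L" and g: "g \<in> G"
  shows "gauge_action L g (ent A) = ent A \<longleftrightarrow> tens L (\<lambda>_. g) * A = A * tens L (\<lambda>_. g)"
proof -
  let ?u = "tens L (\<lambda>_. g)"
  have u: "?u * star ?u = 1" "star ?u * ?u = 1"
    using unitary_subgroup(4,5)[OF G g] by (simp_all add: tens_star[OF L] tens_mult[OF L] tens_one[OF L])
  have "?u * A * star ?u = A \<longleftrightarrow> ?u * A = A * ?u"
  proof
    assume *: "?u * A * star ?u = A"
    have "?u * A * star ?u * ?u = ?u * A"
      by (simp only: mult.assoc u mult_1_right)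
    with * show "?u * A = A * ?u"
      by simp
  next
    assume "?u * A = A * ?u"
    then show "?u * A * star ?u = A"
      by (simp only: mult.assoc u mult_1_right)
  qed
  then show ?thesis
    by (simp add: gauge_action_ent[OF L] ent_inject)
qed

lemma gauge_local_algebra_eq:
  fixes G :: "(complex^'d::finite^'d) set"
  assumes G: "subgroup G unitary_group" and L: "finite L"
  shows "gauge_local_algebra G L = ent ` {A \<in> local_ops L. \<forall>g\<in>G. tens L (\<lambda>_. g) * A = A * tens L (\<lambda>_. g)}"
  unfolding gauge_local_algebra_def ent_local_ops[OF L, symmetric]
  using gauge_action_fixed_iff[OF G L] by auto

text \<open>The unitary on \<open>L'\<close> is the product of those on \<open>L\<close> and on
  \<open>L' - L\<close>, and the latter commutes with every operator on \<open>L\<close>. This is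
  how the intervals \<open>{1..n}\<close> reach \<open>gauge_algebra\<close>, which is built from
  symmetric intervals.\<close>

lemma gauge_local_algebra_mono:
  fixes G :: "(complex^'d::finite^'d) set"
  assumes G: "subgroup G unitary_group" and L: "finite L'" "L \<subseteq> L'"
  shows "gauge_local_algebra G L \<subseteq> gauge_local_algebra G L'"
proof -
  have fin: "finite L" "finite (L' - L)" and un: "L \<union> (L' - L) = L'" and disj: "L \<inter> (L' - L) = {}"
    using L finite_subset by auto
  have "tens L' (\<lambda>_. g) * A = A * tens L' (\<lambda>_. g)"
    if A: "A \<in> local_ops L" "tens L (\<lambda>_. g) * A = A * tens L (\<lambda>_. g)" for g and A :: "(int \<Rightarrow> 'd) fmat"
  proof -
    have "tens L' (\<lambda>_. g) = tens L (\<lambda>_. g) * tens (L' - L) (\<lambda>_. g)"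
      using tens_union[OF fin disj, of "\<lambda>_. g"] unfolding un by (rule sym)
    moreover have "A * tens (L' - L) (\<lambda>_. g) = tens (L' - L) (\<lambda>_. g) * A"
      by (rule mult_commute_disjoint[OF A(1) tens_local[OF fin(2)] disj])
    ultimately show ?thesis
      using A(2) by (metis mult.assoc)
  qed
  then show ?thesis
    unfolding gauge_local_algebra_eq[OF G fin(1)] gauge_local_algebra_eq[OF G L(1)]
    using local_ops_mono[OF L(2)] by blast
qed

lemma gauge_commutant_N:
  fixes G :: "(complex^'d::finite^'d) set"
  assumes G: "subgroup G unitary_group" and L: "finite L"
  shows "ent ` commutant.N (local_ops L) (gauge_unitaries G L) = gauge_local_algebra G L"
  unfolding gauge_local_algebra_eq[OF assms] commutant.N_def[OF gauge_commutant[OF assms]]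
  by (simp add: gauge_unitaries_def)

text \<open>
  The entries of \<open>g \<otimes> \<dots> \<otimes> g\<close> are monomials in the entries of \<open>g\<close>, and there are only
  polynomially many of them.
\<close>

lemma gauge_orbit_bound:
  fixes G :: "(complex^'d::finite^'d) set" and v :: "(int \<Rightarrow> 'd) \<Rightarrow> complex"
  assumes L: "finite L"
  shows "\<exists>T. finite T \<and> card T \<le> (card L + 1) ^ (CARD('d) * CARD('d)) \<and>
    (\<forall>u\<in>gauge_unitaries G L. sector.act (confs L) u v \<in> fv.span T)"
proof -
  interpret sector "confs L" "local_ops L :: (int \<Rightarrow> 'd) fmat set"
    by (rule sector_local_ops[OF L])
  \<comment> \<open>Exponent vectors: one exponent between \<open>0\<close> and
    \<open>card L\<close> for each of the \<open>d^2\<close> matrix positions. Their number is the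
    bound claimed.\<close>
  let ?C = "PiE (UNIV :: ('d \<times> 'd) set) (\<lambda>_. {..card L})"
  \<comment> \<open>The number of sites at which the entry of \<open>g\<close> at position
    \<open>p\<close> occurs in the \<open>(w, x)\<close> entry of the tensor power, i.e. its
    exponent in that monomial.\<close>
  define cnt where "cnt w x p = card {i \<in> L. (w i, x i) = p}" for w x :: "int \<Rightarrow> 'd" and p
  \<comment> \<open>Collects the terms with the same monomial. It does not depend on
    \<open>g\<close>, so these vectors span all orbit points at once.\<close>
  define T where "T c w = (if w \<in> confs L then \<Sum>x\<in>{x \<in> confs L. cnt w x = c}. v x else 0)" for c w
  have cnt: "cnt w x \<in> ?C" for w x
    using L by (auto simp: cnt_def intro: card_mono)
  have finC: "finite ?C" and cardC: "card ?C = (card L + 1) ^ (CARD('d) * CARD('d))"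
    by (simp_all add: finite_PiE card_PiE)
  have "act (tens L (\<lambda>_. g)) v = (\<Sum>c\<in>?C. fscale (\<Prod>p\<in>UNIV. g $ fst p $ snd p ^ c p) (T c))" for g
  proof
    fix w
    show "act (tens L (\<lambda>_. g)) v w = (\<Sum>c\<in>?C. fscale (\<Prod>p\<in>UNIV. g $ fst p $ snd p ^ c p) (T c)) w"
    proof (cases "w \<in> confs L")
      case True
      have mon: "(\<Prod>i\<in>L. g $ w i $ x i) = (\<Prod>p\<in>UNIV. g $ fst p $ snd p ^ cnt w x p)" for x
      proof -
        have "(\<Prod>i\<in>L. g $ w i $ x i) = (\<Prod>p\<in>UNIV. \<Prod>i\<in>{i \<in> L. (w i, x i) = p}. g $ w i $ x i)"
          by (rule prod.group[symmetric]) (use L in auto)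
        also have "\<dots> = (\<Prod>p\<in>UNIV. \<Prod>i\<in>{i \<in> L. (w i, x i) = p}. g $ fst p $ snd p)"
          by (intro prod.cong refl) auto
        finally show ?thesis
          by (simp add: cnt_def)
      qed
      have "act (tens L (\<lambda>_. g)) v w = (\<Sum>x\<in>confs L. (\<Prod>p\<in>UNIV. g $ fst p $ snd p ^ cnt w x p) * v x)"
        using True unfolding act_def ent_tens[OF L] site_tensor_def mon
        by (auto simp: confs_iff agree_on_def intro!: sum.cong)
      also have "\<dots> = (\<Sum>c\<in>?C. \<Sum>x\<in>{x \<in> confs L. cnt w x = c}. (\<Prod>p\<in>UNIV. g $ fst p $ snd p ^ cnt w x p) * v x)"
        by (rule sum.group[symmetric]) (use fin finC cnt in auto)
      also have "\<dots> = (\<Sum>c\<in>?C. fscale (\<Prod>p\<in>UNIV. g $ fst p $ snd p ^ c p) (T c)) w"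
        using True by (simp add: sum_fun_apply fscale_def T_def sum_distrib_left)
      finally show ?thesis .
    next
      case False
      then show ?thesis
        by (simp add: act_def sum_fun_apply fscale_def T_def)
    qed
  qed
  then have "act (tens L (\<lambda>_. g)) v \<in> fv.span (T ` ?C)" for g
    by (simp only:) (intro fv.span_sum fv.span_scale fv.span_base imageI)
  then show ?thesis
    using finC cardC card_image_le[OF finC, of T]
    by (intro exI[of _ "T ` ?C"]) (auto simp: gauge_unitaries_def)
qed

section \<open>States on the infinite tensor product\<close>

lemma kclosure_superset: "K \<in> N \<Longrightarrow> K \<in> kclosure N"
  unfolding kclosure_def knorm_le_def by (auto intro!: bexI[of _ K] mult_nonneg_nonneg sum_nonneg)

lemma finite_int_bounded:
  assumes "finite (L :: int set)"
  obtains n where "1 \<le> n" "L \<subseteq> {- int n..int n}"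
proof -
  \<comment> \<open>The \<open>1\<close> guarantees \<open>1 \<le> n\<close> even for empty
    \<open>L\<close>; the unions that define the algebras start there.\<close>
  let ?b = "Max (insert 1 (abs ` L))"
  have "\<bar>i\<bar> \<le> ?b" if "i \<in> L" for i
    using assms that by (intro Max_ge) auto
  moreover have "1 \<le> ?b"
    using assms by (intro Max_ge) auto
  ultimately show ?thesis
    by (intro that[of "nat ?b"]) force+
qed

lemma local_algebra_tensor_algebra:
  assumes "finite L"
  shows "(local_algebra L :: 'd::finite kernel set) \<subseteq> tensor_algebra"
proof
  fix K :: "'d kernel" assume K: "K \<in> local_algebra L"
  obtain n where n: "1 \<le> n" "L \<subseteq> {- int n..int n}"
    by (rule finite_int_bounded[OF assms])
  have "K \<in> local_algebra {- int n..int n}"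
    using K local_ops_mono[OF n(2)] ent_local_ops[OF assms] ent_local_ops[of "{- int n..int n}"] by blast
  then show "K \<in> tensor_algebra"
    unfolding tensor_algebra_def using n(1) by (intro kclosure_superset) auto
qed

lemma gauge_local_algebra_gauge_algebra:
  fixes G :: "(complex^'d::finite^'d) set"
  assumes "subgroup G unitary_group" "finite L"
  shows "gauge_local_algebra G L \<subseteq> gauge_algebra G"
proof
  fix K assume K: "K \<in> gauge_local_algebra G L"
  obtain n where n: "1 \<le> n" "L \<subseteq> {- int n..int n}"
    by (rule finite_int_bounded[OF assms(2)])
  then have "K \<in> gauge_local_algebra G {- int n..int n}"
    using K gauge_local_algebra_mono[OF assms(1) _ n(2)] by auto
  then show "K \<in> gauge_algebra G"
    unfolding gauge_algebra_def using n(1) by (intro kclosure_superset) auto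
qed

lemma local_sector_state:
  fixes psi :: "'d::finite kernel \<Rightarrow> complex"
  assumes psi: "state_on tensor_algebra psi" and L: "finite L"
  shows "sector_state (confs L) (local_ops L) psi"
proof -
  interpret sector "confs L" "local_ops L :: (int \<Rightarrow> 'd) fmat set"
    by (rule sector_local_ops[OF L])
  have T: "ent A \<in> tensor_algebra" if "A \<in> local_ops L" for A :: "(int \<Rightarrow> 'd) fmat"
    using that local_algebra_tensor_algebra[OF L] by (auto simp: local_ops_def)
  note st = psi[unfolded state_on_def]
  show ?thesis
  proof
    fix A B :: "(int \<Rightarrow> 'd) fmat" and c
    assume A: "A \<in> local_ops L"
    show "psi (ent (A + B)) = psi (ent A) + psi (ent B)" if "B \<in> local_ops L"
      using st T[OF A] T[OF that] by (simp flip: kadd_ent)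
    show "psi (ent (c *\<^sub>C A)) = c * psi (ent A)"
      using st T[OF A] by (simp flip: kscale_ent)
    show "psi (ent (star A * A)) \<in> \<real>\<^sub>\<ge>\<^sub>0"
      using st T[OF A] by (simp flip: kmult_ent kadj_ent)
  next
    show "psi (ent 1) = 1"
      using st by (simp flip: kone_ent)
  qed
qed

section \<open>Translations\<close>

text \<open>Reading the configuration at \<open>i + k\<close> in place of \<open>i\<close> carries
  an operator on \<open>L\<close> to the same operator on \<open>L + k\<close>.\<close>

definition shift :: "int \<Rightarrow> (int \<Rightarrow> 'd) fmat \<Rightarrow> (int \<Rightarrow> 'd) fmat" where
  "shift k A = Fmat (\<lambda>w x. ent A (\<lambda>i. w (i + k)) (\<lambda>i. x (i + k)))"

lemma translate_bij: "bij (\<lambda>(w :: int \<Rightarrow> 'd) i. w (i + k))"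
  by (rule bij_betw_byWitness[where f' = "\<lambda>w i. w (i - k)"]) auto

lemma ent_shift [simp]: "ent (shift k A) w x = ent A (\<lambda>i. w (i + k)) (\<lambda>i. x (i + k))"
proof -
  have "finite ((\<lambda>x i. x (i + k)) -` {x. ent A w x \<noteq> 0})" "finite ((\<lambda>x i. x (i + k)) -` {x. ent A x w \<noteq> 0})" for w
    using finite_row[of A w] finite_col[of A w] bij_is_inj[OF translate_bij[of k]] by (intro finite_vimageI; blast)+
  then show ?thesis
    unfolding shift_def by (subst ent_Fmat) (simp_all add: vimage_def)
qed

lemma translate_eq_iff: "(\<lambda>i. w (i + k)) = (\<lambda>i. x (i + k)) \<longleftrightarrow> w = x" for w x :: "int \<Rightarrow> 'd"
  using inj_eq[OF bij_is_inj[OF translate_bij[of k]], of w x] by simp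

lemma shift_one: "shift k 1 = 1"
  by (rule fmat_eqI) (simp add: translate_eq_iff)

lemma shift_zero: "shift k 0 = 0"
  and shift_star: "star (shift k A) = shift k (star A)"
  and shift_scale: "shift k (c *\<^sub>C A) = c *\<^sub>C shift k A"
  and shift_sum: "shift k (\<Sum>s\<in>S. f s) = (\<Sum>s\<in>S. shift k (f s))"
  by (rule fmat_eqI, simp)+

lemma shift_mult: "shift k (A * B) = shift k A * shift k B"
proof (rule fmat_eqI)
  fix w x :: "int \<Rightarrow> 'a"
  let ?w = "\<lambda>i. w (i + k)" and ?x = "\<lambda>i. x (i + k)"
  let ?R = "{y. ent A ?w y \<noteq> 0}"
  have inj: "inj_on (\<lambda>y i. y (i - k)) ?R"
    by (rule inj_onI) (metis (no_types, lifting) add_diff_cancel_right' ext)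
  have "ent (shift k A * shift k B) w x = (\<Sum>y\<in>(\<lambda>y i. y (i - k)) ` ?R. ent (shift k A) w y * ent (shift k B) y x)"
  proof (rule ent_mult)
    fix y assume "ent (shift k A) w y \<noteq> 0"
    then show "y \<in> (\<lambda>y i. y (i - k)) ` ?R"
      by (intro image_eqI[of _ _ "\<lambda>i. y (i + k)"]) auto
  qed (simp add: finite_row)
  also have "\<dots> = (\<Sum>y\<in>?R. ent A ?w y * ent B y ?x)"
    by (simp add: sum.reindex[OF inj])
  also have "\<dots> = ent (shift k (A * B)) w x"
    by (simp add: ent_mult[OF finite_row[of A ?w]])
  finally show "ent (shift k (A * B)) w x = ent (shift k A * shift k B) w x"
    by simp
qed

lemma shift_local:
  assumes A: "A \<in> local_ops L"
  shows "shift k A \<in> local_ops ((\<lambda>i. i + k) ` L)"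
proof (rule local_opsI)
  fix w x :: "int \<Rightarrow> 'a"
  assume "ent (shift k A) w x \<noteq> 0"
  then have *: "agree_on (- L) (\<lambda>i. w (i + k)) (\<lambda>i. x (i + k))"
    using local_opsD(1)[OF A] by simp
  show "agree_on (- ((\<lambda>i. i + k) ` L)) w x"
    unfolding agree_on_def
  proof
    fix i assume i: "i \<in> - ((\<lambda>i. i + k) ` L)"
    have "i - k \<notin> L"
    proof
      assume "i - k \<in> L"
      then have "i \<in> (\<lambda>i. i + k) ` L"
        by (intro image_eqI[of _ _ "i - k"]) auto
      with i show False
        by simp
    qed
    then show "w i = x i"
      using * unfolding agree_on_def by (auto dest!: bspec[of _ _ "i - k"])
  qed
next
  fix w x w' x' :: "int \<Rightarrow> 'a"
  let ?L = "(\<lambda>i. i + k) ` L"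
  assume "agree_on (- ?L) w x" "agree_on (- ?L) w' x'" "agree_on ?L w w'" "agree_on ?L x x'"
  then show "ent (shift k A) w x = ent (shift k A) w' x'"
    unfolding ent_shift by (intro local_opsD(2)[OF A]) (auto simp: agree_on_def)
qed

lemma trace_shift: "(\<Sum>w\<in>confs ((\<lambda>i. i + k) ` L). ent (shift k A) w w) = (\<Sum>w\<in>confs L. ent A w w)"
proof -
  have "bij_betw (\<lambda>w i. w (i + k)) (confs ((\<lambda>i. i + k) ` L)) (confs L :: (int \<Rightarrow> 'd) set)"
  proof (rule bij_betw_byWitness[where f' = "\<lambda>w i. w (i - k)"])
    show "(\<lambda>w i. w (i - k)) ` confs L \<subseteq> (confs ((\<lambda>i. i + k) ` L) :: (int \<Rightarrow> 'd) set)"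
    proof clarsimp
      fix w :: "int \<Rightarrow> 'd" assume w: "w \<in> confs L"
      have "i \<in> (\<lambda>i. i + k) ` L" if "i - k \<in> L" for i
        using that by (intro image_eqI[of _ _ "i - k"]) auto
      then show "(\<lambda>i. w (i - k)) \<in> confs ((\<lambda>i. i + k) ` L)"
        using w by (auto simp: confs_iff)
    qed
    show "(\<lambda>w i. w (i + k)) ` confs ((\<lambda>i. i + k) ` L) \<subseteq> (confs L :: (int \<Rightarrow> 'd) set)"
    proof clarsimp
      fix w :: "int \<Rightarrow> 'd" assume w: "w \<in> confs ((\<lambda>i. i + k) ` L)"
      have "i + k \<in> (\<lambda>i. i + k) ` L \<longleftrightarrow> i \<in> L" for i
        by auto
      then show "(\<lambda>i. w (i + k)) \<in> confs L"
        using w by (simp add: confs_iff)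
    qed
  qed auto
  then show ?thesis
    unfolding ent_shift by (rule sum.reindex_bij_betw)
qed

lemma shift_tens:
  assumes L: "finite L"
  shows "shift k (tens L a) = tens ((\<lambda>i. i + k) ` L) (\<lambda>i. a (i - k))"
proof (rule tens_eqI[OF _ shift_local[OF tens_local[OF L]]])
  fix w x :: "int \<Rightarrow> 'a"
  assume "agree_on (- ((\<lambda>i. i + k) ` L)) w x"
  then show "ent (shift k (tens L a)) w x = (\<Prod>i\<in>(\<lambda>i. i + k) ` L. a (i - k) $ w i $ x i)"
    by (auto simp: ent_tens[OF L] site_tensor_def agree_on_def prod.reindex)
qed (simp add: L)

lemma image_shift_interval: "(\<lambda>i. i + k) ` {1..int m} = {k + 1..k + int m}"
  by (simp add: add.commute)

lemma finitely_correlated_tens: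
  assumes "finitely_correlated E \<rho> psi"
  shows "psi (ent (tens {k + 1..k + int m} a)) =
    \<rho> (foldr (\<lambda>A C. E (kron A C)) (map (\<lambda>j. a (k + 1 + int j)) [0..<m]) (mat 1))"
proof -
  let ?As = "map (\<lambda>j. a (k + 1 + int j)) [0..<m]"
  have "site_tensor {k + 1..k + int m} a =
      site_tensor {k + 1..k + int (length ?As)} (\<lambda>i. ?As ! nat (i - k - 1))"
    unfolding site_tensor_def by (auto simp: fun_eq_iff intro!: prod.cong)
  then show ?thesis
    using assms by (simp add: finitely_correlated_def ent_tens del: length_map)
qed

text \<open>The value of \<open>psi\<close> on an elementary tensor over consecutive sites depends
  on the list of factors and not on the position \<open>k\<close>; tensors of matrix units span the
  local algebra.\<close>

lemma shift_invariant:
  fixes A :: "(int \<Rightarrow> 'd::finite) fmat"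
  assumes psi: "finitely_correlated E \<rho> psi" and A: "A \<in> local_ops {1..int m}"
  shows "psi (ent (shift k A)) = psi (ent A)"
proof -
  let ?L = "{1..int m}" and ?L' = "{k + 1..k + int m}"
  \<comment> \<open>The matrix unit at site \<open>i\<close> with row \<open>u i\<close> and column
    \<open>v i\<close>.\<close>
  let ?e = "\<lambda>u v i. (\<chi> a b. if a = u i \<and> b = v i then 1 else 0) :: complex^'d^'d"
  have state: "state_on tensor_algebra psi"
    using psi by (simp add: finitely_correlated_def)
  interpret sector_state "confs ?L" "local_ops ?L" psi
    by (rule local_sector_state[OF state]) simp
  interpret B: sector_state "confs ?L'" "local_ops ?L'" psi
    by (rule local_sector_state[OF state]) simp
  have tl: "tens ?L a \<in> local_ops ?L" "shift k (tens ?L a) \<in> local_ops ?L'" for a :: "int \<Rightarrow> complex^'d^'d"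
    using tens_local[of ?L a] shift_local[OF tens_local[of ?L a], of k] by (simp_all only: image_shift_interval finite_atLeastAtMost_int)
  have inv: "psi (ent (shift k (tens ?L a))) = psi (ent (tens ?L a))" for a
    using finitely_correlated_tens[OF psi, of k m "\<lambda>i. a (i - k)"] finitely_correlated_tens[OF psi, of 0 m a]
    by (simp add: shift_tens image_shift_interval del: image_add_atLeastAtMost')
  have expand: "A = (\<Sum>u\<in>confs ?L. \<Sum>v\<in>confs ?L. ent A u v *\<^sub>C tens ?L (?e u v))"
  proof (rule M_eqI[OF A])
    fix w x :: "int \<Rightarrow> 'd" assume wx: "w \<in> confs ?L" "x \<in> confs ?L"
    have "ent (tens ?L (?e u v)) w x = (if u = w then if v = x then 1 else 0 else 0)"
      if "u \<in> confs ?L" "v \<in> confs ?L" for u v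
    proof -
      have "agree_on (- ?L) w x"
        using wx by (simp add: agree_on_def confs_iff)
      then have "ent (tens ?L (?e u v)) w x = (\<Prod>i\<in>?L. if w i = u i \<and> x i = v i then 1 else 0)"
        by (simp add: ent_tens site_tensor_def)
      also have "\<dots> = (if \<forall>i\<in>?L. w i = u i \<and> x i = v i then 1 else 0)"
        by (auto simp: prod_zero_iff)
      also have "(\<forall>i\<in>?L. w i = u i \<and> x i = v i) \<longleftrightarrow> u = w \<and> v = x"
        using wx that unfolding confs_iff fun_eq_iff by metis
      finally show ?thesis
        by simp
    qed
    then have "ent (\<Sum>u\<in>confs ?L. \<Sum>v\<in>confs ?L. ent A u v *\<^sub>C tens ?L (?e u v)) w x =
        (\<Sum>u\<in>confs ?L. \<Sum>v\<in>confs ?L. if u = w then if v = x then ent A u v else 0 else 0)"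
      by (auto intro!: sum.cong)
    also have "\<dots> = (\<Sum>u\<in>confs ?L. if u = w then ent A u x else 0)"
      using wx fin by (intro sum.cong refl) auto
    also have "\<dots> = ent A w x"
      using wx fin by simp
    finally show "ent A w x = ent (\<Sum>u\<in>confs ?L. \<Sum>v\<in>confs ?L. ent A u v *\<^sub>C tens ?L (?e u v)) w x"
      by simp
  qed (intro M_sum M_scale tl)
  have "psi (ent (\<Sum>s\<in>S. f s)) = (\<Sum>s\<in>S. psi (ent (f s)))" if "\<And>s. s \<in> S \<Longrightarrow> f s \<in> local_ops ?L" for S and f :: "(int \<Rightarrow> 'd) \<Rightarrow> _"
    using that psi_scale[OF M_zero, of 0]
    by (induction S rule: infinite_finite_induct) (auto simp: psi_add M_sum)
  then have "psi (ent A) = (\<Sum>u\<in>confs ?L. \<Sum>v\<in>confs ?L. ent A u v * psi (ent (tens ?L (?e u v))))"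
    by (subst expand) (simp add: M_sum M_scale tl psi_scale)
  moreover have "psi (ent (\<Sum>s\<in>S. f s)) = (\<Sum>s\<in>S. psi (ent (f s)))" if "\<And>s. s \<in> S \<Longrightarrow> f s \<in> local_ops ?L'" for S and f :: "(int \<Rightarrow> 'd) \<Rightarrow> _"
    using that B.psi_scale[OF B.M_zero, of 0]
    by (induction S rule: infinite_finite_induct) (auto simp: B.psi_add B.M_sum)
  then have "psi (ent (shift k A)) = (\<Sum>u\<in>confs ?L. \<Sum>v\<in>confs ?L. ent A u v * psi (ent (shift k (tens ?L (?e u v)))))"
    by (subst expand) (simp add: shift_sum shift_scale B.M_sum B.M_scale tl B.psi_scale)
  ultimately show ?thesis
    unfolding inv by simp
qed

section \<open>Subadditivity\<close>

text \<open>\<open>gibbs\<close> against the product of the marginals, whose total is one like that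
  of \<open>a\<close>. Where \<open>a p q = 0\<close> a marginal may vanish and the logarithm of the
  product would not split, so that case is separate.\<close>

lemma eta_subadditive:
  fixes a :: "'i \<Rightarrow> 'j \<Rightarrow> real"
  assumes fin: "finite P" "finite Q" and nn: "\<And>p q. p \<in> P \<Longrightarrow> q \<in> Q \<Longrightarrow> 0 \<le> a p q"
    and total: "(\<Sum>p\<in>P. \<Sum>q\<in>Q. a p q) = 1"
  shows "(\<Sum>p\<in>P. \<Sum>q\<in>Q. eta (a p q)) \<le> (\<Sum>p\<in>P. eta (\<Sum>q\<in>Q. a p q)) + (\<Sum>q\<in>Q. eta (\<Sum>p\<in>P. a p q))"
proof -
  define b where "b p = (\<Sum>q\<in>Q. a p q)" for p
  define c where "c q = (\<Sum>p\<in>P. a p q)" for q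
  have bc: "(\<Sum>p\<in>P. b p) = 1" "(\<Sum>q\<in>Q. c q) = 1"
    using total sum.swap[of a Q P] by (simp_all add: b_def c_def)
  have point: "eta (a p q) \<le> a p q * (- ln (b p)) + a p q * (- ln (c q)) + b p * c q - a p q"
    if p: "p \<in> P" and q: "q \<in> Q" for p q
  proof -
    have le: "a p q \<le> b p" "a p q \<le> c q"
      unfolding b_def c_def using p q fin nn by (auto intro!: member_le_sum[of _ _ "\<lambda>i. a i q"] member_le_sum[of _ _ "a p"])
    show ?thesis
    proof (cases "a p q = 0")
      case True
      then show ?thesis
        using le by simp
    next
      case False
      then have "0 < a p q"
        using nn[OF p q] by simp
      then have "0 < b p" "0 < c q"
        using le by auto
      then show ?thesis
        using gibbs[of "a p q" "b p * c q"] nn[OF p q] by (simp add: ln_mult algebra_simps)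
    qed
  qed
  have "(\<Sum>p\<in>P. \<Sum>q\<in>Q. eta (a p q)) \<le>
      (\<Sum>p\<in>P. \<Sum>q\<in>Q. a p q * (- ln (b p)) + a p q * (- ln (c q)) + b p * c q - a p q)"
    using point by (intro sum_mono)
  also have "\<dots> = (\<Sum>p\<in>P. \<Sum>q\<in>Q. a p q * (- ln (b p))) + (\<Sum>p\<in>P. \<Sum>q\<in>Q. a p q * (- ln (c q))) +
      (\<Sum>p\<in>P. \<Sum>q\<in>Q. b p * c q) - (\<Sum>p\<in>P. \<Sum>q\<in>Q. a p q)"
    by (simp only: sum.distrib sum_subtractf)
  also have "(\<Sum>p\<in>P. \<Sum>q\<in>Q. a p q * (- ln (b p))) = (\<Sum>p\<in>P. eta (b p))"
    by (simp only: sum_distrib_right[symmetric] b_def[symmetric]) (simp add: eta_def)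
  also have "(\<Sum>p\<in>P. \<Sum>q\<in>Q. a p q * (- ln (c q))) = (\<Sum>q\<in>Q. eta (c q))"
    by (subst sum.swap, simp only: sum_distrib_right[symmetric] c_def[symmetric]) (simp add: eta_def)
  also have "(\<Sum>p\<in>P. \<Sum>q\<in>Q. b p * c q) = 1"
    by (simp only: sum_product[symmetric] bc)
  finally show ?thesis
    using total by (simp add: b_def c_def)
qed

text \<open>With \<open>r = 1\<close> the bound on minimal projections leaves rank exactly one,
  which is recorded as trace one so that it can be used across different regions.\<close>

lemma local_entropy_partition:
  fixes psi :: "'d::finite kernel \<Rightarrow> complex"
  assumes psi: "state_on tensor_algebra psi" and L: "finite L"
  obtains Q where "minpartition (local_ops L) 1 Q"
    "entropy (local_algebra L) psi = (\<Sum>p\<in>Q. eta (Re (psi (ent p))))"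
    "\<And>p. p \<in> Q \<Longrightarrow> (\<Sum>w\<in>confs L. ent p w w) = 1"
proof -
  interpret sector_state "confs L" "local_ops L" psi
    by (rule local_sector_state[OF psi L])
  interpret bounded_commutant "confs L" "local_ops L" psi "{1}" 1
    by (rule full_commutant)
  obtain Q where Q: "minpartition (local_ops L) 1 Q"
    "entropy (ent ` local_ops L) psi = (\<Sum>p\<in>Q. eta (pr p))"
    using entropy_eq unfolding full_commutant_N by blast
  have "(\<Sum>w\<in>confs L. ent p w w) = 1" if "p \<in> Q" for p
  proof -
    have p: "minproj (local_ops L) p"
      using Q(1) that by (simp add: minpartition_def)
    then have "rk p = 1"
      using minproj_rk_le[unfolded full_commutant_N] minproj_rk(2)[unfolded full_commutant_N] by (metis antisym)
    then show ?thesis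
      using minproj_rk(1)[unfolded full_commutant_N, OF p] by (simp add: tr_def)
  qed
  then show ?thesis
    using that Q by (simp add: ent_local_ops[OF L] pr_def)
qed

text \<open>Eigenprojections of the first block times translated eigenprojections of the second form
  a partition into rank-one projections. It bounds the joint entropy, and its probabilities have the
  two block distributions as marginals.\<close>

lemma local_entropy_subadditive:
  fixes psi :: "'d::finite kernel \<Rightarrow> complex"
  assumes fc: "finitely_correlated E \<rho> psi"
  shows "entropy (local_algebra {1..int (n + m)}) psi \<le>
    entropy (local_algebra {1..int n}) psi + entropy (local_algebra {1..int m}) psi"
proof -
  let ?L1 = "{1..int n}" and ?L2 = "{1..int m}" and ?L2' = "{int n + 1..int n + int m}" and ?L = "{1..int (n + m)}"
  have state: "state_on tensor_algebra psi"
    using fc by (simp add: finitely_correlated_def)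
  have un: "?L = ?L1 \<union> ?L2'" and disj: "?L1 \<inter> ?L2' = {}"
    by auto
  interpret sector_state "confs ?L" "local_ops ?L" psi
    by (rule local_sector_state[OF state]) simp
  interpret bounded_commutant "confs ?L" "local_ops ?L" psi "{1}" 1
    by (rule full_commutant)
  note N_eq = full_commutant_N
  obtain P where P: "minpartition (local_ops ?L1) 1 P"
    "entropy (local_algebra ?L1) psi = (\<Sum>p\<in>P. eta (pr p))"
    "\<And>p. p \<in> P \<Longrightarrow> (\<Sum>w\<in>confs ?L1. ent p w w) = 1"
    by (rule local_entropy_partition[OF state, of ?L1, folded pr_def]) (simp, rule that)
  obtain Q where Q: "minpartition (local_ops ?L2) 1 Q"
    "entropy (local_algebra ?L2) psi = (\<Sum>q\<in>Q. eta (pr q))"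
    "\<And>q. q \<in> Q \<Longrightarrow> (\<Sum>w\<in>confs ?L2. ent q w w) = 1"
    by (rule local_entropy_partition[OF state, of ?L2, folded pr_def]) (simp, rule that)
  define h where "h q = shift (int n) q" for q :: "(int \<Rightarrow> 'd) fmat"
  have Pp: "p \<in> local_ops ?L1" "proj p" if "p \<in> P" for p
    using P(1) that by (auto simp: minpartition_def minproj_def)
  have PP: "finite P" "\<Sum>P = 1" "\<And>p p'. p \<in> P \<Longrightarrow> p' \<in> P \<Longrightarrow> p \<noteq> p' \<Longrightarrow> p * p' = 0"
    using P(1) by (auto simp: minpartition_def)
  have QQ: "finite Q" "\<Sum>Q = 1" "\<And>q q'. q \<in> Q \<Longrightarrow> q' \<in> Q \<Longrightarrow> q \<noteq> q' \<Longrightarrow> q * q' = 0"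
    using Q(1) by (auto simp: minpartition_def)
  have Qq: "q \<in> local_ops ?L2" "proj q" if "q \<in> Q" for q
    using Q(1) that by (auto simp: minpartition_def minproj_def)
  have hq: "h q \<in> local_ops ?L2'" "proj (h q)" if "q \<in> Q" for q
    using shift_local[OF Qq(1)[OF that], of "int n"] Qq(2)[OF that]
    unfolding h_def image_shift_interval by (auto simp: proj_def shift_star shift_mult[symmetric])
  have horth: "h q * h q' = 0" if "q \<in> Q" "q' \<in> Q" "q \<noteq> q'" for q q'
    using QQ(3)[OF that] by (simp add: h_def shift_mult[symmetric] shift_zero)
  have hsum: "(\<Sum>q\<in>Q. h q) = 1"
    using QQ(2) shift_sum[of "int n" "\<lambda>q. q" Q] by (simp add: h_def shift_one)
  have pM: "p \<in> local_ops ?L" if "p \<in> P" for p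
    using Pp(1)[OF that] local_ops_mono[of ?L1 ?L] by auto
  have hM: "h q \<in> local_ops ?L" if "q \<in> Q" for q
    using hq(1)[OF that] local_ops_mono[of ?L2' ?L] by auto
  have comm: "p * h q = h q * p" if "p \<in> P" "q \<in> Q" for p q
    by (rule mult_commute_disjoint[OF Pp(1)[OF that(1)] hq(1)[OF that(2)] disj])
  have prod4: "p * h q * (p' * h q') = (p * p') * (h q * h q')" if "p' \<in> P" "q \<in> Q" for p q p' q'
    using comm[OF that] by (metis mult.assoc)
  have R: "p * h q \<in> local_ops ?L" "proj (p * h q)" "rk (p * h q) \<le> 1" if "p \<in> P" "q \<in> Q" for p q
  proof -
    show M: "p * h q \<in> local_ops ?L"
      using pM[OF that(1)] hM[OF that(2)] by (rule M_mult)
    show "proj (p * h q)"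
      using prod4[OF that(1,2), of p q] comm[OF that] Pp(2)[OF that(1)] hq(2)[OF that(2)] by (simp add: proj_def)
    have "tr (p * h q) = (\<Sum>w\<in>confs ?L1. ent p w w) * (\<Sum>w\<in>confs ?L2'. ent (h q) w w)"
      unfolding tr_def
      by (rule trace_mult_disjoint[OF Pp(1)[OF that(1)] hq(1)[OF that(2)] disj, folded un]) simp_all
    also have "(\<Sum>w\<in>confs ?L2'. ent (h q) w w) = (\<Sum>w\<in>confs ?L2. ent q w w)"
      using trace_shift[where k = "int n" and L = ?L2 and A = q] unfolding h_def image_shift_interval .
    finally have "tr (p * h q) = 1"
      using P(3)[OF that(1)] Q(3)[OF that(2)] by simp
    then show "rk (p * h q) \<le> 1"
      unfolding rk_def by simp
  qed
  have one: "(\<Sum>(p, q)\<in>P \<times> Q. p * h q) = 1"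
    using PP(2) hsum by (simp add: sum.cartesian_product[symmetric] sum_product[symmetric])
  \<comment> \<open>The products have rank at most one, so the refinement term is
    \<open>ln 1 = 0\<close>.\<close>
  have "entropy (ent ` local_ops ?L) psi \<le> (\<Sum>i\<in>P \<times> Q. eta (pr (case i of (p, q) \<Rightarrow> p * h q))) + ln (real 1)"
  proof (rule entropy_le_coarse[unfolded N_eq])
    show "finite (P \<times> Q)"
      using PP(1) QQ(1) by simp
    show "(case i of (p, q) \<Rightarrow> p * h q) \<in> local_ops ?L \<and> proj (case i of (p, q) \<Rightarrow> p * h q) \<and>
        rk (case i of (p, q) \<Rightarrow> p * h q) \<le> 1" if "i \<in> P \<times> Q" for i
      using R that by auto
    show "(case i of (p, q) \<Rightarrow> p * h q) * (case j of (p, q) \<Rightarrow> p * h q) = 0"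
      if "i \<in> P \<times> Q" "j \<in> P \<times> Q" "i \<noteq> j" for i j
      using that PP(3) horth prod4 by (auto; metis mult_zero_left mult_zero_right)
  qed (use one in auto)
  also have "\<dots> = (\<Sum>p\<in>P. \<Sum>q\<in>Q. eta (pr (p * h q)))"
    by (simp add: sum.cartesian_product split_def)
  also have "\<dots> \<le> (\<Sum>p\<in>P. eta (\<Sum>q\<in>Q. pr (p * h q))) + (\<Sum>q\<in>Q. eta (\<Sum>p\<in>P. pr (p * h q)))"
  proof (rule eta_subadditive[OF PP(1) QQ(1)])
    show "0 \<le> pr (p * h q)" if "p \<in> P" "q \<in> Q" for p q
      using psi_proj(2)[OF R(1,2)[OF that]] .
    have "(\<Sum>p\<in>P. \<Sum>q\<in>Q. pr (p * h q)) = pr (\<Sum>(p, q)\<in>P \<times> Q. p * h q)"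
      using R(1) by (subst pr_sum) (auto simp: sum.cartesian_product split_def)
    then show "(\<Sum>p\<in>P. \<Sum>q\<in>Q. pr (p * h q)) = 1"
      unfolding one pr_one .
  qed
  also have "(\<Sum>p\<in>P. eta (\<Sum>q\<in>Q. pr (p * h q))) = (\<Sum>p\<in>P. eta (pr p))"
  proof (rule sum.cong[OF refl])
    fix p assume "p \<in> P"
    then have "(\<Sum>q\<in>Q. pr (p * h q)) = pr (p * (\<Sum>q\<in>Q. h q))"
      unfolding sum_distrib_left using R(1) by (intro pr_sum[symmetric]) auto
    then show "eta (\<Sum>q\<in>Q. pr (p * h q)) = eta (pr p)"
      by (simp add: hsum)
  qed
  also have "(\<Sum>q\<in>Q. eta (\<Sum>p\<in>P. pr (p * h q))) = (\<Sum>q\<in>Q. eta (pr q))"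
  proof (rule sum.cong[OF refl])
    fix q assume q: "q \<in> Q"
    then have "(\<Sum>p\<in>P. pr (p * h q)) = pr (\<Sum>P * h q)"
      unfolding sum_distrib_right using R(1) by (intro pr_sum[symmetric]) auto
    \<comment> \<open>Translation invariance enters here: the second marginal refers to the shifted
      block.\<close>
    also have "\<dots> = pr q"
      using shift_invariant[OF fc Qq(1)[OF q], of "int n"] PP(2) by (simp add: h_def pr_def)
    finally show "eta (\<Sum>p\<in>P. pr (p * h q)) = eta (pr q)"
      by simp
  qed
  finally show ?thesis
    using P(2) Q(2) by (simp only: ent_local_ops finite_atLeastAtMost_int)
qed

text \<open>The limit is the infimum \<open>l\<close> of the quotients. Pick \<open>m\<close> whose
  quotient is within \<open>e / 2\<close> of \<open>l\<close> and divide \<open>n\<close> by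
  \<open>m\<close> with remainder: subadditivity gives
  \<open>a n / n \<le> a m / m + c / n\<close>.\<close>

lemma fekete:
  fixes a :: "nat \<Rightarrow> real"
  assumes sub: "\<And>n m. a (n + m) \<le> a n + a m" and nn: "\<And>n. 0 \<le> a n"
  shows "convergent (\<lambda>n. a n / real n)"
proof -
  define l where "l = (INF n\<in>{1..}. a n / real n)"
  have bdd: "bdd_below ((\<lambda>n. a n / real n) ` {1..})"
    using nn by (intro bdd_belowI[of _ 0]) auto
  have lower: "l \<le> a n / real n" if "1 \<le> n" for n
    unfolding l_def using that by (intro cINF_lower[OF bdd]) auto
  have mult: "a (q * m + r) \<le> real q * a m + a r" for q m r
  proof (induction q)
    case (Suc q)
    have "a (Suc q * m + r) \<le> a m + a (q * m + r)"
      using sub[of m "q * m + r"] by (simp add: add.assoc)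
    with Suc show ?case
      by (simp add: algebra_simps)
  qed simp
  have "(\<lambda>n. a n / real n) \<longlonglongrightarrow> l"
  proof (rule LIMSEQ_I)
    fix e :: real assume e: "0 < e"
    have "(INF n\<in>{1..}. a n / real n) < l + e / 2"
      using e by (simp add: l_def)
    then obtain m where m: "1 \<le> m" "a m / real m < l + e / 2"
      by (subst (asm) cINF_less_iff[OF _ bdd]) auto
    \<comment> \<open>A bound for all remainders at once; by nonnegativity the sum dominates each
      term.\<close>
    define c where "c = (\<Sum>r<m. a r)"
    obtain n0 where n0: "c / (e / 2) < real n0"
      using reals_Archimedean2 by blast
    have "norm (a n / real n - l) < e" if n: "Suc n0 \<le> n" for n
    proof -
      have npos: "0 < real n"
        using n by simp
      have "a (n mod m) \<le> c"
        unfolding c_def using m(1) nn by (intro member_le_sum) auto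
      moreover have "a n \<le> real (n div m) * a m + a (n mod m)"
        using mult[of "n div m" m "n mod m"] by simp
      moreover have "real (n div m) * a m \<le> real n / real m * a m"
      proof -
      have "real (n div m) * real m \<le> real n"
        unfolding of_nat_mult[symmetric] of_nat_le_iff by (rule div_times_less_eq_dividend)
      then have "real (n div m) \<le> real n / real m"
        using m(1) by (simp add: pos_le_divide_eq)
      then show ?thesis
        using nn by (intro mult_right_mono)
    qed
      ultimately have "a n \<le> real n * (a m / real m) + c"
        by simp
      then have "a n / real n \<le> a m / real m + c / real n"
        using npos by (simp add: field_simps)
      moreover have "c / real n < e / 2"
      proof -
        have "c / (e / 2) < real n"
          using n0 n by linarith
        then show ?thesis
          using e npos by (simp add: field_simps)
      qed
      ultimately have "a n / real n < l + e"
        using m(2) by linarith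
      then show ?thesis
        using lower[of n] n e by (simp add: abs_less_iff)
    qed
    then show "\<exists>no. \<forall>n\<ge>no. norm (a n / real n - l) < e"
      by blast
  qed
  then show ?thesis
    by (rule convergentI)
qed

text \<open>The state enters only through its values on \<open>N\<close> in the description of the
  density. Hence \<open>markov_chain\<close>, a restriction, has the same local entropies as the
  state it restricts.\<close>

lemma entropy_cong: "(\<And>K. K \<in> N \<Longrightarrow> psi K = psi' K) \<Longrightarrow> entropy N psi = entropy N psi'"
  by (simp add: entropy_def density_def cong: ball_cong)

text \<open>The right-hand side is \<open>ln r\<close> for the orbit bound \<open>r\<close>, a power
  of \<open>card L + 1\<close> with exponent \<open>d^2\<close>.\<close>

lemma gauge_entropy_bounds:
  fixes G :: "(complex^'d::finite^'d) set" and psi :: "'d kernel \<Rightarrow> complex"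
  assumes G: "subgroup G unitary_group" and psi: "state_on tensor_algebra psi" and L: "finite L"
  shows "\<bar>entropy (gauge_local_algebra G L) psi - entropy (local_algebra L) psi\<bar> \<le>
    real (CARD('d) * CARD('d)) * ln (real (card L) + 1)"
proof -
  let ?r = "(card L + 1) ^ (CARD('d) * CARD('d))"
  interpret sector_state "confs L" "local_ops L" psi
    by (rule local_sector_state[OF psi L])
  interpret commutant "confs L" "local_ops L" "gauge_unitaries G L"
    by (rule gauge_commutant[OF G L])
  interpret bounded_commutant "confs L" "local_ops L" psi "gauge_unitaries G L" ?r
    by unfold_locales (use gauge_orbit_bound[OF L] in simp_all)
  have "ln (real ?r) = real (CARD('d) * CARD('d)) * ln (real (card L) + 1)"
    by (simp add: ln_realpow add.commute)
  then show ?thesis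
    using full_entropy_le entropy_le_full
    unfolding gauge_commutant_N[OF G L] ent_local_ops[OF L] by linarith
qed

theorem corollary2p4:
  fixes G :: "(complex^'d::finite^'d) set"
    and E :: "complex^('d \<times> 'd)^('d \<times> 'd) \<Rightarrow> complex^'d^'d"
    and \<rho> :: "complex^'d^'d \<Rightarrow> complex"
    and \<phi>t :: "'d kernel \<Rightarrow> complex"
  assumes "subgroup G unitary_group"
    and "covariant G E"
    and "finitely_correlated E \<rho> \<phi>t"
  shows "convergent (entropy_rate local_algebra \<phi>t) \<and>
         convergent (entropy_rate (gauge_local_algebra G) (markov_chain G \<phi>t)) \<and>
         mean_entropy (gauge_local_algebra G) (markov_chain G \<phi>t) =
         mean_entropy local_algebra \<phi>t"
proof -
  note G = assms(1)
  have state: "state_on tensor_algebra \<phi>t"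
    using assms(3) by (simp add: finitely_correlated_def)
  let ?a = "\<lambda>n. entropy (local_algebra {1..int n}) \<phi>t"
  let ?b = "\<lambda>n. entropy (gauge_local_algebra G {1..int n}) (markov_chain G \<phi>t)"
  let ?k = "real (CARD('d) * CARD('d))"
  have nonneg: "0 \<le> ?a n" for n
  proof -
    interpret sector_state "confs {1..int n}" "local_ops {1..int n}" \<phi>t
      by (rule local_sector_state[OF state]) simp
    interpret bounded_commutant "confs {1..int n}" "local_ops {1..int n}" \<phi>t "{1}" 1
      by (rule full_commutant)
    show ?thesis
      using entropy_nonneg unfolding full_commutant_N by (simp add: ent_local_ops)
  qed
  have "convergent (entropy_rate local_algebra \<phi>t)"
    unfolding entropy_rate_def by (rule fekete[OF local_entropy_subadditive[OF assms(3)] nonneg])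
  then obtain l where l: "entropy_rate local_algebra \<phi>t \<longlonglongrightarrow> l"
    by (auto simp: convergent_def)
  have b: "?b n = entropy (gauge_local_algebra G {1..int n}) \<phi>t" for n
    using gauge_local_algebra_gauge_algebra[OF G, of "{1..int n}"]
    by (intro entropy_cong) (auto simp: markov_chain_def)
  have bound: "\<bar>?b n - ?a n\<bar> \<le> ?k * ln (real n + 1)" for n
    using gauge_entropy_bounds[OF G state, of "{1..int n}"] by (simp add: b)
  have "(\<lambda>n. entropy_rate (gauge_local_algebra G) (markov_chain G \<phi>t) n - entropy_rate local_algebra \<phi>t n) \<longlonglongrightarrow> 0"
  proof (rule Lim_null_comparison)
    show "(\<lambda>n. ?k * (ln (real n + 1) / real n)) \<longlonglongrightarrow> 0"
      by real_asymp
    show "\<forall>\<^sub>F n in sequentially. norm (entropy_rate (gauge_local_algebra G) (markov_chain G \<phi>t) n -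
        entropy_rate local_algebra \<phi>t n) \<le> ?k * (ln (real n + 1) / real n)"
    \<comment> \<open>Even \<open>n = 0\<close> is harmless: division by zero yields
      \<open>0\<close> on both sides.\<close>
    proof (rule always_eventually, rule allI)
      fix n
      have "norm (?b n / real n - ?a n / real n) = \<bar>?b n - ?a n\<bar> / real n"
        by (simp add: diff_divide_distrib[symmetric])
      also have "\<dots> \<le> ?k * ln (real n + 1) / real n"
        using bound by (intro divide_right_mono) simp_all
      finally show "norm (entropy_rate (gauge_local_algebra G) (markov_chain G \<phi>t) n -
        entropy_rate local_algebra \<phi>t n) \<le> ?k * (ln (real n + 1) / real n)"
        by (simp add: entropy_rate_def)
    qed
  qed
  from tendsto_add[OF this l]
  have "entropy_rate (gauge_local_algebra G) (markov_chain G \<phi>t) \<longlonglongrightarrow> l"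
    by simp
  then show ?thesis
    using l by (auto simp: convergent_def mean_entropy_def limI)
qed

end
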